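(* Let $p\in(0,1)$ and $\delta=1+\frac{d(1-p)}{2p}$. For every $h\in\mathbb{R}$ there exist positive constants $a_h$ and $b_h$ (depending only on $h$, $p$ and $d$) such that for all positive $w\in C^\infty(\mathbb{R}^d_+)$, $$\|w\|_{L^{1+p}(\mathbb{R}^d_+)}^{1+p}\le\left[a_h\,\|\nabla w\|_{L^2(\mathbb{R}^d_+)}\,\|w\|_{L^{2p}(\mathbb{R}^d_+)}^{p}-h\,b_h\,\|w\|_{L^{1+p}(\partial\mathbb{R}^d_+)}^{1+p}\right]\left(\frac{\|w\|_{L^{2p}(\mathbb{R}^d_+)}}{\|\nabla w\|_{L^2(\mathbb{R}^d_+)}}\right)^{1/\delta},$$ and, furthermore, there is equality when $w(x)=(\beta_h-\|x+he\|^2)_+^{1/(1-p)}$, where $\beta_h$ is such that $$\int_{\mathbb{R}^d_+}\left[\frac{1-p}{2p}\,\big(\beta_h-\|x+he\|^2\big)_+\right]^{2p/(1-p)}dx=1 .$$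
   Context: $\mathbb{R}^d_+=\mathbb{R}^{d-1}\times[0,\infty)$ is the closed half space and $e$ is the $d$-th unit vector of $\mathbb{R}^d$ (orthogonal to $\partial\mathbb{R}^d_+$). Functions in $C^\infty(\mathbb{R}^d_+)$ are smooth up to the boundary and need not vanish there. $\|w\|_{L^q(\mathbb{R}^d_+)}=\left(\int_{\mathbb{R}^d_+}|w|^q\right)^{1/q}$ with Lebesgue measure (a quasi-norm if $q<1$), and $\|w\|_{L^{q}(\partial\mathbb{R}^d_+)}$ is defined in the same way with the $(d-1)$-dimensional Hausdorff measure on $\partial\mathbb{R}^d_+$; $s_+=\max(s,0)$. The inequality is understood for functions $w$ for which the norms appearing in it are finite. *)

theory Defs
  imports "HOL-Analysis.Analysis"
begin

text \<open>The space R^d is an arbitrary Euclidean space \<open>'a\<close> with d = DIM('a), and its d-th unit vector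
  is a fixed element \<open>e\<close> of the orthonormal basis \<open>Basis\<close>.\<close>

definition half_space :: "'a::euclidean_space \<Rightarrow> 'a set" where
  "half_space e = {x. x \<bullet> e \<ge> 0}"

definition half_space_bd :: "'a::euclidean_space \<Rightarrow> 'a set" where
  "half_space_bd e = {x. x \<bullet> e = 0}"


text \<open>Hausdorff measure with the usual normalisation, under which it agrees with Lebesgue measure
  on m-dimensional subspaces. Nonempty sets have weight \<open>unit_ball_vol m * (diameter / 2) ^ m\<close>;
  since \<open>0 ^ 0 = 1\<close>, the case m = 0 is counting measure. The boundedness condition on the covering
  sets is needed because \<open>diameter\<close> is unspecified on unbounded sets.\<close>

definition hausdorff_weight :: "nat \<Rightarrow> 'a::metric_space set \<Rightarrow> ennreal" where
  "hausdorff_weight m C =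
     (if C = {} then 0 else ennreal (unit_ball_vol (real m) * (diameter C / 2) ^ m))"

definition hausdorff_premeasure :: "nat \<Rightarrow> real \<Rightarrow> 'a::metric_space set \<Rightarrow> ennreal" where
  "hausdorff_premeasure m r A =
     (INF C \<in> {C :: nat \<Rightarrow> 'a set. A \<subseteq> (\<Union>i. C i) \<and> (\<forall>i. bounded (C i) \<and> diameter (C i) \<le> r)}.
        \<Sum>i. hausdorff_weight m (C i))"

definition hausdorff_outer :: "nat \<Rightarrow> 'a::metric_space set \<Rightarrow> ennreal" where
  "hausdorff_outer m A = (SUP r \<in> {0<..}. hausdorff_premeasure m r A)"

text \<open>\<open>hausdorff_outer m\<close> is a metric outer measure, hence countably additive on the Borel sets, so
  the value on Borel sets is \<open>hausdorff_outer m\<close> (and not the default 0 of \<open>measure_of\<close>).\<close>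

definition hausdorff_measure :: "nat \<Rightarrow> 'a::metric_space measure" where
  "hausdorff_measure m = measure_of UNIV (sets borel) (hausdorff_outer m)"


text \<open>For 0 < q < 1 this is only a quasi-norm. It is meaningful only for functions satisfying
  \<open>Lq_finite\<close>, the Bochner integral being 0 otherwise.\<close>

definition Lq_finite ::
    "'a measure \<Rightarrow> 'a set \<Rightarrow> real \<Rightarrow> ('a \<Rightarrow> 'b::real_normed_vector) \<Rightarrow> bool" where
  "Lq_finite M S q f \<longleftrightarrow> set_integrable M S (\<lambda>x. norm (f x) powr q)"

definition Lq_norm ::
    "'a measure \<Rightarrow> 'a set \<Rightarrow> real \<Rightarrow> ('a \<Rightarrow> 'b::real_normed_vector) \<Rightarrow> real" where
  "Lq_norm M S q f = (LINT x:S|M. norm (f x) powr q) powr (1 / q)"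


text \<open>Smoothness up to the boundary: all iterated derivatives relative to \<open>S\<close> exist and are
  continuous on \<open>S\<close>. The definitions of \<open>Ck_on\<close>, \<open>smooth_on\<close> and \<open>grad_on\<close> are meant for sets such as
  half spaces, where the derivative relative to \<open>S\<close> is unique at each point of \<open>S\<close>. Values outside
  \<open>S\<close> are irrelevant.\<close>

primrec Ck_on :: "nat \<Rightarrow> 'a::euclidean_space set \<Rightarrow> ('a \<Rightarrow> real) \<Rightarrow> bool" where
  "Ck_on 0 S f \<longleftrightarrow> continuous_on S f"
| "Ck_on (Suc n) S f \<longleftrightarrow> f differentiable_on S \<and>
     (\<forall>v. Ck_on n S (\<lambda>x. frechet_derivative f (at x within S) v))"

definition smooth_on :: "'a::euclidean_space set \<Rightarrow> ('a \<Rightarrow> real) \<Rightarrow> bool" where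
  "smooth_on S f \<longleftrightarrow> (\<forall>n. Ck_on n S f)"

definition grad_on :: "'a::euclidean_space set \<Rightarrow> ('a \<Rightarrow> real) \<Rightarrow> 'a \<Rightarrow> 'a" where
  "grad_on S f x = (\<Sum>i\<in>Basis. frechet_derivative f (at x within S) i *\<^sub>R i)"


definition trace_norms_finite :: "real \<Rightarrow> 'a::euclidean_space \<Rightarrow> ('a \<Rightarrow> real) \<Rightarrow> bool" where
  "trace_norms_finite p e w \<longleftrightarrow>
     Lq_finite lborel (half_space e) (1 + p) w \<and>
     Lq_finite lborel (half_space e) 2 (grad_on (half_space e) w) \<and>
     Lq_finite lborel (half_space e) (2 * p) w \<and>
     Lq_finite (hausdorff_measure (DIM('a) - 1)) (half_space_bd e) (1 + p) w"

definition trace_GN_lhs :: "real \<Rightarrow> 'a::euclidean_space \<Rightarrow> ('a \<Rightarrow> real) \<Rightarrow> real" where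
  "trace_GN_lhs p e w = Lq_norm lborel (half_space e) (1 + p) w powr (1 + p)"

definition trace_GN_rhs ::
    "real \<Rightarrow> real \<Rightarrow> real \<Rightarrow> real \<Rightarrow> real \<Rightarrow> 'a::euclidean_space \<Rightarrow> ('a \<Rightarrow> real) \<Rightarrow> real" where
  "trace_GN_rhs p \<delta> h a b e w =
     (a * Lq_norm lborel (half_space e) 2 (grad_on (half_space e) w)
        * Lq_norm lborel (half_space e) (2 * p) w powr p
      - h * b * Lq_norm (hausdorff_measure (DIM('a) - 1)) (half_space_bd e) (1 + p) w powr (1 + p))
     * (Lq_norm lborel (half_space e) (2 * p) w
        / Lq_norm lborel (half_space e) 2 (grad_on (half_space e) w)) powr (1 / \<delta>)"

definition extremal :: "real \<Rightarrow> real \<Rightarrow> 'a::euclidean_space \<Rightarrow> real \<Rightarrow> 'a \<Rightarrow> real" where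
  "extremal p h e \<beta> x = max (\<beta> - (norm (x + h *\<^sub>R e))\<^sup>2) 0 powr (1 / (1 - p))"

definition extremal_normalized :: "real \<Rightarrow> real \<Rightarrow> 'a::euclidean_space \<Rightarrow> real \<Rightarrow> bool" where
  "extremal_normalized p h e \<beta> \<longleftrightarrow>
     (LINT x:half_space e|lborel.
        ((1 - p) / (2 * p) * max (\<beta> - (norm (x + h *\<^sub>R e))\<^sup>2) 0) powr (2 * p / (1 - p))) = 1"

end

theory Submission
  imports Defs
begin

text \<open>
  With \<open>q = 2 p / (1 - p)\<close> and \<open>u = w powr (1 - p)\<close> the integrals of \<open>w powr (2 p)\<close>, \<open>w powr (1 + p)\<close> and
  \<open>(norm (grad w))\<^sup>2\<close> are, up to a constant, those of \<open>u powr q\<close>, \<open>u powr (q + 1)\<close> and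
  \<open>u powr q * (norm (grad u))\<^sup>2\<close>, and the extremal becomes the concave profile
  \<open>V = max 0 (\<beta> - (norm (x + h e))\<^sup>2)\<close>.  If \<open>u powr q\<close> and \<open>v powr q\<close> have equal integrals and
  \<open>K ((1 - t) x + t y) \<ge> (1 - t) u x + t v y\<close>, then the integral of \<open>K powr (q + 1)\<close> is at least
  \<open>1 - t\<close> times that of \<open>u powr (q + 1)\<close> plus \<open>t\<close> times that of \<open>v powr (q + 1)\<close>.  Take a rescaled \<open>V\<close>
  for \<open>v\<close> and differentiate at \<open>t = 0\<close>: Legendre duality turns the supremum over \<open>y\<close> into
  \<open>(norm (grad u))\<^sup>2\<close>, and integrating \<open>grad (u powr (q + 1))\<close> against \<open>x + h e\<close> by parts produces the trace
  term.  The inequality is an equality for \<open>u = V\<close>, and choosing the two scaling parameters so that \<open>v\<close>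
  matches the mass and the Dirichlet norm of \<open>u\<close> gives the theorem.
\<close>

section \<open>Prekopa--Leindler and Borell--Brascamp--Lieb inequalities\<close>

text \<open>Equal masses are what allows plain arithmetic means with no dimensional exponent: after
  division by the common mass the slice functions have the same supremum 1, so that all their
  superlevel sets below 1 are nonempty and the sharp inequality on the line applies. Equality of the
  masses is one relation between the scaling parameters \<open>k\<close> and \<open>s\<close>. In
  terms of \<open>r = k * s\<close> the bound is \<open>1 / s\<close> times an expression free of
  \<open>s\<close>, whose trace term has the fixed coefficient \<open>h / c\<close>. Equal Dirichlet
  norms then fix \<open>r\<close>, the mass relation fixes \<open>s\<close>, and
  \<open>1 / s\<close> becomes the factor with exponent \<open>1 / \<delta>\<close>. Nothing is
  optimised, and for the extremal itself \<open>k = s = 1\<close>. The comparison is carried out for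
  compactly supported \<open>u\<close>, which a positive \<open>w\<close> never provides; hence a
  truncation and a cutoff come before the parameters are chosen. Surface measure times length along
  the normal is identified with Lebesgue measure only up to a factor \<open>c\<close>. This factor
  enters the inequality and the equality case alike and is absorbed into the constant in front of
  the trace.\<close>

lemma emeasure_lborel_real_affine_preimage:
  fixes A :: "real set"
  assumes "A \<in> sets borel" "c > 0"
  shows "emeasure lborel {z. (z - b) / c \<in> A} = ennreal c * emeasure lborel A"
proof -
  have m: "{z. (z - b) / c \<in> A} \<in> sets borel"
    using assms by measurable
  have v: "(\<lambda>x. b + c * x) -` {z. (z - b) / c \<in> A} = A"
    using assms by auto
  have "emeasure lborel {z. (z - b) / c \<in> A} =
      emeasure (density (distr lborel borel (\<lambda>x. b + c * x)) (\<lambda>_. ennreal \<bar>c\<bar>)) {z. (z - b) / c \<in> A}"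
    using lborel_real_affine[of c b] assms by simp
  also have "\<dots> = ennreal c * emeasure lborel A"
    using m assms by (simp add: emeasure_density nn_integral_cmult emeasure_distr v)
  finally show ?thesis .
qed

text \<open>A copy of (1 - t) A shifted by t b and a copy of t B shifted by (1 - t) a both lie in
  \<open>C\<close>. If a were the maximum of A and b the minimum of B, they would meet only at (1 -
  t) a + t b. The sets are merely bounded, so a and b are taken within \<open>r\<close> of the
  supremum and the infimum, at the cost of strips of total weighted length at most
  \<open>r\<close>.\<close>

lemma brunn_minkowski_real:
  fixes A B C :: "real set"
  assumes [measurable]: "A \<in> sets borel" "B \<in> sets borel" "C \<in> sets borel"
    and bd: "bounded A" "bounded B" and ne: "A \<noteq> {}" "B \<noteq> {}" and t: "0 < t" "t < 1"
    and sub: "\<And>x y. x \<in> A \<Longrightarrow> y \<in> B \<Longrightarrow> (1 - t) * x + t * y \<in> C"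
  shows "ennreal (1 - t) * emeasure lborel A + ennreal t * emeasure lborel B \<le> emeasure lborel C"
proof (rule ennreal_le_epsilon)
  fix r :: real assume r: "0 < r"
  have bA: "bdd_above A" "bdd_below B"
    using bd by (auto simp: bounded_imp_bdd_above bounded_imp_bdd_below)
  obtain a where a: "a \<in> A" "Sup A - r < a"
    using less_cSup_iff[OF ne(1) bA(1), of "Sup A - r"] r by auto
  obtain b where b: "b \<in> B" "b < Inf B + r"
    using cInf_less_iff[OF ne(2) bA(2), of "Inf B + r"] r by auto
  define A1 where "A1 = A \<inter> {..a}"
  define B1 where "B1 = B \<inter> {b<..}"
  have [measurable]: "A1 \<in> sets borel" "B1 \<in> sets borel"
    unfolding A1_def B1_def by measurable
  have "A \<subseteq> A1 \<union> {a..Sup A}"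
    using bA(1) by (auto simp: A1_def intro: cSup_upper)
  then have "emeasure lborel A \<le> emeasure lborel (A1 \<union> {a..Sup A})"
    by (intro emeasure_mono) auto
  also have "\<dots> \<le> emeasure lborel A1 + emeasure lborel {a..Sup A}"
    by (intro emeasure_subadditive) auto
  also have "emeasure lborel {a..Sup A} \<le> ennreal r"
    using a by (auto simp: emeasure_lborel_Icc_eq ennreal_leI)
  finally have eA: "emeasure lborel A \<le> emeasure lborel A1 + ennreal r"
    by simp
  have "B \<subseteq> B1 \<union> {Inf B..b}"
    using bA(2) by (auto simp: B1_def intro: cInf_lower)
  then have "emeasure lborel B \<le> emeasure lborel (B1 \<union> {Inf B..b})"
    by (intro emeasure_mono) auto
  also have "\<dots> \<le> emeasure lborel B1 + emeasure lborel {Inf B..b}"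
    by (intro emeasure_subadditive) auto
  also have "emeasure lborel {Inf B..b} \<le> ennreal r"
    using b by (auto simp: emeasure_lborel_Icc_eq ennreal_leI)
  finally have eB: "emeasure lborel B \<le> emeasure lborel B1 + ennreal r"
    by simp
  \<comment> \<open>The two shifted copies; after the cut at \<open>a\<close> and at
    \<open>b\<close> one lies weakly to the left and the other strictly to the right of
    \<open>(1 - t) * a + t * b\<close>, so their measures add.\<close>
  define A2 where "A2 = {z. (z - t * b) / (1 - t) \<in> A1}"
  define B2 where "B2 = {z. (z - (1 - t) * a) / t \<in> B1}"
  have [measurable]: "A2 \<in> sets borel" "B2 \<in> sets borel"
    unfolding A2_def B2_def by measurable
  have e2: "emeasure lborel A2 = ennreal (1 - t) * emeasure lborel A1"
    "emeasure lborel B2 = ennreal t * emeasure lborel B1"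
    unfolding A2_def B2_def using t by (auto intro!: emeasure_lborel_real_affine_preimage)
  have A2: "A2 \<subseteq> C \<inter> {..(1 - t) * a + t * b}"
  proof
    fix z assume z: "z \<in> A2"
    define x where "x = (z - t * b) / (1 - t)"
    have "x \<in> A1" using z by (simp add: A2_def x_def)
    moreover have "z = (1 - t) * x + t * b"
      using t by (simp add: x_def)
    ultimately show "z \<in> C \<inter> {..(1 - t) * a + t * b}"
      using t b sub by (auto simp: A1_def)
  qed
  have B2: "B2 \<subseteq> C \<inter> {(1 - t) * a + t * b<..}"
  proof
    fix z assume z: "z \<in> B2"
    define x where "x = (z - (1 - t) * a) / t"
    have "x \<in> B1" using z by (simp add: B2_def x_def)
    moreover have "z = (1 - t) * a + t * x"
      using t by (simp add: x_def)
    ultimately show "z \<in> C \<inter> {(1 - t) * a + t * b<..}"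
      using t a sub by (auto simp: B1_def)
  qed
  have "ennreal (1 - t) * emeasure lborel A + ennreal t * emeasure lborel B \<le>
      ennreal (1 - t) * (emeasure lborel A1 + ennreal r) + ennreal t * (emeasure lborel B1 + ennreal r)"
    by (intro add_mono mult_left_mono eA eB) auto
  also have "\<dots> = (emeasure lborel A2 + emeasure lborel B2) + (ennreal (1 - t) * ennreal r + ennreal t * ennreal r)"
    by (simp add: e2 distrib_left ac_simps)
  also have "ennreal (1 - t) * ennreal r + ennreal t * ennreal r = ennreal r"
    using t r by (simp add: ennreal_mult[symmetric] ennreal_plus[symmetric] algebra_simps del: ennreal_plus)
  also have "emeasure lborel A2 + emeasure lborel B2 = emeasure lborel (A2 \<union> B2)"
    using A2 B2 by (intro plus_emeasure) fastforce+
  also have "\<dots> \<le> emeasure lborel C"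
    using A2 B2 by (intro emeasure_mono) auto
  finally show "ennreal (1 - t) * emeasure lborel A + ennreal t * emeasure lborel B \<le> emeasure lborel C + ennreal r"
    by simp
qed

text \<open>Fubini on the region below the graph of \<open>f\<close>. The weight \<open>w\<close> is
  present so that the integral of \<open>u powr (q + 1)\<close>, read as \<open>u powr q\<close>
  times \<open>u\<close>, can be sliced along the superlevel sets of \<open>u\<close>.\<close>

lemma nn_integral_layer_cake:
  fixes f w :: "'a \<Rightarrow> ennreal"
  assumes "sigma_finite_measure M"
    and [measurable]: "f \<in> borel_measurable M" "w \<in> borel_measurable M"
  shows "(\<integral>\<^sup>+x. w x * f x \<partial>M) =
    (\<integral>\<^sup>+s. indicator {0..} s * (\<integral>\<^sup>+x. w x * indicator {x. ennreal s < f x} x \<partial>M) \<partial>lborel)"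
proof -
  interpret sigma_finite_measure M by fact
  interpret pair_sigma_finite M "lborel :: real measure" ..
  have *: "f x = (\<integral>\<^sup>+s. indicator {0..} s * indicator {x. ennreal s < f x} x \<partial>lborel)" for x
  proof (cases "f x")
    case (real r)
    have "(\<integral>\<^sup>+s. indicator {0..} s * indicator {x. ennreal s < f x} x \<partial>lborel) =
        (\<integral>\<^sup>+s. indicator {0..<r} s \<partial>(lborel :: real measure))"
      using real by (intro nn_integral_cong) (auto split: split_indicator simp: ennreal_less_iff)
    also have "\<dots> = f x"
      using real by simp
    finally show ?thesis by simp
  next
    case top
    have "(\<integral>\<^sup>+s. indicator {0..} s * indicator {x. ennreal s < f x} x \<partial>lborel) =
        (\<integral>\<^sup>+s. indicator {0..} s \<partial>(lborel :: real measure))"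
      using top by (intro nn_integral_cong) (auto split: split_indicator)
    also have "\<dots> = emeasure lborel {0::real..}"
      by simp
    also have "\<dots> = \<infinity>"
    proof (rule ccontr)
      assume "emeasure lborel {0::real..} \<noteq> \<infinity>"
      then obtain r where r: "emeasure lborel {0::real..} = ennreal r" "0 \<le> r"
        by (cases "emeasure lborel {0::real..}") auto
      have "emeasure lborel {0..r + 1} \<le> emeasure lborel {0::real..}"
        by (intro emeasure_mono) auto
      then show False using r by simp
    qed
    finally show ?thesis using top by simp
  qed
  have "(\<integral>\<^sup>+x. w x * f x \<partial>M) =
     (\<integral>\<^sup>+x. (\<integral>\<^sup>+s. w x * (indicator {0..} s * indicator {x. ennreal s < f x} x) \<partial>lborel) \<partial>M)"
    by (subst *) (intro nn_integral_cong nn_integral_cmult[symmetric], measurable)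
  also have "\<dots> = (\<integral>\<^sup>+s. (\<integral>\<^sup>+x. w x * (indicator {0..} s * indicator {x. ennreal s < f x} x) \<partial>M) \<partial>lborel)"
    by (rule Fubini'[symmetric]) measurable
  also have "\<dots> = (\<integral>\<^sup>+s. indicator {0..} s * (\<integral>\<^sup>+x. w x * indicator {x. ennreal s < f x} x \<partial>M) \<partial>lborel)"
    by (intro nn_integral_cong, subst nn_integral_cmult[symmetric]) (auto simp: ac_simps)
  finally show ?thesis .
qed

text \<open>Both functions have supremum 1, so for every level in [0, 1) both superlevel sets are
  nonempty and the one-dimensional Brunn--Minkowski inequality applies level by level; integration
  over the levels finishes. The result is used twice: to prove Prekopa--Leindler on the line, and
  again for the slice functions of the equal mass inequality.\<close>

lemma nn_integral_min_real:
  fixes f g :: "real \<Rightarrow> real" and k :: "real \<Rightarrow> ennreal"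
  assumes [measurable]: "f \<in> borel_measurable borel" "g \<in> borel_measurable borel" "k \<in> borel_measurable borel"
    and f1: "\<And>x. f x \<le> 1" and g1: "\<And>x. g x \<le> 1"
    and bf: "bounded {x. 0 < f x}" and bg: "bounded {x. 0 < g x}"
    and sf: "\<And>s. s < 1 \<Longrightarrow> \<exists>x. s < f x" and sg: "\<And>s. s < 1 \<Longrightarrow> \<exists>x. s < g x"
    and t: "0 < t" "t < 1"
    and k: "\<And>x y. 0 < f x \<Longrightarrow> 0 < g y \<Longrightarrow> ennreal (min (f x) (g y)) \<le> k ((1 - t) * x + t * y)"
  shows "ennreal (1 - t) * (\<integral>\<^sup>+x. ennreal (f x) \<partial>lborel) + ennreal t * (\<integral>\<^sup>+x. ennreal (g x) \<partial>lborel)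
     \<le> (\<integral>\<^sup>+x. k x \<partial>lborel)"
proof -
  have lc: "(\<integral>\<^sup>+x. \<phi> x \<partial>lborel) = (\<integral>\<^sup>+s. indicator {0..} s * emeasure lborel {x. ennreal s < \<phi> x} \<partial>lborel)"
    if [measurable]: "\<phi> \<in> borel_measurable borel" for \<phi> :: "real \<Rightarrow> ennreal"
    using nn_integral_layer_cake[of "lborel :: real measure" \<phi> "\<lambda>_. 1"]
    by (simp add: lborel.sigma_finite_measure_axioms)
  have "ennreal (1 - t) * (indicator {0..} s * emeasure lborel {x. ennreal s < ennreal (f x)})
      + ennreal t * (indicator {0..} s * emeasure lborel {x. ennreal s < ennreal (g x)})
      \<le> indicator {0..} s * emeasure lborel {x. ennreal s < k x}" for s :: real
  proof (cases "0 \<le> s \<and> s < 1")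
    case True
    have eq: "{x. ennreal s < ennreal (f x)} = {x. s < f x}" "{x. ennreal s < ennreal (g x)} = {x. s < g x}"
      using True by (auto simp: ennreal_less_iff)
    have "ennreal (1 - t) * emeasure lborel {x. s < f x} + ennreal t * emeasure lborel {x. s < g x}
        \<le> emeasure lborel {x. ennreal s < k x}"
    proof (rule brunn_minkowski_real[OF _ _ _ _ _ _ _ t])
      show "bounded {x. s < f x}" "bounded {x. s < g x}"
        using True by (auto intro: bounded_subset[OF bf] bounded_subset[OF bg])
      show "{x. s < f x} \<noteq> {}" "{x. s < g x} \<noteq> {}"
        using sf[of s] sg[of s] True by auto
      fix x y assume xy: "x \<in> {x. s < f x}" "y \<in> {x. s < g x}"
      then have "ennreal s < ennreal (min (f x) (g y))"
        using True by (auto simp: ennreal_less_iff)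
      also have "\<dots> \<le> k ((1 - t) * x + t * y)"
        using xy True by (intro k) auto
      finally show "(1 - t) * x + t * y \<in> {x. ennreal s < k x}" by simp
    qed measurable
    then show ?thesis using True by (simp add: eq)
  next
    case False
    \<comment> \<open>Brunn--Minkowski would be false with an empty set, but for levels
      \<open>1 \<le> s\<close> both sets are empty and the left side vanishes; negative levels are
      removed by the indicator.\<close>
    have "emeasure lborel {x. ennreal s < ennreal (f x)} = 0" "emeasure lborel {x. ennreal s < ennreal (g x)} = 0"
      if "1 \<le> s"
    proof -
      have "{x. ennreal s < ennreal (f x)} = {}" "{x. ennreal s < ennreal (g x)} = {}"
        using that f1 g1 order_trans[OF f1 that] order_trans[OF g1 that]
        by (auto simp: not_less ennreal_leI)
      then show "emeasure lborel {x. ennreal s < ennreal (f x)} = 0" "emeasure lborel {x. ennreal s < ennreal (g x)} = 0"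
        by simp_all
    qed
    then show ?thesis using False by (auto split: split_indicator)
  qed
  note le = this
  have "ennreal (1 - t) * (\<integral>\<^sup>+x. ennreal (f x) \<partial>lborel) + ennreal t * (\<integral>\<^sup>+x. ennreal (g x) \<partial>lborel) =
    (\<integral>\<^sup>+s. ennreal (1 - t) * (indicator {0..} s * emeasure lborel {x. ennreal s < ennreal (f x)})
      + ennreal t * (indicator {0..} s * emeasure lborel {x. ennreal s < ennreal (g x)}) \<partial>lborel)"
    unfolding lc[of "\<lambda>x. ennreal (f x)", simplified] lc[of "\<lambda>x. ennreal (g x)", simplified]
    by (subst nn_integral_add) (auto simp: nn_integral_cmult)
  also have "\<dots> \<le> (\<integral>\<^sup>+s. indicator {0..} s * emeasure lborel {x. ennreal s < k x} \<partial>lborel)"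
    by (intro nn_integral_mono le)
  also have "\<dots> = (\<integral>\<^sup>+x. k x \<partial>lborel)"
    by (rule lc[symmetric]) measurable
  finally show ?thesis .
qed

section \<open>The Prekopa--Leindler inequality, first on the line and then in all
  dimensions\<close>

lemma min_le_geometric_mean:
  fixes a b t :: real
  assumes "0 \<le> a" "0 \<le> b" "0 < t" "t < 1"
  shows "min a b \<le> a powr (1 - t) * b powr t"
proof (cases "a = 0 \<or> b = 0")
  case False
  have "min a b = min a b powr (1 - t) * min a b powr t"
    using False assms by (simp add: powr_add[symmetric])
  also have "\<dots> \<le> a powr (1 - t) * b powr t"
    using assms False by (intro mult_mono powr_mono2) auto
  finally show ?thesis .
qed (use assms in auto)

lemma ennreal_mult_inverse_le_iff:
  assumes "0 < c" "0 \<le> a" "ennreal (a / c) \<le> ennreal (1 / c) * x"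
  shows "ennreal a \<le> x"
proof -
  have "ennreal a = ennreal c * ennreal (a / c)"
    using assms by (simp add: ennreal_mult[symmetric])
  also have "\<dots> \<le> ennreal c * (ennreal (1 / c) * x)"
    by (intro mult_left_mono assms) simp
  also have "\<dots> = (ennreal c * ennreal (1 / c)) * x"
    by (simp add: mult.assoc)
  also have "ennreal c * ennreal (1 / c) = 1"
    using assms by (simp add: ennreal_mult[symmetric])
  finally show ?thesis by simp
qed

text \<open>Dividing \<open>f\<close> and \<open>g\<close> by their suprema a and b gives functions
  with supremum 1, whose minimum is below their geometric mean, so the arithmetic bound for such
  functions applies to A / a and B / b. Weighted AM-GM turns it into a geometric mean, in which the
  factor \<open>c\<close> made of a and b cancels.\<close>

lemma prekopa_leindler_real:
  fixes f g :: "real \<Rightarrow> real" and k :: "real \<Rightarrow> ennreal"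
  assumes [measurable]: "f \<in> borel_measurable borel" "g \<in> borel_measurable borel" "k \<in> borel_measurable borel"
    and f: "\<And>x. 0 \<le> f x" "\<And>x. f x \<le> C" "\<And>x. f x \<noteq> 0 \<Longrightarrow> \<bar>x\<bar> \<le> R"
    and g: "\<And>x. 0 \<le> g x" "\<And>x. g x \<le> C" "\<And>x. g x \<noteq> 0 \<Longrightarrow> \<bar>x\<bar> \<le> R"
    and t: "0 < t" "t < 1"
    and k: "\<And>x y. ennreal (f x powr (1 - t) * g y powr t) \<le> k ((1 - t) * x + t * y)"
    and A: "(\<integral>\<^sup>+x. ennreal (f x) \<partial>lborel) = ennreal A" "0 \<le> A"
    and B: "(\<integral>\<^sup>+x. ennreal (g x) \<partial>lborel) = ennreal B" "0 \<le> B"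
  shows "ennreal (A powr (1 - t) * B powr t) \<le> (\<integral>\<^sup>+x. k x \<partial>lborel)"
proof (cases "A = 0 \<or> B = 0")
  case False
  then have AB: "0 < A" "0 < B" using A B by auto
  have ex: "\<exists>x. 0 < \<phi> x" if "(\<integral>\<^sup>+x. ennreal (\<phi> x) \<partial>lborel) = ennreal D" "0 < D" for \<phi> :: "real \<Rightarrow> real" and D
  proof (rule ccontr)
    assume "\<not> (\<exists>x. 0 < \<phi> x)"
    then have "ennreal (\<phi> x) = 0" for x
      by (auto simp: not_less ennreal_neg)
    with that show False by simp
  qed
  define a where "a = (SUP x. f x)"
  define b where "b = (SUP x. g x)"
  have bdd: "bdd_above (range f)" "bdd_above (range g)"
    using f(2) g(2) by (auto intro!: bdd_aboveI2)
  have le: "f x \<le> a" "g x \<le> b" for x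
    unfolding a_def b_def by (auto intro!: cSUP_upper bdd)
  have ab: "0 < a" "0 < b"
    using ex[OF A(1) AB(1)] ex[OF B(1) AB(2)] le by (auto intro: less_le_trans)
  define c where "c = a powr (1 - t) * b powr t"
  have c: "0 < c" using ab by (simp add: c_def)
  have "ennreal (1 - t) * (\<integral>\<^sup>+x. ennreal (f x / a) \<partial>lborel) + ennreal t * (\<integral>\<^sup>+x. ennreal (g x / b) \<partial>lborel)
     \<le> (\<integral>\<^sup>+x. ennreal (1 / c) * k x \<partial>lborel)"
  proof (rule nn_integral_min_real[OF _ _ _ _ _ _ _ _ _ t])
    show "f x / a \<le> 1" "g x / b \<le> 1" for x
      using le ab by simp_all
    have "x \<in> {-R..R}" if "0 < f x / a" for x
      using f(3)[of x] that by (cases "f x = 0") (auto simp: abs_le_iff)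
    then have "{x. 0 < f x / a} \<subseteq> {-R..R}" by blast
    then show "bounded {x. 0 < f x / a}" by (rule bounded_subset[rotated]) simp
    have "x \<in> {-R..R}" if "0 < g x / b" for x
      using g(3)[of x] that by (cases "g x = 0") (auto simp: abs_le_iff)
    then have "{x. 0 < g x / b} \<subseteq> {-R..R}" by blast
    then show "bounded {x. 0 < g x / b}" by (rule bounded_subset[rotated]) simp
    fix s :: real assume "s < 1"
    then have "s * a < a" "s * b < b" using ab by simp_all
    then show "\<exists>x. s < f x / a" "\<exists>x. s < g x / b"
      using less_cSUP_iff[OF _ bdd(1), of "s * a"] less_cSUP_iff[OF _ bdd(2), of "s * b"] ab
      by (auto simp: a_def[symmetric] b_def[symmetric] pos_less_divide_eq)
  next
    fix x y
    have "min (f x / a) (g y / b) \<le> (f x / a) powr (1 - t) * (g y / b) powr t"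
      using f g ab t by (intro min_le_geometric_mean) auto
    also have "\<dots> = 1 / c * (f x powr (1 - t) * g y powr t)"
      using f g ab by (simp add: powr_divide c_def)
    finally have "ennreal (min (f x / a) (g y / b)) \<le> ennreal (1 / c) * ennreal (f x powr (1 - t) * g y powr t)"
      using c by (simp add: ennreal_mult[symmetric] ennreal_leI)
    also have "\<dots> \<le> ennreal (1 / c) * k ((1 - t) * x + t * y)"
      by (intro mult_left_mono k) simp
    finally show "ennreal (min (f x / a) (g y / b)) \<le> ennreal (1 / c) * k ((1 - t) * x + t * y)" .
  qed measurable
  moreover have "(\<integral>\<^sup>+x. ennreal (f x / a) \<partial>lborel) = ennreal (A / a)"
    using ab f A by (simp add: divide_ennreal[symmetric] nn_integral_divide)
  moreover have "(\<integral>\<^sup>+x. ennreal (g x / b) \<partial>lborel) = ennreal (B / b)"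
    using ab g B by (simp add: divide_ennreal[symmetric] nn_integral_divide)
  moreover have "(\<integral>\<^sup>+x. ennreal (1 / c) * k x \<partial>lborel) = ennreal (1 / c) * (\<integral>\<^sup>+x. k x \<partial>lborel)"
    by (simp add: nn_integral_cmult)
  moreover have "ennreal (1 - t) * ennreal (A / a) + ennreal t * ennreal (B / b) = ennreal ((1 - t) * (A / a) + t * (B / b))"
    using t AB ab by (simp add: ennreal_mult[symmetric] ennreal_plus[symmetric] del: ennreal_plus)
  ultimately have "ennreal ((1 - t) * (A / a) + t * (B / b)) \<le> ennreal (1 / c) * (\<integral>\<^sup>+x. k x \<partial>lborel)"
    by simp
  moreover have "(A powr (1 - t) * B powr t) / c \<le> (1 - t) * (A / a) + t * (B / b)"
    using Youngs_inequality_0[of "1 - t" t "A / a" "B / b"] t AB ab by (simp add: powr_divide c_def)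
  ultimately have "ennreal ((A powr (1 - t) * B powr t) / c) \<le> ennreal (1 / c) * (\<integral>\<^sup>+x. k x \<partial>lborel)"
    using ennreal_leI order_trans by blast
  then show ?thesis
    by (rule ennreal_mult_inverse_le_iff[rotated 2]) (use c in auto)
qed auto

lemma prekopa_leindler_PiM:
  fixes f g :: "('i \<Rightarrow> real) \<Rightarrow> real" and k :: "('i \<Rightarrow> real) \<Rightarrow> ennreal"
  assumes "finite I"
    and "f \<in> borel_measurable (\<Pi>\<^sub>M i\<in>I. lborel)" "g \<in> borel_measurable (\<Pi>\<^sub>M i\<in>I. lborel)"
      "k \<in> borel_measurable (\<Pi>\<^sub>M i\<in>I. lborel)"
    and "\<And>x. 0 \<le> f x" "\<And>x. f x \<le> C" "\<And>x i. f x \<noteq> 0 \<Longrightarrow> i \<in> I \<Longrightarrow> \<bar>x i\<bar> \<le> R"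
    and "\<And>x. 0 \<le> g x" "\<And>x. g x \<le> C" "\<And>x i. g x \<noteq> 0 \<Longrightarrow> i \<in> I \<Longrightarrow> \<bar>x i\<bar> \<le> R"
    and t: "0 < t" "t < 1"
    and "\<And>x y. ennreal (f x powr (1 - t) * g y powr t) \<le> k (\<lambda>i\<in>I. (1 - t) * x i + t * y i)"
    and "(\<integral>\<^sup>+x. ennreal (f x) \<partial>(\<Pi>\<^sub>M i\<in>I. lborel)) = ennreal A" "0 \<le> A"
    and "(\<integral>\<^sup>+x. ennreal (g x) \<partial>(\<Pi>\<^sub>M i\<in>I. lborel)) = ennreal B" "0 \<le> B"
  shows "ennreal (A powr (1 - t) * B powr t) \<le> (\<integral>\<^sup>+x. k x \<partial>(\<Pi>\<^sub>M i\<in>I. lborel))"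
  using assms(1-10,13-)
proof (induction I arbitrary: f g k A B rule: finite_induct)
  case empty
  interpret product_sigma_finite "\<lambda>_::'i. lborel :: real measure" ..
  have "A = f (\<lambda>k. undefined)" "B = g (\<lambda>k. undefined)"
    using empty.prems(11-14) empty.prems(4,7) by (simp_all add: nn_integral_empty)
  then show ?case
    using empty.prems(10)[of "\<lambda>k. undefined" "\<lambda>k. undefined"]
    by (simp add: nn_integral_empty restrict_def cong del: if_weak_cong)
next
  case (insert i I)
  interpret product_sigma_finite "\<lambda>_::'i. lborel :: real measure" ..
  note [measurable] = insert.prems(1-3)
  let ?P = "\<Pi>\<^sub>M i\<in>I. (lborel :: real measure)"
  have upd [measurable]: "(\<lambda>x. x(i := s)) \<in> ?P \<rightarrow>\<^sub>M (\<Pi>\<^sub>M i\<in>insert i I. lborel)" for s :: real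
    by (rule measurable_fun_upd[where J=I]) (auto simp: insert.hyps)
  \<comment> \<open>The bound C of the function times the volume of a cube of side 2 R: it keeps the
    partial integrals finite and bounded, as the inequality on the line demands.\<close>
  define D where "D = C * (2 * R) ^ card I"
  have fin: "(\<integral>\<^sup>+x. ennreal (\<phi> (x(i := s))) \<partial>?P) \<le> ennreal D"
    if [measurable]: "\<phi> \<in> borel_measurable (\<Pi>\<^sub>M i\<in>insert i I. lborel)"
      and \<phi>: "\<And>x. 0 \<le> \<phi> x" "\<And>x. \<phi> x \<le> C" "\<And>x j. \<phi> x \<noteq> 0 \<Longrightarrow> j \<in> insert i I \<Longrightarrow> \<bar>x j\<bar> \<le> R" for \<phi> :: "('i \<Rightarrow> real) \<Rightarrow> real" and s
  proof (cases "0 \<le> R")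
    case True
    have C: "0 \<le> C" using \<phi>(1,2)[of undefined] by simp
    have "(\<integral>\<^sup>+x. ennreal (\<phi> (x(i := s))) \<partial>?P) \<le> (\<integral>\<^sup>+x. ennreal C * indicator (Pi\<^sub>E I (\<lambda>_. {-R..R})) x \<partial>?P)"
    proof (intro nn_integral_mono)
      fix x assume x: "x \<in> space ?P"
      show "ennreal (\<phi> (x(i := s))) \<le> ennreal C * indicator (Pi\<^sub>E I (\<lambda>_. {-R..R})) x"
      proof (cases "\<phi> (x(i := s)) = 0")
        case False
        have "\<bar>x j\<bar> \<le> R" if "j \<in> I" for j
          using \<phi>(3)[OF False, of j] that insert.hyps by (auto split: if_splits)
        then have "x \<in> Pi\<^sub>E I (\<lambda>_. {-R..R})"
          using x unfolding space_PiM PiE_iff by (force simp: abs_le_iff)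
        then show ?thesis using \<phi>(2) by (simp add: ennreal_leI)
      qed simp
    qed
    also have "\<dots> = ennreal C * emeasure ?P (Pi\<^sub>E I (\<lambda>_. {-R..R}))"
      by (intro nn_integral_cmult_indicator sets_PiM_I_finite insert.hyps) auto
    also have "emeasure ?P (Pi\<^sub>E I (\<lambda>_. {-R..R})) = (\<Prod>j\<in>I. emeasure lborel {-R..R})"
      by (intro emeasure_PiM insert.hyps) auto
    also have "\<dots> = ennreal ((2 * R) ^ card I)"
      using True ennreal_power[of "2 * R" "card I"] by simp
    also have "ennreal C * ennreal ((2 * R) ^ card I) = ennreal D"
      unfolding D_def using C True by (intro ennreal_mult[symmetric]) auto
    finally show ?thesis .
  next
    case False
    have "\<phi> (x(i := s)) = 0" for x
    proof (rule ccontr)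
      assume "\<phi> (x(i := s)) \<noteq> 0"
      then have "\<bar>s\<bar> \<le> R"
        using \<phi>(3)[of "x(i := s)" i] by simp
      with False show False by simp
    qed
    then show ?thesis by simp
  qed
  define F where "F s = enn2real (\<integral>\<^sup>+x. ennreal (f (x(i := s))) \<partial>?P)" for s
  define G where "G s = enn2real (\<integral>\<^sup>+x. ennreal (g (x(i := s))) \<partial>?P)" for s
  define K where "K s = (\<integral>\<^sup>+x. k (x(i := s)) \<partial>?P)" for s
  have finF: "(\<integral>\<^sup>+x. ennreal (f (x(i := s))) \<partial>?P) \<le> ennreal D" for s
    by (rule fin; fact insert.prems)
  have finG: "(\<integral>\<^sup>+x. ennreal (g (x(i := s))) \<partial>?P) \<le> ennreal D" for s
    by (rule fin; fact insert.prems)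
  have F: "(\<integral>\<^sup>+x. ennreal (f (x(i := s))) \<partial>?P) = ennreal (F s)" for s
    unfolding F_def using le_less_trans[OF finF ennreal_less_top] by (rule ennreal_enn2real[symmetric])
  have G: "(\<integral>\<^sup>+x. ennreal (g (x(i := s))) \<partial>?P) = ennreal (G s)" for s
    unfolding G_def using le_less_trans[OF finG ennreal_less_top] by (rule ennreal_enn2real[symmetric])
  have FG0: "0 \<le> F s" "0 \<le> G s" for s by (simp_all add: F_def G_def)
  \<comment> \<open>For \<open>R < 0\<close> the functions vanish, while the formula for
    \<open>D\<close> may give a negative number; hence the maximum with 0.\<close>
  have FD: "F s \<le> max D 0" for s
    using finF[of s] FG0[of s] unfolding F by (cases "0 \<le> D") (auto simp: ennreal_neg)
  have GD: "G s \<le> max D 0" for s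
    using finG[of s] FG0[of s] unfolding G by (cases "0 \<le> D") (auto simp: ennreal_neg)
  have [measurable]: "F \<in> borel_measurable borel" "G \<in> borel_measurable borel" "K \<in> borel_measurable borel"
  proof -
    interpret sigma_finite_measure ?P
      by (rule sigma_finite) fact
    have [measurable]: "(\<lambda>(s, x). x(i := s)) \<in> lborel \<Otimes>\<^sub>M ?P \<rightarrow>\<^sub>M (\<Pi>\<^sub>M i\<in>insert i I. lborel)"
      unfolding split_beta' by (rule measurable_fun_upd[where J=I]) (auto simp: insert.hyps)
    have *: "(\<lambda>s. \<integral>\<^sup>+x. \<phi> (x(i := s)) \<partial>?P) \<in> borel_measurable borel"
      if [measurable]: "\<phi> \<in> borel_measurable (\<Pi>\<^sub>M i\<in>insert i I. lborel)" for \<phi> :: "('i \<Rightarrow> real) \<Rightarrow> ennreal"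
    proof -
      have "(\<lambda>s. \<integral>\<^sup>+x. \<phi> (case (s, x) of (s, x) \<Rightarrow> x(i := s)) \<partial>?P) \<in> borel_measurable lborel"
        by measurable
      then show ?thesis by simp
    qed
    show "F \<in> borel_measurable borel" "G \<in> borel_measurable borel" "K \<in> borel_measurable borel"
      unfolding F_def G_def K_def
      using *[of "\<lambda>x. ennreal (f x)"] *[of "\<lambda>x. ennreal (g x)"] *[of k] by (auto intro!: borel_measurable_enn2real)
  qed
  have "ennreal (A powr (1 - t) * B powr t) \<le> (\<integral>\<^sup>+x. K x \<partial>lborel)"
  proof (rule prekopa_leindler_real[where C = "max D 0" and R = R, OF _ _ _ _ FD _ _ GD _ t])
    show "\<bar>s\<bar> \<le> R" if "F s \<noteq> 0" for s
    proof (rule ccontr)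
      assume "\<not> \<bar>s\<bar> \<le> R"
      then have "f (x(i := s)) = 0" for x
        using insert.prems(6)[of "x(i := s)" i, OF _ insertI1] unfolding fun_upd_same by blast
      with that show False by (simp add: F_def)
    qed
    show "\<bar>s\<bar> \<le> R" if "G s \<noteq> 0" for s
    proof (rule ccontr)
      assume "\<not> \<bar>s\<bar> \<le> R"
      then have "g (x(i := s)) = 0" for x
        using insert.prems(9)[of "x(i := s)" i, OF _ insertI1] unfolding fun_upd_same by blast
      with that show False by (simp add: G_def)
    qed
    have "(\<integral>\<^sup>+s. (\<integral>\<^sup>+x. ennreal (f (x(i := s))) \<partial>?P) \<partial>lborel) = ennreal A"
      unfolding insert.prems(11)[symmetric]
      by (rule product_nn_integral_insert_rev[symmetric, OF insert.hyps]) measurable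
    then show "(\<integral>\<^sup>+x. ennreal (F x) \<partial>lborel) = ennreal A"
      by (simp only: F)
    have "(\<integral>\<^sup>+s. (\<integral>\<^sup>+x. ennreal (g (x(i := s))) \<partial>?P) \<partial>lborel) = ennreal B"
      unfolding insert.prems(13)[symmetric]
      by (rule product_nn_integral_insert_rev[symmetric, OF insert.hyps]) measurable
    then show "(\<integral>\<^sup>+x. ennreal (G x) \<partial>lborel) = ennreal B"
      by (simp only: G)
    fix s r :: real
    show "ennreal (F s powr (1 - t) * G r powr t) \<le> K ((1 - t) * s + t * r)"
      unfolding K_def
    proof (rule insert.IH[where f = "\<lambda>x. f (x(i := s))" and g = "\<lambda>x. g (x(i := r))"])
      fix x y :: "'i \<Rightarrow> real"
      have eq: "(\<lambda>j\<in>insert i I. (1 - t) * (x(i := s)) j + t * (y(i := r)) j) =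
          (\<lambda>j\<in>I. (1 - t) * x j + t * y j)(i := (1 - t) * s + t * r)"
        using insert.hyps by (auto simp: fun_eq_iff)
      show "ennreal (f (x(i := s)) powr (1 - t) * g (y(i := r)) powr t)
          \<le> k ((\<lambda>j\<in>I. (1 - t) * x j + t * y j)(i := (1 - t) * s + t * r))"
        using insert.prems(10)[of "x(i := s)" "y(i := r)"] unfolding eq .
    next
      fix x j assume "f (x(i := s)) \<noteq> 0" "j \<in> I"
      then show "\<bar>x j\<bar> \<le> R"
        using insert.prems(6)[of "x(i := s)" j, OF _ insertI2] insert.hyps fun_upd_other[of j i x s] by metis
    next
      fix x j assume "g (x(i := r)) \<noteq> 0" "j \<in> I"
      then show "\<bar>x j\<bar> \<le> R"
        using insert.prems(9)[of "x(i := r)" j, OF _ insertI2] insert.hyps fun_upd_other[of j i x r] by metis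
    next
      show "(\<lambda>x. f (x(i := s))) \<in> borel_measurable ?P" "(\<lambda>x. g (x(i := r))) \<in> borel_measurable ?P"
        "(\<lambda>x. k (x(i := (1 - t) * s + t * r))) \<in> borel_measurable ?P"
        by measurable
    qed (rule insert.prems(4) insert.prems(5) insert.prems(7) insert.prems(8) F G FG0)+
  next
    show "F \<in> borel_measurable borel" "G \<in> borel_measurable borel" "K \<in> borel_measurable borel"
      by measurable
  qed (rule FG0 insert.prems(12) insert.prems(14))+
  also have "\<dots> = (\<integral>\<^sup>+x. k x \<partial>(\<Pi>\<^sub>M i\<in>insert i I. lborel))"
    unfolding K_def by (rule product_nn_integral_insert_rev[symmetric, OF insert.hyps]) measurable
  finally show ?case .
qed

lemma prekopa_leindler:
  fixes f g :: "'a::euclidean_space \<Rightarrow> real" and k :: "'a \<Rightarrow> ennreal"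
  assumes [measurable]: "f \<in> borel_measurable borel" "g \<in> borel_measurable borel" "k \<in> borel_measurable borel"
    and f: "\<And>x. 0 \<le> f x" "\<And>x. f x \<le> C" "\<And>x. f x \<noteq> 0 \<Longrightarrow> norm x \<le> R"
    and g: "\<And>x. 0 \<le> g x" "\<And>x. g x \<le> C" "\<And>x. g x \<noteq> 0 \<Longrightarrow> norm x \<le> R"
    and t: "0 < t" "t < 1"
    and k: "\<And>x y. ennreal (f x powr (1 - t) * g y powr t) \<le> k ((1 - t) *\<^sub>R x + t *\<^sub>R y)"
    and A: "(\<integral>\<^sup>+x. ennreal (f x) \<partial>lborel) = ennreal A" "0 \<le> A"
    and B: "(\<integral>\<^sup>+x. ennreal (g x) \<partial>lborel) = ennreal B" "0 \<le> B"
  shows "ennreal (A powr (1 - t) * B powr t) \<le> (\<integral>\<^sup>+x. k x \<partial>lborel)"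
proof -
  define v :: "('a \<Rightarrow> real) \<Rightarrow> 'a" where "v x = (\<Sum>b\<in>Basis. x b *\<^sub>R b)" for x
  have vm [measurable]: "v \<in> (\<Pi>\<^sub>M b\<in>Basis. lborel) \<rightarrow>\<^sub>M borel"
    unfolding v_def by measurable
  have n: "(\<integral>\<^sup>+x. \<phi> (v x) \<partial>(\<Pi>\<^sub>M b\<in>Basis. lborel)) = (\<integral>\<^sup>+x. \<phi> x \<partial>lborel)"
    if [measurable]: "\<phi> \<in> borel_measurable borel" for \<phi> :: "'a \<Rightarrow> ennreal"
    by (subst lborel_eq, subst nn_integral_distr) (simp_all add: v_def[symmetric] vm[unfolded v_def])
  have vb: "\<bar>x b\<bar> \<le> norm (v x)" if "b \<in> Basis" for x :: "'a \<Rightarrow> real" and b :: 'a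
    using Basis_le_norm[OF that, of "v x"] that by (simp add: v_def inner_sum_left_Basis)
  have "ennreal (A powr (1 - t) * B powr t) \<le> (\<integral>\<^sup>+x. k (v x) \<partial>(\<Pi>\<^sub>M b\<in>Basis. lborel))"
  proof (rule prekopa_leindler_PiM[where f = "\<lambda>x. f (v x)" and g = "\<lambda>x. g (v x)" and C = C and R = R])
    fix x y
    have "v (\<lambda>i\<in>Basis. (1 - t) * x i + t * y i) = (1 - t) *\<^sub>R v x + t *\<^sub>R v y"
      by (simp add: v_def scaleR_sum_right sum.distrib[symmetric] algebra_simps)
    then show "ennreal (f (v x) powr (1 - t) * g (v y) powr t) \<le> k (v (\<lambda>i\<in>Basis. (1 - t) * x i + t * y i))"
      using k by simp
  next
    fix x and b :: 'a assume "f (v x) \<noteq> 0" "b \<in> Basis"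
    then show "\<bar>x b\<bar> \<le> R" using f(3) vb by (meson order_trans)
  next
    fix x and b :: 'a assume "g (v x) \<noteq> 0" "b \<in> Basis"
    then show "\<bar>x b\<bar> \<le> R" using g(3) vb by (meson order_trans)
  next
    show "(\<lambda>x. f (v x)) \<in> borel_measurable (\<Pi>\<^sub>M b\<in>Basis. lborel)"
      "(\<lambda>x. g (v x)) \<in> borel_measurable (\<Pi>\<^sub>M b\<in>Basis. lborel)"
      "(\<lambda>x. k (v x)) \<in> borel_measurable (\<Pi>\<^sub>M b\<in>Basis. lborel)"
      by measurable
  next
    show "(\<integral>\<^sup>+x. ennreal (f (v x)) \<partial>(\<Pi>\<^sub>M b\<in>Basis. lborel)) = ennreal A"
      "(\<integral>\<^sup>+x. ennreal (g (v x)) \<partial>(\<Pi>\<^sub>M b\<in>Basis. lborel)) = ennreal B"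
      using A B n[of "\<lambda>x. ennreal (f x)"] n[of "\<lambda>x. ennreal (g x)"] by simp_all
  qed (use f g t A B in auto)
  also have "\<dots> = (\<integral>\<^sup>+x. k x \<partial>lborel)"
    by (rule n) measurable
  finally show ?thesis .
qed

text \<open>Slicing with the weights \<open>u powr q\<close> and \<open>v powr q\<close> over the superlevel sets reduces the claim to
  the one-dimensional inequality for two functions with the same supremum.\<close>

proposition borell_brascamp_lieb_equal_mass:
  fixes u v K :: "'a::euclidean_space \<Rightarrow> real"
  assumes [measurable]: "u \<in> borel_measurable borel" "v \<in> borel_measurable borel" "K \<in> borel_measurable borel"
    and u: "\<And>x. 0 \<le> u x" "\<And>x. u x \<le> C" "\<And>x. u x \<noteq> 0 \<Longrightarrow> norm x \<le> R"
    and v: "\<And>x. 0 \<le> v x" "\<And>x. v x \<le> C" "\<And>x. v x \<noteq> 0 \<Longrightarrow> norm x \<le> R"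
    and t: "0 < t" "t < 1" and q: "0 < q"
    and K0: "\<And>x. 0 \<le> K x"
    and K: "\<And>x y. 0 < u x \<Longrightarrow> 0 < v y \<Longrightarrow> (1 - t) * u x + t * v y \<le> K ((1 - t) *\<^sub>R x + t *\<^sub>R y)"
    and M: "(\<integral>\<^sup>+x. ennreal (u x powr q) \<partial>lborel) = ennreal M" "(\<integral>\<^sup>+x. ennreal (v x powr q) \<partial>lborel) = ennreal M"
      "0 < M"
  shows "ennreal (1 - t) * (\<integral>\<^sup>+x. ennreal (u x powr (q + 1)) \<partial>lborel)
      + ennreal t * (\<integral>\<^sup>+x. ennreal (v x powr (q + 1)) \<partial>lborel)
     \<le> (\<integral>\<^sup>+x. ennreal (K x powr (q + 1)) \<partial>lborel)"
proof -
  define \<Phi> where "\<Phi> w s = (\<integral>\<^sup>+x. ennreal (w x powr q) * indicator {x. s < w x} x \<partial>lborel)" for w :: "'a \<Rightarrow> real" and s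
  have meas [measurable]: "\<Phi> w \<in> borel_measurable borel" if [measurable]: "w \<in> borel_measurable borel" for w
    unfolding \<Phi>_def by measurable
  have lc: "(\<integral>\<^sup>+x. ennreal (w x powr (q + 1)) \<partial>lborel) = (\<integral>\<^sup>+s. indicator {0..} s * \<Phi> w s \<partial>lborel)"
    if [measurable]: "w \<in> borel_measurable borel" and w: "\<And>x. 0 \<le> w x" for w :: "'a \<Rightarrow> real"
  proof -
    have "(\<integral>\<^sup>+x. ennreal (w x powr (q + 1)) \<partial>lborel) = (\<integral>\<^sup>+x. ennreal (w x powr q) * ennreal (w x) \<partial>lborel)"
      using w by (intro nn_integral_cong) (simp add: ennreal_mult[symmetric] powr_add)
    also have "\<dots> = (\<integral>\<^sup>+s. indicator {0..} s * (\<integral>\<^sup>+x. ennreal (w x powr q) * indicator {x. ennreal s < ennreal (w x)} x \<partial>lborel) \<partial>lborel)"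
      by (rule nn_integral_layer_cake) (auto intro: lborel.sigma_finite_measure_axioms)
    also have "\<dots> = (\<integral>\<^sup>+s. indicator {0..} s * \<Phi> w s \<partial>lborel)"
      unfolding \<Phi>_def by (intro nn_integral_cong) (auto simp: ennreal_less_iff split: split_indicator)
    finally show ?thesis .
  qed
  \<comment> \<open>Normalised so that the supremum 1 is attained at s = 0, where the whole mass
    \<open>M\<close> is counted. The same \<open>M\<close> serves for \<open>u\<close> and
    \<open>v\<close>; this is where equality of the masses enters.\<close>
  define f where "f w s = (if 0 \<le> s then enn2real (\<Phi> w s) / M else 0)" for w s
  have \<Phi>M: "\<Phi> w s \<le> ennreal M" if "(\<integral>\<^sup>+x. ennreal (w x powr q) \<partial>lborel) = ennreal M" for w s
    unfolding \<Phi>_def that[symmetric] by (intro nn_integral_mono) (auto split: split_indicator)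
  have \<Phi>e: "ennreal (enn2real (\<Phi> w s)) = \<Phi> w s" if "(\<integral>\<^sup>+x. ennreal (w x powr q) \<partial>lborel) = ennreal M" for w s
    by (rule ennreal_enn2real[OF le_less_trans[OF \<Phi>M[OF that] ennreal_less_top]])
  have f_props: "f w s \<le> 1" "0 \<le> f w s" "bounded {s. 0 < f w s}" "s < 1 \<Longrightarrow> \<exists>r. s < f w r"
      "(\<integral>\<^sup>+s. ennreal (f w s) \<partial>lborel) = ennreal (1 / M) * (\<integral>\<^sup>+x. ennreal (w x powr (q + 1)) \<partial>lborel)"
    if w [measurable]: "w \<in> borel_measurable borel"
      and wM: "(\<integral>\<^sup>+x. ennreal (w x powr q) \<partial>lborel) = ennreal M" and wC: "\<And>x. 0 \<le> w x" "\<And>x. w x \<le> C" for w s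
  proof -
    have "enn2real (\<Phi> w s) \<le> M"
      using \<Phi>M[OF wM, of s] \<Phi>e[OF wM, of s] M(3) by (metis ennreal_le_iff less_imp_le)
    then show "f w s \<le> 1" "0 \<le> f w s"
      using M(3) by (auto simp: f_def)
    have "\<Phi> w s = 0" if "C < s" for s
    proof -
      have "{x. s < w x} = {}" using wC(2) that by (auto simp: not_less intro: order_trans less_imp_le)
      then show ?thesis by (simp add: \<Phi>_def)
    qed
    then have "{s. 0 < f w s} \<subseteq> {0..C}"
      by (auto simp: f_def not_less[symmetric] split: if_splits)
    then show "bounded {s. 0 < f w s}"
      by (rule bounded_subset[rotated]) simp
    have "\<Phi> w 0 = ennreal M"
      unfolding \<Phi>_def wM[symmetric] using wC(1) q
      by (intro nn_integral_cong) (auto split: split_indicator simp: not_less dest: antisym)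
    then have "f w 0 = 1"
      using M(3) by (simp add: f_def)
    then show "\<exists>r. s < f w r" if "s < 1"
      using that by metis
    have "(\<integral>\<^sup>+s. ennreal (f w s) \<partial>lborel) = (\<integral>\<^sup>+s. ennreal (1 / M) * (indicator {0..} s * \<Phi> w s) \<partial>lborel)"
    proof (intro nn_integral_cong)
      fix s
      show "ennreal (f w s) = ennreal (1 / M) * (indicator {0..} s * \<Phi> w s)"
      proof (cases "0 \<le> s")
        case True
        have "ennreal (f w s) = ennreal (1 / M) * ennreal (enn2real (\<Phi> w s))"
          using True M(3) by (simp add: f_def ennreal_mult[symmetric])
        then show ?thesis using True by (simp add: \<Phi>e[OF wM])
      qed (simp add: f_def)
    qed
    also have "\<dots> = ennreal (1 / M) * (\<integral>\<^sup>+x. ennreal (w x powr (q + 1)) \<partial>lborel)"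
      using wC by (subst lc) (auto simp: nn_integral_cmult)
    finally show "(\<integral>\<^sup>+s. ennreal (f w s) \<partial>lborel) = ennreal (1 / M) * (\<integral>\<^sup>+x. ennreal (w x powr (q + 1)) \<partial>lborel)" .
  qed
  note fu = f_props[OF assms(1) M(1) u(1,2)] and fv = f_props[OF assms(2) M(2) v(1,2)]
  have "ennreal (1 - t) * (\<integral>\<^sup>+s. ennreal (f u s) \<partial>lborel) + ennreal t * (\<integral>\<^sup>+s. ennreal (f v s) \<partial>lborel)
     \<le> (\<integral>\<^sup>+s. ennreal (1 / M) * (indicator {0..} s * \<Phi> K s) \<partial>lborel)"
  proof (rule nn_integral_min_real[OF _ _ _ fu(1) fv(1) fu(3) fv(3) fu(4) fv(4) t])
    show "f u \<in> borel_measurable borel" "f v \<in> borel_measurable borel"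
      "(\<lambda>s. ennreal (1 / M) * (indicator {0..} s * \<Phi> K s)) \<in> borel_measurable borel"
      unfolding f_def by measurable
  next
    fix s r assume sr: "0 < f u s" "0 < f v r"
    then have s: "0 \<le> s" "0 \<le> r" by (auto simp: f_def split: if_splits)
    have n: "(\<integral>\<^sup>+x. ennreal (w x powr q * indicator {x. s < w x} x) \<partial>lborel) = ennreal (enn2real (\<Phi> w s))"
      if "(\<integral>\<^sup>+x. ennreal (w x powr q) \<partial>lborel) = ennreal M" for w s
      unfolding \<Phi>e[OF that] unfolding \<Phi>_def by (intro nn_integral_cong) (auto split: split_indicator)
    \<comment> \<open>Prekopa--Leindler for the weights restricted to superlevel sets: by AM-GM the
      geometric mean of \<open>u x powr q\<close> and \<open>v y powr q\<close> is at most
      \<open>((1 - t) * u x + t * v y) powr q\<close>, and the same convex combination exceeds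
      \<open>(1 - t) * s + t * r\<close>.\<close>
    have "ennreal (enn2real (\<Phi> u s) powr (1 - t) * enn2real (\<Phi> v r) powr t) \<le> \<Phi> K ((1 - t) * s + t * r)"
      unfolding \<Phi>_def[of K]
    proof (rule prekopa_leindler[where f = "\<lambda>x. u x powr q * indicator {x. s < u x} x"
        and g = "\<lambda>x. v x powr q * indicator {x. r < v x} x" and C = "C powr q" and R = R, OF _ _ _ _ _ _ _ _ _ t])
      show "u x powr q * indicator {x. s < u x} x \<le> C powr q" "v x powr q * indicator {x. r < v x} x \<le> C powr q" for x
        using u(1,2)[of x] v(1,2)[of x] q by (auto split: split_indicator intro: powr_mono2)
      show "norm x \<le> R" if "u x powr q * indicator {x. s < u x} x \<noteq> 0" for x
        using that u(3)[of x] by auto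
      show "norm x \<le> R" if "v x powr q * indicator {x. r < v x} x \<noteq> 0" for x
        using that v(3)[of x] by auto
    next
      fix x y
      show "ennreal ((u x powr q * indicator {x. s < u x} x) powr (1 - t) * (v y powr q * indicator {x. r < v x} y) powr t)
        \<le> ennreal (K ((1 - t) *\<^sub>R x + t *\<^sub>R y) powr q) *
           indicator {x. (1 - t) * s + t * r < K x} ((1 - t) *\<^sub>R x + t *\<^sub>R y)"
      proof (cases "s < u x \<and> r < v y")
        case True
        have pos: "0 < u x" "0 < v y" using True s by auto
        have "(1 - t) * s + t * r < (1 - t) * u x + t * v y"
          using True t by (intro add_strict_mono mult_strict_left_mono) auto
        also have le: "\<dots> \<le> K ((1 - t) *\<^sub>R x + t *\<^sub>R y)"
          by (rule K[OF pos])
        finally have lt: "(1 - t) * s + t * r < K ((1 - t) *\<^sub>R x + t *\<^sub>R y)" .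
        have "u x powr (1 - t) * v y powr t \<le> (1 - t) * u x + t * v y"
          using Youngs_inequality_0[of "1 - t" t "u x" "v y"] t pos by simp
        also note le
        finally have "(u x powr (1 - t) * v y powr t) powr q \<le> K ((1 - t) *\<^sub>R x + t *\<^sub>R y) powr q"
          using q by (intro powr_mono2) auto
        moreover have "(u x powr (1 - t) * v y powr t) powr q = (u x powr q) powr (1 - t) * (v y powr q) powr t"
          by (simp add: powr_mult powr_powr mult.commute)
        ultimately show ?thesis using True lt by (simp add: ennreal_leI)
      qed (auto split: split_indicator)
    qed (auto simp: n M)
    then have le: "ennreal (1 / M) * ennreal (enn2real (\<Phi> u s) powr (1 - t) * enn2real (\<Phi> v r) powr t)
        \<le> ennreal (1 / M) * \<Phi> K ((1 - t) * s + t * r)"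
      by (intro mult_left_mono) auto
    have "min (f u s) (f v r) \<le> f u s powr (1 - t) * f v r powr t"
      using sr t by (intro min_le_geometric_mean) auto
    also have "\<dots> = 1 / M * (enn2real (\<Phi> u s) powr (1 - t) * enn2real (\<Phi> v r) powr t)"
      using s M(3) by (simp add: f_def powr_divide powr_diff)
    finally have "ennreal (min (f u s) (f v r)) \<le> ennreal (1 / M * (enn2real (\<Phi> u s) powr (1 - t) * enn2real (\<Phi> v r) powr t))"
      by (rule ennreal_leI)
    also have "\<dots> = ennreal (1 / M) * ennreal (enn2real (\<Phi> u s) powr (1 - t) * enn2real (\<Phi> v r) powr t)"
      using M(3) by (intro ennreal_mult) auto
    also note le
    finally have "ennreal (min (f u s) (f v r)) \<le> ennreal (1 / M) * \<Phi> K ((1 - t) * s + t * r)" .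
    then show "ennreal (min (f u s) (f v r)) \<le> ennreal (1 / M) * (indicator {0..} ((1 - t) * s + t * r) * \<Phi> K ((1 - t) * s + t * r))"
      using s t by simp
  qed
  also have "\<dots> = ennreal (1 / M) * (\<integral>\<^sup>+x. ennreal (K x powr (q + 1)) \<partial>lborel)"
    using K0 by (subst lc) (auto simp: nn_integral_cmult)
  finally have *: "ennreal (1 / M) * (ennreal (1 - t) * (\<integral>\<^sup>+x. ennreal (u x powr (q + 1)) \<partial>lborel)
      + ennreal t * (\<integral>\<^sup>+x. ennreal (v x powr (q + 1)) \<partial>lborel))
     \<le> ennreal (1 / M) * (\<integral>\<^sup>+x. ennreal (K x powr (q + 1)) \<partial>lborel)"
    unfolding fu(5) fv(5) by (simp add: distrib_left ac_simps)
  have **: "ennreal M * (ennreal (1 / M) * z) = z" for z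
    using M(3) by (simp add: mult.assoc[symmetric] ennreal_mult[symmetric])
  show ?thesis
    using mult_left_mono[OF *, of "ennreal M"] unfolding ** by simp
qed

section \<open>The infinitesimal inequality\<close>

text \<open>Convexity of the power, with the tangent drawn at the new point \<open>r\<close> and not
  at \<open>s\<close>: an increment is then bounded above by the derivative at the perturbed
  function, which is the direction required before the limit is taken. The inequality itself is
  Young's with exponents (q + 1) / q and q + 1.\<close>

lemma convex_powr_tangent:
  fixes r s q :: real
  assumes "0 < q" "0 \<le> s"
  shows "max 0 r powr (q + 1) - s powr (q + 1) \<le> (q + 1) * (r - s) * max 0 r powr q"
proof (cases "0 < r")
  case True
  have "r powr q * s \<le> q / (q + 1) * r powr (q + 1) + 1 / (q + 1) * s powr (q + 1)"
  proof (cases "s = 0")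
    case False
    have "(r powr (q + 1)) powr (q / (q + 1)) * (s powr (q + 1)) powr (1 / (q + 1)) \<le>
        q / (q + 1) * r powr (q + 1) + 1 / (q + 1) * s powr (q + 1)"
      using assms True False by (intro Youngs_inequality_0) (auto simp: add_divide_distrib[symmetric])
    then show ?thesis
      using assms True False by (simp add: powr_powr)
  qed (use assms in auto)
  then have "(q + 1) * (r powr q * s) \<le> (q + 1) * (q / (q + 1) * r powr (q + 1) + 1 / (q + 1) * s powr (q + 1))"
    using assms by (intro mult_left_mono) auto
  also have "\<dots> = q * r powr (q + 1) + s powr (q + 1)"
    using assms by (simp add: distrib_left)
  finally show ?thesis
    using True by (simp add: algebra_simps powr_add)
qed (use assms in auto)

lemma set_integrable_continuous_compact:
  fixes f :: "'a::euclidean_space \<Rightarrow> 'b::euclidean_space"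
  assumes "compact S" "continuous_on S f"
  shows "set_integrable lborel S f"
  using borel_integrable_compact[OF assms] by (simp add: set_integrable_def)

lemma nn_integral_indicator_eq_set_lebesgue_integral:
  fixes f :: "'a::euclidean_space \<Rightarrow> real"
  assumes "compact S" "continuous_on S f" "\<And>x. x \<in> S \<Longrightarrow> 0 \<le> f x"
  shows "(\<integral>\<^sup>+x. ennreal (indicator S x * f x) \<partial>lborel) = ennreal (LINT x:S|lborel. f x)"
  using set_integrable_continuous_compact[OF assms(1,2)] assms(3)
  unfolding set_integrable_def set_lebesgue_integral_def
  by (subst nn_integral_eq_integral) (auto split: split_indicator)

text \<open>The mean value inequality for \<open>u\<close> minus its linear part at
  \<open>z\<close>. It stands in for concavity, which \<open>u\<close> does not have; the price is
  the oscillation \<open>r\<close> of the gradient along the segment.\<close>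

lemma tangent_upper_bound:
  fixes u :: "'a::euclidean_space \<Rightarrow> real" and g :: "'a \<Rightarrow> 'a"
  assumes "convex H" "x \<in> H" "z \<in> H"
    and u: "\<And>x. x \<in> H \<Longrightarrow> (u has_derivative (\<lambda>v. g x \<bullet> v)) (at x within H)"
    and g: "\<And>y. y \<in> closed_segment x z \<Longrightarrow> norm (g y - g z) \<le> r"
  shows "u x \<le> u z + g z \<bullet> (x - z) + r * norm (x - z)"
proof -
  have sub: "closed_segment x z \<subseteq> H"
    using assms(1-3) by (simp add: closed_segment_subset)
  have "norm ((u x - g z \<bullet> x) - (u z - g z \<bullet> z)) \<le> r * norm (x - z)"
  proof (rule differentiable_bound[where S = "closed_segment x z" and f = "\<lambda>y. u y - g z \<bullet> y"])
    fix y assume y: "y \<in> closed_segment x z"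
    show "((\<lambda>y. u y - g z \<bullet> y) has_derivative (\<lambda>v. g y \<bullet> v - g z \<bullet> v)) (at y within closed_segment x z)"
      by (intro has_derivative_diff has_derivative_subset[OF u sub] derivative_intros) (use y sub in auto)
    have "norm (g y \<bullet> v - g z \<bullet> v) \<le> r * norm v" for v
    proof -
      have "norm (g y \<bullet> v - g z \<bullet> v) \<le> norm (g y - g z) * norm v"
        using Cauchy_Schwarz_ineq2[of "g y - g z" v] by (simp add: inner_diff_left)
      also have "\<dots> \<le> r * norm v"
        by (intro mult_right_mono g y) simp
      finally show ?thesis .
    qed
    then show "onorm (\<lambda>v. g y \<bullet> v - g z \<bullet> v) \<le> r"
      by (intro onorm_le)
  qed auto
  then show ?thesis
    by (simp add: inner_diff_right)
qed

text \<open>Completion of the square in \<open>g + (2 * \<kappa>) *\<^sub>R w\<close>; the right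
  side is the Legendre transform of the quadratic
  \<open>\<kappa> * (norm w)\<^sup>2\<close>.\<close>

lemma gradient_legendre_bound:
  fixes g w :: "'a::real_inner"
  assumes "0 < \<kappa>"
  shows "- (g \<bullet> w) - \<kappa> * (norm w)\<^sup>2 \<le> (norm g)\<^sup>2 / (4 * \<kappa>)"
proof -
  have "0 \<le> (norm (g + (2 * \<kappa>) *\<^sub>R w))\<^sup>2" by simp
  also have "\<dots> = (norm g)\<^sup>2 + 4 * \<kappa> * (g \<bullet> w) + 4 * \<kappa>\<^sup>2 * (norm w)\<^sup>2"
    unfolding power2_norm_eq_inner
    by (simp add: inner_add_left inner_add_right inner_commute power2_eq_square)
  finally have "0 \<le> ((norm g)\<^sup>2 + 4 * \<kappa> * (g \<bullet> w) + 4 * \<kappa>\<^sup>2 * (norm w)\<^sup>2) / (4 * \<kappa>)"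
    using assms by simp
  also have "\<dots> = (norm g)\<^sup>2 / (4 * \<kappa>) + g \<bullet> w + \<kappa> * (norm w)\<^sup>2"
    using assms by (simp add: add_divide_distrib power2_eq_square)
  finally show ?thesis by simp
qed

text \<open>Expanding \<open>u\<close> to first order at z = (1 - t) x + t y shows that
  \<open>(1 - t) * u x + t * v y\<close> is at most \<open>u z + t * (G z + r)\<close>, where
  \<open>r\<close> absorbs the error of the expansion. The positive part of this perturbation of
  \<open>u\<close> is therefore admissible in the equal mass inequality; dividing by t, letting t
  tend to 0 and then \<open>r\<close> to 0 leaves the first variation.\<close>

proposition borell_brascamp_lieb_gradient:
  fixes u :: "'a::euclidean_space \<Rightarrow> real" and g :: "'a \<Rightarrow> 'a" and c :: 'a and \<tau> \<kappa> q :: real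
  defines "v \<equiv> \<lambda>y. max 0 (\<tau> - \<kappa> * (norm (y - c))\<^sup>2)"
  assumes H: "closed H" "convex H"
    and u: "\<And>x. x \<in> H \<Longrightarrow> (u has_derivative (\<lambda>v. g x \<bullet> v)) (at x within H)"
    and g: "continuous_on H g"
    and u0: "\<And>x. x \<in> H \<Longrightarrow> 0 \<le> u x" and uR: "\<And>x. x \<in> H \<Longrightarrow> R \<le> norm x \<Longrightarrow> u x = 0"
    and q: "0 < q" and \<kappa>: "0 < \<kappa>"
    and mass: "(LINT x:H|lborel. u x powr q) = (LINT x:H|lborel. v x powr q)" "0 < (LINT x:H|lborel. v x powr q)"
  shows "(LINT x:H|lborel. v x powr (q + 1)) - (LINT x:H|lborel. u x powr (q + 1)) \<le>
    (q + 1) * (LINT x:H|lborel. u x powr q * (\<tau> + (norm (g x))\<^sup>2 / (4 * \<kappa>) + g x \<bullet> (x - c) - u x))"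
proof -
  \<comment> \<open>Radius of a ball containing the supports of both \<open>u\<close> and
    \<open>v\<close>; the 1 makes it positive, since \<open>\<rho>\<close> is used as a
    divisor.\<close>
  define \<rho> where "\<rho> = max 1 (max R (norm c + sqrt (\<tau> / \<kappa>)))"
  define B where "B = H \<inter> cball 0 \<rho>"
  have \<rho>: "0 < \<rho>" "R \<le> \<rho>" by (auto simp: \<rho>_def)
  have B: "compact B" "convex B" "B \<subseteq> H"
    using H by (auto simp: B_def intro!: convex_Int closed_Int_compact)
  have uB: "x \<in> B" if "x \<in> H" "0 < u x" for x
    using uR[of x] that \<rho> by (cases "R \<le> norm x") (auto simp: B_def)
  have vB: "y \<in> B" if "y \<in> H" "0 < v y" for y
  proof -
    have "\<kappa> * (norm (y - c))\<^sup>2 < \<tau>" using that by (auto simp: v_def)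
    then have "(norm (y - c))\<^sup>2 \<le> \<tau> / \<kappa>" using \<kappa> by (simp add: pos_le_divide_eq mult.commute)
    then have "norm (y - c) \<le> sqrt (\<tau> / \<kappa>)" by (rule real_le_rsqrt)
    then have "norm y \<le> norm c + sqrt (\<tau> / \<kappa>)"
      using norm_triangle_ineq[of "y - c" c] by simp
    then show ?thesis using that by (auto simp: B_def \<rho>_def)
  qed
  have cu: "continuous_on H u"
    using u by (intro has_derivative_continuous_on)
  have cv: "continuous_on S v" for S
    unfolding v_def by (intro continuous_intros)
  note cB = continuous_on_subset[OF cu B(3)] continuous_on_subset[OF g B(3)] cv
  have v0: "0 \<le> v y" for y by (simp add: v_def)
  have HB: "(LINT x:H|lborel. f x) = (LINT x:B|lborel. f x)" if "\<And>x. x \<in> H \<Longrightarrow> x \<notin> B \<Longrightarrow> f x = 0" for f :: "'a \<Rightarrow> real"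
    using that B(3) unfolding set_lebesgue_integral_def
    by (intro Bochner_Integration.integral_cong) (auto split: split_indicator)
  have uz: "u x = 0" if "x \<in> H" "x \<notin> B" for x
    using uB[OF that(1)] u0[OF that(1)] that(2) by force
  have vz: "v x = 0" if "x \<in> H" "x \<notin> B" for x
    using vB[OF that(1)] v0[of x] that(2) by force
  define M where "M = (LINT x:B|lborel. v x powr q)"
  have M: "(LINT x:B|lborel. u x powr q) = M" "0 < M"
    using mass by (simp_all add: M_def HB uz vz)
  have cont: "continuous_on B (\<lambda>x. u x powr r)" "continuous_on B (\<lambda>x. v x powr r)" if "0 < r" for r
    using u0 B(3) v0 that by (intro continuous_on_powr' cB continuous_on_const; auto)+
  obtain C where C: "\<And>x. x \<in> B \<Longrightarrow> u x \<le> C" "\<And>x. x \<in> B \<Longrightarrow> v x \<le> C" "0 \<le> C"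
  proof -
    have "bounded (u ` B)" "bounded (v ` B)"
      using cB B(1) by (auto intro!: compact_imp_bounded compact_continuous_image)
    then obtain C1 C2 where "\<And>x. x \<in> B \<Longrightarrow> norm (u x) \<le> C1" "\<And>x. x \<in> B \<Longrightarrow> norm (v x) \<le> C2"
      unfolding bounded_iff by blast
    then show ?thesis
      by (intro that[of "max 0 (max C1 C2)"]) fastforce+
  qed
  \<comment> \<open>The Legendre bound for the supremum over y of
    \<open>g x \<bullet> (x - y) + v y\<close>, minus \<open>u x\<close>; the last term comes from
    the factor 1 - t in front of \<open>u\<close>.\<close>
  define G where "G x = \<tau> + (norm (g x))\<^sup>2 / (4 * \<kappa>) + g x \<bullet> (x - c) - u x" for x
  have cG: "continuous_on B G"
    unfolding G_def using \<kappa> cB by (intro continuous_intros) auto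
  define I where "I w = (LINT x:B|lborel. w x powr (q + 1))" for w :: "'a \<Rightarrow> real"
  have main: "I v - I u \<le> (q + 1) * (LINT x:B|lborel. u x powr q * (G x + r))" if r: "0 < r" for r
  proof -
    \<comment> \<open>Points of \<open>B\<close> are at most 2 \<rho> apart, so an oscillation
      \<open>\<epsilon>\<close> of the gradient costs at most \<open>t * r\<close> in the
      expansion.\<close>
    define \<epsilon> where "\<epsilon> = r / (2 * \<rho>)"
    have \<epsilon>: "0 < \<epsilon>" using r \<rho> by (simp add: \<epsilon>_def)
    obtain \<eta> where \<eta>: "0 < \<eta>" "\<And>x y. x \<in> B \<Longrightarrow> y \<in> B \<Longrightarrow> dist x y < \<eta> \<Longrightarrow> dist (g x) (g y) < \<epsilon>"
      using compact_uniformly_continuous[OF cB(2) B(1)] \<epsilon> unfolding uniformly_continuous_on_def by metis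
    have *: "I v - I u \<le> (q + 1) * (LINT x:B|lborel. (G x + r) * max 0 (u x + t * (G x + r)) powr q)"
      if t: "0 < t" "t < 1" "2 * \<rho> * t < \<eta>" for t
    proof -
      \<comment> \<open>The positive part is taken because \<open>G + r\<close> may be negative
        where \<open>u\<close> vanishes, and powers are formed of \<open>K\<close>.\<close>
      define K where "K x = max 0 (u x + t * (G x + r))" for x
      have cK: "continuous_on B K"
        unfolding K_def using cB cG by (intro continuous_intros)
      have cK': "continuous_on B (\<lambda>x. K x powr r)" if "0 < r" for r
        using that by (intro continuous_on_powr' cK continuous_on_const) (auto simp: K_def)
      have bm: "(\<lambda>x. indicator B x * f x) \<in> borel_measurable borel" if "continuous_on B f" for f :: "'a \<Rightarrow> real"
        using borel_measurable_continuous_on_indicator[OF _ that] B(1) by (simp add: compact_imp_closed)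
      have key: "(1 - t) * u x + t * v y \<le> K ((1 - t) *\<^sub>R x + t *\<^sub>R y) \<and> (1 - t) *\<^sub>R x + t *\<^sub>R y \<in> B"
        if x: "x \<in> B" and y: "y \<in> B" "0 < v y" for x y
      proof -
        define z where "z = (1 - t) *\<^sub>R x + t *\<^sub>R y"
        have z: "z \<in> B"
          unfolding z_def using convexD[OF B(2) x y(1), of "1 - t" t] t by simp
        \<comment> \<open>The factor 1 - t in front of \<open>u x\<close> turns the displacement
          from z to x into t times the one from y to z. Hence both the linear term and the error
          carry the factor t and can be combined with \<open>t * v y\<close>.\<close>
        have xz: "x - z = t *\<^sub>R (x - y)" "(1 - t) *\<^sub>R (x - z) = t *\<^sub>R (z - y)"
          by (simp_all add: z_def algebra_simps)
        have d2: "norm (a - b) \<le> 2 * \<rho>" if "a \<in> B" "b \<in> B" for a b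
          using norm_triangle_ineq4[of a b] that by (auto simp: B_def)
        have "norm (x - z) \<le> t * (2 * \<rho>)"
          unfolding xz using d2[OF x y(1)] t by simp
        then have nx: "norm (x - z) < \<eta>" using t by (simp add: mult.commute mult.left_commute)
        have "u x \<le> u z + g z \<bullet> (x - z) + \<epsilon> * norm (x - z)"
        proof (rule tangent_upper_bound[OF H(2) _ _ u])
          show "x \<in> H" "z \<in> H" using x z B by auto
          fix w assume w: "w \<in> closed_segment x z"
          then have "w \<in> B" using closed_segment_subset[OF x z B(2)] by auto
          moreover have "dist w z < \<eta>"
            using segment_bound(2)[OF w] nx by (simp add: dist_norm norm_minus_commute[of z x])
          ultimately show "norm (g w - g z) \<le> \<epsilon>"
            using \<eta>(2)[of w z] z by (simp add: dist_norm less_imp_le)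
        qed
        then have "(1 - t) * u x \<le> (1 - t) * (u z + g z \<bullet> (x - z) + \<epsilon> * norm (x - z))"
          using t by (intro mult_left_mono) auto
        also have "\<dots> = (1 - t) * u z + g z \<bullet> ((1 - t) *\<^sub>R (x - z)) + \<epsilon> * norm ((1 - t) *\<^sub>R (x - z))"
          using t by (simp only: inner_scaleR_right norm_scaleR) (simp add: algebra_simps)
        also have "\<dots> = (1 - t) * u z + t * (g z \<bullet> (z - y)) + \<epsilon> * (t * norm (z - y))"
          unfolding xz(2) using t by simp
        also have "\<epsilon> * (t * norm (z - y)) \<le> \<epsilon> * (t * (2 * \<rho>))"
          using t \<epsilon> d2[OF z y(1)] by (intro mult_left_mono) auto
        also have "\<epsilon> * (t * (2 * \<rho>)) = t * r"
          using \<rho> by (simp add: \<epsilon>_def)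
        finally have 1: "(1 - t) * u x \<le> (1 - t) * u z + t * (g z \<bullet> (z - y)) + t * r" by simp
        have "v y = \<tau> - \<kappa> * (norm (y - c))\<^sup>2"
          using y(2) by (auto simp: v_def max_def split: if_splits)
        then have "g z \<bullet> (z - y) + v y \<le> \<tau> + (norm (g z))\<^sup>2 / (4 * \<kappa>) + g z \<bullet> (z - c)"
          using gradient_legendre_bound[OF \<kappa>, of "g z" "y - c"] by (simp add: inner_diff_right)
        then have "t * (g z \<bullet> (z - y) + v y) \<le> t * (\<tau> + (norm (g z))\<^sup>2 / (4 * \<kappa>) + g z \<bullet> (z - c))"
          using t by (intro mult_left_mono) auto
        with 1 have "(1 - t) * u x + t * v y \<le> u z + t * (G z + r)"
          by (simp add: G_def algebra_simps)
        then show ?thesis using z by (simp add: z_def[symmetric] K_def)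
      qed
      have nn: "(\<integral>\<^sup>+x. ennreal ((indicator B x * w x) powr s) \<partial>lborel) = ennreal (LINT x:B|lborel. w x powr s)"
        if "0 < s" "continuous_on B (\<lambda>x. w x powr s)" for w :: "'a \<Rightarrow> real" and s
      proof -
        have "(indicator B x * w x) powr s = indicator B x * w x powr s" for x
          using that(1) by (auto split: split_indicator)
        then show ?thesis
          using nn_integral_indicator_eq_set_lebesgue_integral[OF B(1) that(2)] by simp
      qed
      have Ige: "0 \<le> I w" for w
        unfolding I_def set_lebesgue_integral_def by (intro Bochner_Integration.integral_nonneg) auto
      have "ennreal (1 - t) * (\<integral>\<^sup>+x. ennreal ((indicator B x * u x) powr (q + 1)) \<partial>lborel)
          + ennreal t * (\<integral>\<^sup>+x. ennreal ((indicator B x * v x) powr (q + 1)) \<partial>lborel)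
         \<le> (\<integral>\<^sup>+x. ennreal ((indicator B x * K x) powr (q + 1)) \<partial>lborel)"
      proof (rule borell_brascamp_lieb_equal_mass[where C = C and R = \<rho> and M = M])
        show "(\<lambda>x. indicator B x * u x) \<in> borel_measurable borel" "(\<lambda>x. indicator B x * v x) \<in> borel_measurable borel"
          "(\<lambda>x. indicator B x * K x) \<in> borel_measurable borel"
          using bm cB cK by auto
        show "0 < t" "t < 1" "0 < q" "0 < M" by fact+
        show "(\<integral>\<^sup>+x. ennreal ((indicator B x * u x) powr q) \<partial>lborel) = ennreal M"
          "(\<integral>\<^sup>+x. ennreal ((indicator B x * v x) powr q) \<partial>lborel) = ennreal M"
          using nn[OF q cont(1)[OF q]] nn[OF q cont(2)[OF q]] M by (auto simp: M_def)
        show "(1 - t) * (indicator B x * u x) + t * (indicator B y * v y)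
           \<le> indicator B ((1 - t) *\<^sub>R x + t *\<^sub>R y) * K ((1 - t) *\<^sub>R x + t *\<^sub>R y)"
          if "0 < indicator B x * u x" "0 < indicator B y * v y" for x y
          using key[of x y] that by (auto split: split_indicator_asm)
        show "0 \<le> indicator B x * u x" "indicator B x * u x \<le> C" "0 \<le> indicator B x * v x" "indicator B x * v x \<le> C"
          "0 \<le> indicator B x * K x" for x
          using u0[of x] v0[of x] C(1,2)[of x] C(3) B(3) by (auto split: split_indicator simp: K_def)
        show "norm x \<le> \<rho>" if "indicator B x * u x \<noteq> 0" for x
          using that by (auto simp: B_def split: split_indicator_asm)
        show "norm x \<le> \<rho>" if "indicator B x * v x \<noteq> 0" for x
          using that by (auto simp: B_def split: split_indicator_asm)
      qed
      then have "ennreal ((1 - t) * I u + t * I v) \<le> ennreal (I K)"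
        using q t Ige by (simp add: nn cont cK' I_def[symmetric] ennreal_mult[symmetric] ennreal_plus[symmetric] del: ennreal_plus)
      then have "(1 - t) * I u + t * I v \<le> I K"
        using Ige by (simp add: ennreal_le_iff)
      then have "t * (I v - I u) \<le> I K - I u"
        by (simp add: algebra_simps)
      also have "\<dots> = (LINT x:B|lborel. K x powr (q + 1) - u x powr (q + 1))"
        unfolding I_def using q
        by (intro set_integral_diff(2)[symmetric] set_integrable_continuous_compact B(1) cont cK') auto
      also have "\<dots> \<le> (LINT x:B|lborel. t * ((q + 1) * ((G x + r) * K x powr q)))"
      proof (rule set_integral_mono)
        show "set_integrable lborel B (\<lambda>x. K x powr (q + 1) - u x powr (q + 1))"
          using q by (intro set_integrable_continuous_compact B(1) continuous_intros cont cK') auto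
        show "set_integrable lborel B (\<lambda>x. t * ((q + 1) * ((G x + r) * K x powr q)))"
          using q by (intro set_integrable_continuous_compact B(1) continuous_intros cG cK') auto
        fix x assume x: "x \<in> B"
        show "K x powr (q + 1) - u x powr (q + 1) \<le> t * ((q + 1) * ((G x + r) * K x powr q))"
          using convex_powr_tangent[OF q u0[of x], of "u x + t * (G x + r)"] x B(3)
          unfolding K_def by (auto simp: ac_simps)
      qed
      finally have "t * (I v - I u) \<le> t * ((q + 1) * (LINT x:B|lborel. (G x + r) * K x powr q))"
        by simp
      then show ?thesis using t by (simp add: K_def)
    qed
    \<comment> \<open>Any null sequence bounded by 1/2 and by \<eta> / (4 \<rho>) satisfies the two
      smallness conditions on t, with a factor 2 to spare.\<close>
    define m where "m = min (1/2) (\<eta> / (4 * \<rho>))"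
    have m: "0 < m" "m \<le> 1/2" "m \<le> \<eta> / (4 * \<rho>)"
      using \<eta>(1) \<rho> by (auto simp: m_def)
    define tn where "tn n = m / real (Suc n)" for n
    have tn: "0 < tn n" "tn n < 1" "2 * \<rho> * tn n < \<eta>" for n
    proof -
      have le: "tn n \<le> m / 1"
        unfolding tn_def using m(1) by (intro divide_left_mono) auto
      show "0 < tn n" using m by (simp add: tn_def)
      show "tn n < 1" using le m(2) by simp
      have "2 * \<rho> * tn n \<le> 2 * \<rho> * (\<eta> / (4 * \<rho>))" using le m(3) \<rho> by (intro mult_left_mono) auto
      also have "\<dots> < \<eta>" using \<eta>(1) \<rho> by (simp add: field_simps)
      finally show "2 * \<rho> * tn n < \<eta>" .
    qed
    have tn0: "tn \<longlonglongrightarrow> 0"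
      unfolding tn_def
      by (rule real_tendsto_divide_at_top[OF tendsto_const filterlim_compose[OF filterlim_real_sequentially filterlim_Suc]])
    define P where "P s x = (G x + r) * max 0 (u x + s * (G x + r)) powr q" for s x
    have lim: "(\<lambda>n. LINT x:B|lborel. P (tn n) x) \<longlonglongrightarrow>
        (LINT x:B|lborel. P 0 x)"
    proof -
      have "bounded (G ` B)"
        using cG B(1) by (auto intro!: compact_imp_bounded compact_continuous_image)
      then obtain D where D: "\<And>x. x \<in> B \<Longrightarrow> \<bar>G x\<bar> \<le> D"
        unfolding bounded_iff by auto
      define E where "E = (D + r) * (C + (D + r)) powr q"
      show ?thesis
        unfolding set_lebesgue_integral_def
      proof (rule integral_dominated_convergence[where w = "\<lambda>x. indicator B x *\<^sub>R E"])
        have ci: "continuous_on B (P s)" for s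
          unfolding P_def[abs_def] using q by (intro continuous_on_mult continuous_on_powr' continuous_on_max continuous_on_add cG cB continuous_on_const) auto
        show "(\<lambda>x. indicator B x *\<^sub>R P 0 x) \<in> borel_measurable lborel"
          using borel_measurable_continuous_on_indicator[OF _ ci[of 0]] B(1) by (simp add: compact_imp_closed)
        show "(\<lambda>x. indicator B x *\<^sub>R P (tn n) x) \<in> borel_measurable lborel" for n
          using borel_measurable_continuous_on_indicator[OF _ ci] B(1) by (simp add: compact_imp_closed)
        show "integrable lborel (\<lambda>x. indicator B x *\<^sub>R E)"
          using set_integrable_continuous_compact[OF B(1), of "\<lambda>_. E"] by (simp add: set_integrable_def)
        show "AE x in lborel. (\<lambda>n. indicator B x *\<^sub>R P (tn n) x)
            \<longlonglongrightarrow> indicator B x *\<^sub>R P 0 x"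
        proof (rule AE_I2)
          fix x
          have "(\<lambda>n. max 0 (u x + tn n * (G x + r))) \<longlonglongrightarrow> max 0 (u x + 0 * (G x + r))"
            by (intro tendsto_intros tn0)
          then have "(\<lambda>n. max 0 (u x + tn n * (G x + r)) powr q) \<longlonglongrightarrow> max 0 (u x) powr q"
            using q by (intro tendsto_powr') auto
          then show "(\<lambda>n. indicator B x *\<^sub>R P (tn n) x) \<longlonglongrightarrow> indicator B x *\<^sub>R P 0 x"
            unfolding P_def mult_zero_left add_0_right by (rule tendsto_scaleR[OF tendsto_const tendsto_mult[OF tendsto_const]])
        qed
        fix n
        show "AE x in lborel. norm (indicator B x *\<^sub>R P (tn n) x) \<le> indicator B x *\<^sub>R E"
        proof (rule AE_I2)
          fix x
          have "\<bar>G x + r\<bar> * max 0 (u x + tn n * (G x + r)) powr q \<le> (D + r) * (C + (D + r)) powr q" if x: "x \<in> B"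
          proof (rule mult_mono)
            show a: "\<bar>G x + r\<bar> \<le> D + r" using D[OF x] r by auto
            have "tn n * (G x + r) \<le> \<bar>tn n\<bar> * \<bar>G x + r\<bar>" by (metis abs_ge_self abs_mult)
            also have "\<dots> \<le> 1 * (D + r)"
              using tn[of n] a by (intro mult_mono) auto
            finally have "max 0 (u x + tn n * (G x + r)) \<le> C + (D + r)"
              using C(1)[OF x] C(3) a by simp
            then show "max 0 (u x + tn n * (G x + r)) powr q \<le> (C + (D + r)) powr q"
              using q by (intro powr_mono2) auto
          qed (use D[OF x] r in auto)
          then show "norm (indicator B x *\<^sub>R P (tn n) x) \<le> indicator B x *\<^sub>R E"
            by (auto split: split_indicator simp: abs_mult E_def P_def)
        qed
      qed
    qed
    have "I v - I u \<le> (q + 1) * (LINT x:B|lborel. P 0 x)"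
      by (rule tendsto_le[OF sequentially_bot tendsto_mult_left[OF lim] tendsto_const])
         (use *[OF tn] in \<open>auto simp: P_def\<close>)
    also have "(LINT x:B|lborel. P 0 x) = (LINT x:B|lborel. u x powr q * (G x + r))"
      unfolding set_lebesgue_integral_def using u0 B(3)
      by (intro Bochner_Integration.integral_cong) (auto split: split_indicator simp: max_def P_def)
    finally show ?thesis .
  qed
  have iG: "set_integrable lborel B (\<lambda>x. u x powr q * G x)" "set_integrable lborel B (\<lambda>x. u x powr q * r)" for r
    by (intro set_integrable_continuous_compact[OF B(1)] continuous_on_mult cont(1)[OF q] cG continuous_on_const)+
  have "I v - I u \<le> (q + 1) * (LINT x:B|lborel. u x powr q * G x) + s" if s: "0 < s" for s
  proof -
    \<comment> \<open>The extra term is \<open>(q + 1) * M * r\<close>, which this choice makes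
      equal to \<open>s\<close>.\<close>
    define r where "r = s / ((q + 1) * M)"
    have r: "0 < r" using s q M by (simp add: r_def)
    have "(LINT x:B|lborel. u x powr q * (G x + r)) = (LINT x:B|lborel. u x powr q * G x) + M * r"
      using iG M by (simp add: distrib_left set_integral_add)
    then show ?thesis
      using main[OF r] q M s by (simp add: r_def distrib_left)
  qed
  then have "I v - I u \<le> (q + 1) * (LINT x:B|lborel. u x powr q * G x)"
    by (rule field_le_epsilon)
  then show ?thesis
    using q by (simp add: I_def HB uz vz G_def)
qed

section \<open>Hausdorff measures\<close>

lemma hausdorff_weight_empty [simp]: "hausdorff_weight m {} = 0"
  by (simp add: hausdorff_weight_def)

lemma hausdorff_premeasure_le:
  assumes "A \<subseteq> (\<Union>i. C i)" "\<And>i. bounded (C i)" "\<And>i. diameter (C i) \<le> r"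
  shows "hausdorff_premeasure m r A \<le> (\<Sum>i. hausdorff_weight m (C i))"
  unfolding hausdorff_premeasure_def using assms by (intro INF_lower) auto

lemma hausdorff_premeasure_antimono:
  "r \<le> s \<Longrightarrow> hausdorff_premeasure m s A \<le> hausdorff_premeasure m r A"
  unfolding hausdorff_premeasure_def by (intro INF_superset_mono) (auto intro: order_trans)

lemma hausdorff_premeasure_mono:
  "A \<subseteq> B \<Longrightarrow> hausdorff_premeasure m r A \<le> hausdorff_premeasure m r B"
  unfolding hausdorff_premeasure_def by (intro INF_superset_mono) auto

lemma hausdorff_premeasure_le_outer:
  "0 < r \<Longrightarrow> hausdorff_premeasure m r A \<le> hausdorff_outer m A"
  unfolding hausdorff_outer_def by (intro SUP_upper) auto

lemma hausdorff_outer_mono: "A \<subseteq> B \<Longrightarrow> hausdorff_outer m A \<le> hausdorff_outer m B"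
  unfolding hausdorff_outer_def by (intro SUP_mono) (auto intro: hausdorff_premeasure_mono)

lemma hausdorff_outer_empty [simp]: "hausdorff_outer m {} = 0"
proof -
  have "hausdorff_premeasure m r {} \<le> 0" if "0 < r" for r
    using hausdorff_premeasure_le[of "{}" "\<lambda>_. {}" r m] that by simp
  then show ?thesis
    unfolding hausdorff_outer_def by (intro antisym SUP_least) auto
qed

lemma hausdorff_premeasure_UN_le:
  "hausdorff_premeasure m r (\<Union>n. A n) \<le> (\<Sum>n. hausdorff_premeasure m r (A (n::nat)))"
proof (rule ennreal_le_epsilon)
  fix \<epsilon> :: real
  assume fin: "(\<Sum>n. hausdorff_premeasure m r (A n)) < top" and \<epsilon>: "0 < \<epsilon>"
  have "\<exists>C. A n \<subseteq> (\<Union>i. C i) \<and> (\<forall>i. bounded (C i) \<and> diameter (C i) \<le> r) \<and>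
      (\<Sum>i. hausdorff_weight m (C i)) \<le> hausdorff_premeasure m r (A n) + \<epsilon> * (1 / 2) ^ Suc n" for n
  proof -
    have "hausdorff_premeasure m r (A n) < top"
      using fin ennreal_suminf_lessD by blast
    then have "hausdorff_premeasure m r (A n) < hausdorff_premeasure m r (A n) + ennreal (\<epsilon> * (1 / 2) ^ Suc n)"
      using \<epsilon> by (cases "hausdorff_premeasure m r (A n)") (auto simp: ennreal_less_iff simp flip: ennreal_plus)
    then obtain C where "C \<in> {C :: nat \<Rightarrow> 'a set. A n \<subseteq> (\<Union>i. C i) \<and> (\<forall>i. bounded (C i) \<and> diameter (C i) \<le> r)}"
      "(\<Sum>i. hausdorff_weight m (C i)) < hausdorff_premeasure m r (A n) + ennreal (\<epsilon> * (1 / 2) ^ Suc n)"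
      unfolding hausdorff_premeasure_def INF_less_iff by blast
    then show ?thesis by (intro exI[of _ C]) (auto simp: less_imp_le)
  qed
  then obtain C where C: "\<And>n. A n \<subseteq> (\<Union>i. C n i)" "\<And>n i. bounded (C n i)" "\<And>n i. diameter (C n i) \<le> r"
    "\<And>n. (\<Sum>i. hausdorff_weight m (C n i)) \<le> hausdorff_premeasure m r (A n) + \<epsilon> * (1 / 2) ^ Suc n"
    by metis
  define D where "D k = (case prod_decode k of (n, i) \<Rightarrow> C n i)" for k
  have "hausdorff_premeasure m r (\<Union>n. A n) \<le> (\<Sum>k. hausdorff_weight m (D k))"
  proof (rule hausdorff_premeasure_le)
    show "(\<Union>n. A n) \<subseteq> (\<Union>k. D k)"
    proof
      fix x assume "x \<in> (\<Union>n. A n)"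
      then obtain n i where "x \<in> C n i" using C(1) by blast
      then have "x \<in> D (prod_encode (n, i))" by (simp add: D_def)
      then show "x \<in> (\<Union>k. D k)" by blast
    qed
  qed (use C in \<open>auto simp: D_def split: prod.split\<close>)
  also have "\<dots> = (\<Sum>k. (\<lambda>(n, i). hausdorff_weight m (C n i)) (prod_decode k))"
    by (intro suminf_cong) (auto simp: D_def split: prod.split)
  also have "\<dots> = (\<Sum>n. \<Sum>i. hausdorff_weight m (C n i))"
    by (rule suminf_ennreal_2dimen) simp
  also have "\<dots> \<le> (\<Sum>n. hausdorff_premeasure m r (A n) + \<epsilon> * (1 / 2) ^ Suc n)"
    by (intro suminf_le C summableI)
  also have "\<dots> = (\<Sum>n. hausdorff_premeasure m r (A n)) + (\<Sum>n. ennreal (\<epsilon> * (1 / 2) ^ Suc n))"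
    by (rule suminf_add[symmetric]) (auto intro: summableI)
  also have "(\<Sum>n. ennreal (\<epsilon> * (1 / 2) ^ Suc n)) = ennreal \<epsilon>"
    using sums_mult[OF power_half_series, of \<epsilon>] \<epsilon>
    by (intro suminf_ennreal_eq) auto
  finally show "hausdorff_premeasure m r (\<Union>n. A n) \<le> (\<Sum>n. hausdorff_premeasure m r (A n)) + ennreal \<epsilon>" .
qed

lemma hausdorff_outer_UN_le: "hausdorff_outer m (\<Union>n. A n) \<le> (\<Sum>n. hausdorff_outer m (A (n::nat)))"
  unfolding hausdorff_outer_def[of m "\<Union>n. A n"]
proof (rule SUP_least)
  fix r :: real assume "r \<in> {0<..}"
  then have "(\<Sum>n. hausdorff_premeasure m r (A n)) \<le> (\<Sum>n. hausdorff_outer m (A n))"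
    by (intro suminf_le summableI hausdorff_premeasure_le_outer) simp
  with hausdorff_premeasure_UN_le show "hausdorff_premeasure m r (\<Union>n. A n) \<le> (\<Sum>n. hausdorff_outer m (A n))"
    by (rule order_trans)
qed

lemma hausdorff_outer_space: "outer_measure_space (Pow UNIV) (hausdorff_outer m)"
  unfolding outer_measure_space_def positive_def increasing_def countably_subadditive_def
  by (auto intro: hausdorff_outer_mono hausdorff_outer_UN_le)

lemma hausdorff_outer_Un_le: "hausdorff_outer m (A \<union> B) \<le> hausdorff_outer m A + hausdorff_outer m B"
proof -
  interpret sigma_algebra UNIV "Pow UNIV :: 'a set set" by (rule sigma_algebra_Pow)
  have "subadditive (Pow UNIV) (hausdorff_outer m :: 'a set \<Rightarrow> ennreal)"
    using hausdorff_outer_space[of m]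
    unfolding outer_measure_space_def by (intro countably_subadditive_subadditive) auto
  then have "hausdorff_outer m (A \<union> (B - A)) \<le> hausdorff_outer m A + hausdorff_outer m (B - A)"
    by (rule subadditiveD) auto
  also have "\<dots> \<le> hausdorff_outer m A + hausdorff_outer m B"
    by (intro add_left_mono hausdorff_outer_mono) auto
  finally show ?thesis by simp
qed

text \<open>No covering set of diameter below the distance d can meet both \<open>A\<close> and
  \<open>B\<close>, so every sufficiently fine cover of the union splits into a cover of each. Since
  the premeasure grows as the mesh shrinks, fine covers suffice.\<close>

lemma hausdorff_outer_metric:
  assumes d: "0 < d" "\<And>x y. x \<in> A \<Longrightarrow> y \<in> B \<Longrightarrow> d \<le> dist x y"
  shows "hausdorff_outer m A + hausdorff_outer m B \<le> hausdorff_outer m (A \<union> B)"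
proof -
  have *: "hausdorff_premeasure m r A + hausdorff_premeasure m r B \<le> hausdorff_premeasure m r (A \<union> B)" if r: "r < d" for r
    unfolding hausdorff_premeasure_def[of m r "A \<union> B"]
  proof (rule INF_greatest)
    fix C assume "C \<in> {C :: nat \<Rightarrow> 'a set. A \<union> B \<subseteq> (\<Union>i. C i) \<and> (\<forall>i. bounded (C i) \<and> diameter (C i) \<le> r)}"
    then have C: "A \<union> B \<subseteq> (\<Union>i. C i)" "\<And>i. bounded (C i)" "\<And>i. diameter (C i) \<le> r" by auto
    \<comment> \<open>Sets missing \<open>X\<close> are replaced by the empty set, the only one
      whose weight is 0 in every dimension, including the counting case.\<close>
    define D where "D X i = (if C i \<inter> X = {} then {} else C i)" for X i
    have dD: "diameter (D X i) \<le> r" "bounded (D X i)" for X i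
      using C diameter_ge_0[OF C(2), of i] by (auto simp: D_def intro: order_trans)
    have "hausdorff_premeasure m r X \<le> (\<Sum>i. hausdorff_weight m (D X i))" if X: "X \<subseteq> A \<union> B" for X
    proof (rule hausdorff_premeasure_le[OF _ dD(2,1)])
      show "X \<subseteq> (\<Union>i. D X i)"
      proof
        fix x assume x: "x \<in> X"
        then obtain i where i: "x \<in> C i" using X C(1) by blast
        with x have "x \<in> D X i" by (auto simp: D_def)
        then show "x \<in> (\<Union>i. D X i)" by blast
      qed
    qed
    then have "hausdorff_premeasure m r A + hausdorff_premeasure m r B \<le>
        (\<Sum>i. hausdorff_weight m (D A i)) + (\<Sum>i. hausdorff_weight m (D B i))"
      by (intro add_mono) auto
    also have "\<dots> = (\<Sum>i. hausdorff_weight m (D A i) + hausdorff_weight m (D B i))"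
      by (rule suminf_add) (auto intro: summableI)
    also have "\<dots> \<le> (\<Sum>i. hausdorff_weight m (C i))"
    proof (intro suminf_le summableI)
      fix i
      have "C i \<inter> A = {} \<or> C i \<inter> B = {}"
      proof (rule ccontr)
        assume "\<not> ?thesis"
        then obtain x y where xy: "x \<in> C i" "x \<in> A" "y \<in> C i" "y \<in> B" by blast
        then have "d \<le> dist x y" using d(2) by blast
        also have "\<dots> \<le> diameter (C i)" using xy C by (intro diameter_bounded_bound)
        finally show False using C(3)[of i] r by simp
      qed
      then show "hausdorff_weight m (D A i) + hausdorff_weight m (D B i) \<le> hausdorff_weight m (C i)"
        by (auto simp: D_def)
    qed
    finally show "hausdorff_premeasure m r A + hausdorff_premeasure m r B \<le> (\<Sum>i. hausdorff_weight m (C i))" .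
  qed
  have "hausdorff_premeasure m r A + hausdorff_premeasure m s B \<le> hausdorff_outer m (A \<union> B)" if "0 < r" "0 < s" for r s
  proof -
    define q where "q = min (min r s) (d / 2)"
    have q: "0 < q" "q \<le> r" "q \<le> s" "q < d" using that d(1) by (auto simp: q_def)
    have "hausdorff_premeasure m r A + hausdorff_premeasure m s B \<le> hausdorff_premeasure m q A + hausdorff_premeasure m q B"
      using q by (intro add_mono hausdorff_premeasure_antimono)
    also have "\<dots> \<le> hausdorff_outer m (A \<union> B)"
      using *[OF q(4)] hausdorff_premeasure_le_outer[OF q(1)] by (rule order_trans)
    finally show ?thesis .
  qed
  then have "(SUP r\<in>{0<..}. hausdorff_premeasure m r A + hausdorff_premeasure m s B) \<le> hausdorff_outer m (A \<union> B)" if "0 < s" for s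
    using that by (intro SUP_least) auto
  then have "hausdorff_outer m A + hausdorff_premeasure m s B \<le> hausdorff_outer m (A \<union> B)" if "0 < s" for s
    unfolding hausdorff_outer_def[of m A] using that
    by (subst ennreal_SUP_add_left[symmetric]) auto
  then have "(SUP s\<in>{0<..}. hausdorff_outer m A + hausdorff_premeasure m s B) \<le> hausdorff_outer m (A \<union> B)"
    by (intro SUP_least) auto
  then show ?thesis
    unfolding hausdorff_outer_def[of m B]
    by (subst ennreal_SUP_add_right) auto
qed

text \<open>Caratheodory's criterion. The part \<open>An n\<close> of \<open>A\<close> at distance
  at least 1 / (n + 1) from \<open>F\<close> is additive with \<open>A \<inter> F\<close>, and the
  remainder is cut into the shells \<open>R k\<close>. Shells whose indices differ by two are
  separated, so the even and the odd shells each have total measure at most that of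
  \<open>A\<close>; the series over all shells converges and its tails vanish.\<close>

lemma hausdorff_outer_caratheodory_closed:
  fixes F :: "'a::metric_space set"
  assumes F: "closed F"
  shows "hausdorff_outer m (A \<inter> F) + hausdorff_outer m (A - F) = hausdorff_outer m A"
proof (rule antisym)
  have "A = (A \<inter> F) \<union> (A - F)" by blast
  then show "hausdorff_outer m A \<le> hausdorff_outer m (A \<inter> F) + hausdorff_outer m (A - F)"
    using hausdorff_outer_Un_le by metis
  show "hausdorff_outer m (A \<inter> F) + hausdorff_outer m (A - F) \<le> hausdorff_outer m A"
  proof (cases "F = {} \<or> hausdorff_outer m A = \<infinity>")
    case False
    then have ne: "F \<noteq> {}" and fin: "hausdorff_outer m A \<noteq> top" by auto
    define f where "f x = infdist x F" for x
    have f: "f x \<le> f y + dist x y" for x y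
      unfolding f_def by (rule infdist_triangle)
    have f0: "x \<in> F \<longleftrightarrow> f x = 0" for x
      unfolding f_def using F ne by (rule in_closed_iff_infdist_zero)
    have fnn: "0 \<le> f x" for x by (simp add: f_def infdist_nonneg)
    define An where "An n = {x \<in> A. 1 / real (Suc n) \<le> f x}" for n
    define R where "R k = {x \<in> A. 1 / real (Suc (Suc k)) \<le> f x \<and> f x < 1 / real (Suc k)}" for k
    have sumR: "(\<Sum>k. hausdorff_outer m (R (2 * k + j))) \<le> hausdorff_outer m A" for j
    proof (rule suminf_le_const[OF summableI])
      fix N
      have "(\<Sum>k<N. hausdorff_outer m (R (2 * k + j))) \<le> hausdorff_outer m (\<Union>k<N. R (2 * k + j))"
      proof (induction N)
        case (Suc N)
        have "(\<Sum>k<Suc N. hausdorff_outer m (R (2 * k + j))) \<le>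
            hausdorff_outer m (\<Union>k<N. R (2 * k + j)) + hausdorff_outer m (R (2 * N + j))"
          using Suc.IH by (simp add: add_right_mono)
        also have "\<dots> \<le> hausdorff_outer m ((\<Union>k<N. R (2 * k + j)) \<union> R (2 * N + j))"
        proof (rule hausdorff_outer_metric)
          \<comment> \<open>The width of the skipped shell is the distance between the new shell and
            all earlier ones of the same parity. For \<open>N = 0\<close> the union is empty, so any
            positive number serves.\<close>
          have "1 / real (Suc (2 * N + j)) < 1 / real (2 * N + j)" if "N \<noteq> 0"
            using that by (intro divide_strict_left_mono) auto
          then show "0 < (if N = 0 then 1 else 1 / real (2 * N + j) - 1 / real (Suc (2 * N + j)))"
            by simp
          fix x y assume "x \<in> (\<Union>k<N. R (2 * k + j))" and y: "y \<in> R (2 * N + j)"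
          then obtain k where k: "k < N" "x \<in> R (2 * k + j)" by blast
          have "1 / real (2 * N + j) \<le> 1 / real (Suc (Suc (2 * k + j)))"
            using k by (intro divide_left_mono) auto
          also have "\<dots> \<le> f x" using k by (simp add: R_def)
          also have "\<dots> \<le> f y + dist x y" by (rule f)
          also have "f y \<le> 1 / real (Suc (2 * N + j))" using y by (simp add: R_def)
          finally show "(if N = 0 then 1 else 1 / real (2 * N + j) - 1 / real (Suc (2 * N + j))) \<le> dist x y"
            using k by simp
        qed
        also have "(\<Union>k<N. R (2 * k + j)) \<union> R (2 * N + j) = (\<Union>k<Suc N. R (2 * k + j))"
          by (auto simp: lessThan_Suc)
        finally show ?case .
      qed simp
      also have "\<dots> \<le> hausdorff_outer m A"
        by (intro hausdorff_outer_mono) (auto simp: R_def)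
      finally show "(\<Sum>k<N. hausdorff_outer m (R (2 * k + j))) \<le> hausdorff_outer m A" .
    qed
    have sfin: "(\<Sum>k. hausdorff_outer m (R k)) \<noteq> top"
    proof -
      have "(\<Sum>k<n. hausdorff_outer m (R k)) \<le> hausdorff_outer m A + hausdorff_outer m A" for n
      proof -
        have "(\<Sum>k<n. hausdorff_outer m (R k)) \<le> (\<Sum>k<2 * n. hausdorff_outer m (R k))"
          by (intro sum_mono2) auto
        also have "\<dots> = (\<Sum>k<n. hausdorff_outer m (R (2 * k + 0))) + (\<Sum>k<n. hausdorff_outer m (R (2 * k + 1)))"
          by (induction n) (auto simp: ac_simps)
        also have "\<dots> \<le> (\<Sum>k. hausdorff_outer m (R (2 * k + 0))) + (\<Sum>k. hausdorff_outer m (R (2 * k + 1)))"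
          by (intro add_mono sum_le_suminf summableI) auto
        also have "\<dots> \<le> hausdorff_outer m A + hausdorff_outer m A"
          by (intro add_mono sumR)
        finally show ?thesis .
      qed
      then have "(\<Sum>k. hausdorff_outer m (R k)) \<le> hausdorff_outer m A + hausdorff_outer m A"
        by (intro suminf_le_const summableI)
      then show ?thesis using fin by (auto simp: top_unique)
    qed
    have le: "hausdorff_outer m (A \<inter> F) + hausdorff_outer m (A - F) \<le> hausdorff_outer m A + (\<Sum>k. hausdorff_outer m (R (k + n)))" for n
    proof -
      have "A - F \<subseteq> An n \<union> (\<Union>k. R (k + n))"
      proof
        fix x assume x: "x \<in> A - F"
        show "x \<in> An n \<union> (\<Union>k. R (k + n))"
        proof (cases "1 / real (Suc n) \<le> f x")
          case False
          have "0 < f x" using x f0[of x] fnn[of x] by auto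
          then obtain l where l: "1 / real (Suc l) < f x"
            using reals_Archimedean[of "f x"] unfolding inverse_eq_divide by blast
          \<comment> \<open>Minimality places \<open>x\<close> in the shell just before index
            \<open>k\<close>; \<open>k > n\<close> because \<open>x\<close> is not in
            \<open>An n\<close>, so that shell belongs to the tail.\<close>
          define k where "k = (LEAST k. 1 / real (Suc k) \<le> f x)"
          have k: "1 / real (Suc k) \<le> f x" unfolding k_def using less_imp_le[OF l] by (rule LeastI)
          have kn: "n < k"
          proof (rule ccontr)
            assume "\<not> n < k"
            then have "1 / real (Suc n) \<le> 1 / real (Suc k)" by (intro divide_left_mono) auto
            with k False show False by simp
          qed
          then obtain i where i: "k = Suc (i + n)"
            using less_imp_Suc_add[OF kn] by (auto simp: add.commute)
          have "\<not> 1 / real (Suc (i + n)) \<le> f x"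
            using not_less_Least[of "i + n" "\<lambda>k. 1 / real (Suc k) \<le> f x"] i by (simp add: k_def)
          then have "x \<in> R (i + n)" using k i x by (simp add: R_def)
          then show ?thesis by blast
        qed (use x in \<open>simp add: An_def\<close>)
      qed
      then have "hausdorff_outer m (A - F) \<le> hausdorff_outer m (An n \<union> (\<Union>k. R (k + n)))"
        by (rule hausdorff_outer_mono)
      also have "\<dots> \<le> hausdorff_outer m (An n) + hausdorff_outer m (\<Union>k. R (k + n))"
        by (rule hausdorff_outer_Un_le)
      also have "\<dots> \<le> hausdorff_outer m (An n) + (\<Sum>k. hausdorff_outer m (R (k + n)))"
        by (intro add_left_mono hausdorff_outer_UN_le)
      finally have "hausdorff_outer m (A \<inter> F) + hausdorff_outer m (A - F) \<le>
          (hausdorff_outer m (A \<inter> F) + hausdorff_outer m (An n)) + (\<Sum>k. hausdorff_outer m (R (k + n)))"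
        by (simp add: add.assoc add_left_mono)
      also have "hausdorff_outer m (A \<inter> F) + hausdorff_outer m (An n) \<le> hausdorff_outer m ((A \<inter> F) \<union> An n)"
      proof (rule hausdorff_outer_metric)
        show "0 < 1 / real (Suc n)" by simp
        fix x y assume "x \<in> A \<inter> F" "y \<in> An n"
        then show "1 / real (Suc n) \<le> dist x y"
          using f[of y x] f0[of x] by (auto simp: An_def dist_commute)
      qed
      also have "\<dots> \<le> hausdorff_outer m A"
        by (intro hausdorff_outer_mono) (auto simp: An_def)
      finally show ?thesis by (simp add: add_right_mono)
    qed
    have "(\<lambda>n. \<Sum>k. hausdorff_outer m (R (k + n))) \<longlonglongrightarrow> 0"
    proof -
      define g where "g k = enn2real (hausdorff_outer m (R k))" for k
      have g: "hausdorff_outer m (R k) = ennreal (g k)" for k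
        using sfin ennreal_suminf_lessD[of "\<lambda>k. hausdorff_outer m (R k)" top k]
        by (simp add: g_def less_top)
      have g0: "0 \<le> g k" for k by (simp add: g_def)
      have sg: "summable g"
        using sfin g0 by (intro summable_suminf_not_top) (auto simp: g)
      have "(\<lambda>n. ennreal (suminf g - (\<Sum>k<n. g k))) \<longlonglongrightarrow> ennreal (suminf g - suminf g)"
        by (intro tendsto_ennrealI tendsto_diff tendsto_const summable_LIMSEQ sg)
      moreover have "(\<Sum>k. hausdorff_outer m (R (k + n))) = ennreal (suminf g - (\<Sum>k<n. g k))" for n
        unfolding g using sg g0
        by (subst suminf_ennreal2) (auto simp: suminf_minus_initial_segment)
      ultimately show ?thesis by simp
    qed
    then have "(\<lambda>n. hausdorff_outer m A + (\<Sum>k. hausdorff_outer m (R (k + n)))) \<longlonglongrightarrow> hausdorff_outer m A + 0"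
      by (intro tendsto_add tendsto_const)
    then show ?thesis
      using le by (intro LIMSEQ_le_const) auto
  qed (auto)
qed

lemma measure_space_hausdorff_outer:
  "measure_space UNIV (sets borel) (hausdorff_outer m :: 'a::metric_space set \<Rightarrow> ennreal)"
proof -
  interpret sigma_algebra UNIV "Pow UNIV :: 'a set set" by (rule sigma_algebra_Pow)
  let ?L = "lambda_system UNIV (Pow UNIV) (hausdorff_outer m :: 'a set \<Rightarrow> ennreal)"
  have L: "measure_space UNIV ?L (hausdorff_outer m)"
    by (rule caratheodory_lemma[OF hausdorff_outer_space])
  then interpret L: sigma_algebra UNIV ?L
    by (simp add: measure_space_def)
  have "Collect closed \<subseteq> ?L"
    using hausdorff_outer_caratheodory_closed
    by (auto simp: lambda_system_def Int_commute Diff_eq Compl_eq_Diff_UNIV[symmetric])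
  then have "sigma_sets UNIV (Collect closed) \<subseteq> ?L"
    by (rule L.sigma_sets_subset)
  then have "sets borel \<subseteq> ?L"
    by (simp add: borel_eq_closed)
  then show ?thesis
    using L by (intro measure_down[OF L]) (auto simp: sets.sigma_algebra_axioms[of borel, simplified])
qed

lemma sets_hausdorff_measure [simp, measurable_cong]: "sets (hausdorff_measure m) = sets borel"
  and space_hausdorff_measure [simp]: "space (hausdorff_measure m) = UNIV"
  unfolding hausdorff_measure_def
  by (simp_all add: sets.sigma_sets_eq[of borel, simplified])

lemma emeasure_hausdorff_measure:
  assumes "A \<in> sets borel"
  shows "emeasure (hausdorff_measure m) A = hausdorff_outer m A"
  unfolding hausdorff_measure_def using assms measure_space_hausdorff_outer[of m]
  by (intro emeasure_measure_of_sigma) (auto simp: measure_space_def)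

section \<open>Translation invariance and two-sided bounds on a coordinate hyperplane\<close>

lemma diameter_translation:
  fixes S :: "'a::real_normed_vector set"
  shows "diameter ((+) c ` S) = diameter S"
proof -
  have "(+) c ` S \<times> (+) c ` S = (\<lambda>(x, y). (c + x, c + y)) ` (S \<times> S)"
    by auto
  then show ?thesis
    by (simp add: diameter_def image_image case_prod_unfold)
qed

lemma hausdorff_outer_translation:
  fixes A :: "'a::real_normed_vector set"
  shows "hausdorff_outer m ((+) c ` A) = hausdorff_outer m A"
proof -
  have *: "hausdorff_premeasure m r ((+) c ` A) \<le> hausdorff_premeasure m r A" for r and c :: 'a and A
    unfolding hausdorff_premeasure_def[of m r A]
  proof (rule INF_greatest)
    fix C assume "C \<in> {C :: nat \<Rightarrow> 'a set. A \<subseteq> (\<Union>i. C i) \<and> (\<forall>i. bounded (C i) \<and> diameter (C i) \<le> r)}"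
    then have C: "A \<subseteq> (\<Union>i. C i)" "\<And>i. bounded (C i)" "\<And>i. diameter (C i) \<le> r" by auto
    have "hausdorff_premeasure m r ((+) c ` A) \<le> (\<Sum>i. hausdorff_weight m ((+) c ` C i))"
    proof (rule hausdorff_premeasure_le)
      show "(+) c ` A \<subseteq> (\<Union>i. (+) c ` C i)" using C(1) by blast
    qed (use C in \<open>auto simp: diameter_translation intro: bounded_translation\<close>)
    also have "\<dots> = (\<Sum>i. hausdorff_weight m (C i))"
      unfolding hausdorff_weight_def diameter_translation by simp
    finally show "hausdorff_premeasure m r ((+) c ` A) \<le> (\<Sum>i. hausdorff_weight m (C i))" .
  qed
  have "hausdorff_premeasure m r ((+) c ` A) = hausdorff_premeasure m r A" for r
  proof (rule antisym[OF *])
    have "(+) (- c) ` (+) c ` A = A" by (simp add: image_image)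
    then show "hausdorff_premeasure m r A \<le> hausdorff_premeasure m r ((+) c ` A)"
      using *[of r "- c" "(+) c ` A"] by simp
  qed
  then show ?thesis by (simp add: hausdorff_outer_def)
qed

lemma hausdorff_premeasure_finite_cover:
  assumes "finite J" "A \<subseteq> (\<Union>j\<in>J. C j)" "\<And>j. j \<in> J \<Longrightarrow> bounded (C j)" "\<And>j. j \<in> J \<Longrightarrow> diameter (C j) \<le> r" "0 \<le> r"
  shows "hausdorff_premeasure m r A \<le> (\<Sum>j\<in>J. hausdorff_weight m (C j))"
proof -
  obtain h where h: "bij_betw h {0..<card J} J"
    using ex_bij_betw_nat_finite[OF assms(1)] by blast
  define D where "D i = (if i < card J then C (h i) else {})" for i
  have hJ: "h i \<in> J" if "i < card J" for i
    using h that by (auto simp: bij_betw_def)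
  have "hausdorff_premeasure m r A \<le> (\<Sum>i. hausdorff_weight m (D i))"
  proof (rule hausdorff_premeasure_le)
    show "A \<subseteq> (\<Union>i. D i)"
    proof
      fix x assume "x \<in> A"
      then obtain j where j: "j \<in> J" "x \<in> C j" using assms(2) by blast
      then have "j \<in> h ` {0..<card J}" using h by (simp add: bij_betw_def)
      then obtain i where "i < card J" "j = h i" by auto
      then have "x \<in> D i" using j by (simp add: D_def)
      then show "x \<in> (\<Union>i. D i)" by blast
    qed
  qed (use assms(3-5) hJ in \<open>auto simp: D_def\<close>)
  also have "\<dots> = (\<Sum>i\<in>{0..<card J}. hausdorff_weight m (C (h i)))"
    by (subst suminf_finite[of "{0..<card J}"]) (auto simp: D_def)
  also have "\<dots> = (\<Sum>j\<in>J. hausdorff_weight m (C j))"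
    by (rule sum.reindex_bij_betw[OF h])
  finally show ?thesis .
qed

text \<open>A grid of mesh 1 / N has (2 n N)^m cells with m = \<open>DIM('a) - 1\<close>, each of
  diameter at most m / N by comparison with the l1 norm. In the total weight the powers of N cancel,
  and \<open>W\<close> remains, whatever the mesh.\<close>

lemma hausdorff_outer_hyperplane_box_finite:
  fixes e :: "'a::euclidean_space"
  assumes e: "e \<in> Basis" and n: "0 < n"
  shows "hausdorff_outer (DIM('a) - 1) (half_space_bd e \<inter> cbox (- real n *\<^sub>R One) (real n *\<^sub>R One)) < \<infinity>"
    (is "hausdorff_outer ?m ?A < _")
proof -
  define E where "E = Basis - {e}"
  have E: "finite E" "card E = ?m" "Basis = insert e E" "e \<notin> E"
    using e by (auto simp: E_def)
  have sumB: "sum f Basis = f e + sum f E" and prodB: "prod f Basis = f e * prod f E" for f :: "'a \<Rightarrow> real"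
    unfolding E(3) using E(1,4) by auto
  define W where "W = unit_ball_vol (real ?m) * (real n * real ?m) ^ ?m"
  have W0: "0 \<le> W" unfolding W_def by (intro mult_nonneg_nonneg) (auto simp: less_imp_le)
  have "hausdorff_premeasure ?m r ?A \<le> ennreal W" if r: "0 < r" for r
  proof -
    obtain N where N: "real ?m / r < real N" "0 < N"
    proof -
      obtain N where "real ?m / r < real N" using reals_Archimedean2 by blast
      then show ?thesis using r that by (cases "N = 0") (auto simp: divide_less_0_iff)
    qed
    define J where "J = Pi\<^sub>E E (\<lambda>_. {0..<2 * n * N})"
    define C where "C k = {x. x \<bullet> e = 0 \<and> (\<forall>b\<in>E. real (k b) / real N - real n \<le> x \<bullet> b \<and> x \<bullet> b \<le> (real (k b) + 1) / real N - real n)}" for k :: "'a \<Rightarrow> nat"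
    have nC: "norm (x - y) \<le> real ?m / real N" if xy: "x \<in> C k" "y \<in> C k" for x y k
    proof -
      have "norm (x - y) \<le> (\<Sum>b\<in>Basis. \<bar>(x - y) \<bullet> b\<bar>)" by (rule norm_le_l1)
      also have "\<dots> = (\<Sum>b\<in>E. \<bar>(x - y) \<bullet> b\<bar>)"
        unfolding sumB using xy by (simp add: C_def inner_diff_left)
      also have "\<dots> \<le> (\<Sum>b\<in>E. 1 / real N)"
      proof (rule sum_mono)
        fix b assume "b \<in> E"
        then have "real (k b) / real N - real n \<le> x \<bullet> b" "x \<bullet> b \<le> (real (k b) + 1) / real N - real n"
          "real (k b) / real N - real n \<le> y \<bullet> b" "y \<bullet> b \<le> (real (k b) + 1) / real N - real n"
          using xy by (auto simp: C_def)
        then show "\<bar>(x - y) \<bullet> b\<bar> \<le> 1 / real N"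
          by (auto simp: inner_diff_left add_divide_distrib abs_le_iff)
      qed
      finally show ?thesis by (simp add: E(2))
    qed
    have dC: "diameter (C k) \<le> real ?m / real N" for k
      using nC by (intro diameter_le) auto
    have bC: "bounded (C k)" for k
    proof (cases "C k = {}")
      case False
      then obtain x where x: "x \<in> C k" by blast
      have "C k \<subseteq> cball x (real ?m / real N)"
        using nC[OF x] by (auto simp: dist_norm)
      then show ?thesis by (rule bounded_subset[OF bounded_cball])
    qed simp
    have "hausdorff_premeasure ?m r ?A \<le> (\<Sum>k\<in>J. hausdorff_weight ?m (C k))"
    proof (rule hausdorff_premeasure_finite_cover)
      show "finite J" unfolding J_def using E by (intro finite_PiE) auto
      show "?A \<subseteq> (\<Union>k\<in>J. C k)"
      proof
        fix x assume x: "x \<in> ?A"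
        have xb: "- real n \<le> x \<bullet> b" "x \<bullet> b \<le> real n" if "b \<in> E" for b
          using x that E by (auto simp: mem_box inner_sum_left_Basis)
        \<comment> \<open>On the upper face the floor is \<open>2 * n * N\<close>, one past the last
          index; the minimum moves such a point into the last cell, which is closed.\<close>
        define k where "k = (\<lambda>b\<in>E. min (nat \<lfloor>(x \<bullet> b + real n) * real N\<rfloor>) (2 * n * N - 1))"
        have k: "k b < 2 * n * N \<and> real (k b) / real N - real n \<le> x \<bullet> b \<and> x \<bullet> b \<le> (real (k b) + 1) / real N - real n"
          if b: "b \<in> E" for b
        proof -
          define s where "s = (x \<bullet> b + real n) * real N"
          have s: "0 \<le> s" "s \<le> real (2 * n * N)"
          proof -
            show "0 \<le> s" using xb[OF b] by (simp add: s_def)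
            have "s \<le> (real n + real n) * real N" unfolding s_def using xb[OF b] by (intro mult_right_mono) auto
            then show "s \<le> real (2 * n * N)" by simp
          qed
          have kb: "k b = min (nat \<lfloor>s\<rfloor>) (2 * n * N - 1)" using b by (simp add: k_def s_def)
          have pos: "0 < 2 * n * N" using n N by simp
          have 1: "real (k b) \<le> s"
          proof -
            have "real (k b) \<le> real (nat \<lfloor>s\<rfloor>)" unfolding kb by simp
            also have "\<dots> \<le> s" using s by simp
            finally show ?thesis .
          qed
          have 2: "s \<le> real (k b) + 1"
          proof (cases "nat \<lfloor>s\<rfloor> \<le> 2 * n * N - 1")
            case True
            then have "real (k b) = real_of_int \<lfloor>s\<rfloor>" using s by (simp add: kb)
            then show ?thesis by linarith
          next
            case False
            then have "k b = 2 * n * N - 1" by (simp add: kb)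
            then show ?thesis using s pos by (simp add: of_nat_diff)
          qed
          have 3: "k b < 2 * n * N"
            using pos unfolding kb min_less_iff_disj by linarith
          have xs: "x \<bullet> b = s / real N - real n" using N by (simp add: s_def)
          show ?thesis
            using 1 2 3 N unfolding xs by (auto simp: divide_right_mono)
        qed
        have "k \<in> J" "x \<in> C k"
          using k x by (auto simp: J_def C_def k_def half_space_bd_def)
        then show "x \<in> (\<Union>k\<in>J. C k)" by blast
      qed
      have "real ?m / real N \<le> r" using N r by (simp add: field_simps)
      then show "diameter (C k) \<le> r" for k using dC[of k] by simp
    qed (use bC r in auto)
    also have "\<dots> \<le> (\<Sum>k\<in>J. ennreal (unit_ball_vol (real ?m) * (real ?m / real N / 2) ^ ?m))"
    proof (rule sum_mono)
      fix k
      show "hausdorff_weight ?m (C k) \<le> ennreal (unit_ball_vol (real ?m) * (real ?m / real N / 2) ^ ?m)"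
        unfolding hausdorff_weight_def using dC[of k] diameter_ge_0[OF bC, of k]
        by (auto intro!: ennreal_leI mult_left_mono power_mono divide_right_mono simp: less_imp_le)
    qed
    also have "\<dots> = ennreal (real (card J) * (unit_ball_vol (real ?m) * (real ?m / real N / 2) ^ ?m))"
      by (simp add: ennreal_mult less_imp_le ennreal_of_nat_eq_real_of_nat)
    also have "real (card J) * (unit_ball_vol (real ?m) * (real ?m / real N / 2) ^ ?m) = W"
    proof -
      have "card J = (2 * n * N) ^ ?m"
        using E by (simp add: J_def card_PiE prod_constant)
      then have "real (card J) * (real ?m / real N / 2) ^ ?m = (real (2 * n * N) * (real ?m / real N / 2)) ^ ?m"
        by (simp only: of_nat_power power_mult_distrib of_nat_mult)
      also have "real (2 * n * N) * (real ?m / real N / 2) = real n * real ?m"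
        using N by simp
      finally show ?thesis by (simp add: W_def)
    qed
    finally show ?thesis .
  qed
  then have "hausdorff_outer ?m ?A \<le> ennreal W"
    unfolding hausdorff_outer_def by (intro SUP_least) auto
  then show ?thesis
    by (rule le_less_trans) simp
qed

text \<open>Thickening: around each covering set of diameter d stands a box of half-side d within
  the hyperplane and of height 1 along \<open>e\<close>. Its volume (2 d)^m is \<open>w\<close>
  times the weight of the set, with m = \<open>DIM('a) - 1\<close>. The boxes cover the unit cube,
  because every point of it projects into a covered point of its face, so the weights add up to at
  least \<open>1 / w\<close>.\<close>

lemma hausdorff_outer_hyperplane_cube_pos:
  fixes e :: "'a::euclidean_space"
  assumes e: "e \<in> Basis"
  shows "0 < hausdorff_outer (DIM('a) - 1) (half_space_bd e \<inter> cbox 0 One)"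
    (is "0 < hausdorff_outer ?m ?A")
proof -
  define E where "E = Basis - {e}"
  have E: "finite E" "card E = ?m" "Basis = insert e E" "e \<notin> E"
    using e by (auto simp: E_def)
  have sumB: "sum f Basis = f e + sum f E" and prodB: "prod f Basis = f e * prod f E" for f :: "'a \<Rightarrow> real"
    unfolding E(3) using E(1,4) by auto
  define w where "w = 4 ^ ?m / unit_ball_vol (real ?m)"
  have ub: "0 < unit_ball_vol (real ?m)" by simp
  have w: "0 < w" unfolding w_def by (intro divide_pos_pos ub) simp
  have wV: "w * unit_ball_vol (real ?m) = 4 ^ ?m"
    unfolding w_def times_divide_eq_left by (rule nonzero_mult_div_cancel_right[OF less_imp_neq[OF ub, symmetric]])
  have "1 \<le> ennreal w * hausdorff_premeasure ?m 1 ?A"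
  proof -
    have "ennreal (1 / w) \<le> hausdorff_premeasure ?m 1 ?A"
      unfolding hausdorff_premeasure_def
    proof (rule INF_greatest)
      fix C assume "C \<in> {C :: nat \<Rightarrow> 'a set. ?A \<subseteq> (\<Union>i. C i) \<and> (\<forall>i. bounded (C i) \<and> diameter (C i) \<le> 1)}"
      then have C: "?A \<subseteq> (\<Union>i. C i)" "\<And>i. bounded (C i)" by auto
      define a where "a i = (SOME x. x \<in> C i)" for i
      have a: "a i \<in> C i" if "C i \<noteq> {}" for i
        unfolding a_def using that by (auto intro: someI)
      define d where "d i = diameter (C i)" for i
      have d: "0 \<le> d i" for i unfolding d_def using C by (intro diameter_ge_0)
      \<comment> \<open>Lower and upper corners of the thickened box: half-side \<open>d i\<close>
        around the chosen point \<open>a i\<close> in the directions of \<open>E\<close>, and [0, 1]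
        in the direction \<open>e\<close>.\<close>
      define l where "l i = (\<Sum>b\<in>E. (a i \<bullet> b - d i) *\<^sub>R b)" for i
      define u where "u i = (\<Sum>b\<in>E. (a i \<bullet> b + d i) *\<^sub>R b) + e" for i
      define T where "T i = (if C i = {} then {} else cbox (l i) (u i))" for i
      have sE: "(\<Sum>b\<in>E. f b *\<^sub>R b) \<bullet> c = (if c \<in> E then f c else 0)" if "c \<in> Basis" for f :: "'a \<Rightarrow> real" and c
      proof -
        have "(\<Sum>b\<in>E. f b *\<^sub>R b) \<bullet> c = (\<Sum>b\<in>E. if b = c then f b else 0)"
          unfolding inner_sum_left using that E by (intro sum.cong) (auto simp: inner_Basis)
        also have "\<dots> = (if c \<in> E then f c else 0)" using E by simp
        finally show ?thesis .
      qed
      have lu: "l i \<bullet> e = 0" "u i \<bullet> e = 1" "\<And>b. b \<in> E \<Longrightarrow> l i \<bullet> b = a i \<bullet> b - d i" "\<And>b. b \<in> E \<Longrightarrow> u i \<bullet> b = a i \<bullet> b + d i" for i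
        using E e by (auto simp: l_def u_def sE inner_add_left inner_Basis)
      have eT: "emeasure lborel (T i) \<le> ennreal w * hausdorff_weight ?m (C i)" for i
      proof (cases "C i = {}")
        case False
        have "emeasure lborel (T i) = ennreal (\<Prod>b\<in>Basis. (u i - l i) \<bullet> b)"
          using False lu d[of i] unfolding T_def E(3) by (simp add: emeasure_lborel_cbox_eq E(3))
        also have "(\<Prod>b\<in>Basis. (u i - l i) \<bullet> b) = (\<Prod>b\<in>E. 2 * d i)"
          unfolding prodB using lu by (simp add: inner_diff_left)
        also have "\<dots> = (2 * d i) ^ ?m" by (simp add: E(2))
        also have "\<dots> = w * (unit_ball_vol (real ?m) * (d i / 2) ^ ?m)"
        proof -
          have "w * (unit_ball_vol (real ?m) * (d i / 2) ^ ?m) = 4 ^ ?m * (d i / 2) ^ ?m"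
            unfolding wV[symmetric] by (simp only: mult.assoc)
          also have "\<dots> = (4 * (d i / 2)) ^ ?m" by (simp only: power_mult_distrib)
          finally show ?thesis by simp
        qed
        also have "ennreal \<dots> = ennreal w * hausdorff_weight ?m (C i)"
          using False w d[of i] by (simp add: hausdorff_weight_def d_def ennreal_mult less_imp_le)
        finally show ?thesis by simp
      qed (simp add: T_def)
      have "cbox 0 One \<subseteq> (\<Union>i. T i)"
      proof
        fix y :: 'a assume y: "y \<in> cbox 0 One"
        have yb: "0 \<le> y \<bullet> b" "y \<bullet> b \<le> 1" if "b \<in> Basis" for b
          using y that by (auto simp: mem_box)
        define z where "z = y - (y \<bullet> e) *\<^sub>R e"
        have eb: "e \<bullet> b = 0" if "b \<in> E" for b
          using e that by (auto simp: E_def intro!: inner_not_same_Basis)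
        have z: "z \<bullet> e = 0" "\<And>b. b \<in> E \<Longrightarrow> z \<bullet> b = y \<bullet> b"
          using e by (auto simp: z_def inner_diff_left eb)
        have "z \<in> ?A"
        proof -
          have "0 \<le> z \<bullet> b \<and> z \<bullet> b \<le> 1" if "b \<in> Basis" for b
            using that z yb[OF that] by (cases "b = e") (auto simp: E_def)
          then show ?thesis using z by (auto simp: half_space_bd_def mem_box)
        qed
        then obtain i where i: "z \<in> C i" using C by blast
        have "y \<in> T i"
        proof -
          have za: "\<bar>z \<bullet> b - a i \<bullet> b\<bar> \<le> d i" if "b \<in> E" for b
          proof -
            have "\<bar>(z - a i) \<bullet> b\<bar> \<le> norm (z - a i)"
              using that E by (intro Basis_le_norm) auto
            also have "\<dots> \<le> d i"
              unfolding d_def dist_norm[symmetric] using i a[of i] C(2) by (intro diameter_bounded_bound) auto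
            finally show ?thesis by (simp add: inner_diff_left)
          qed
          have "l i \<bullet> b \<le> y \<bullet> b \<and> y \<bullet> b \<le> u i \<bullet> b" if "b \<in> Basis" for b
          proof (cases "b = e")
            case True
            then show ?thesis using lu(1,2)[of i] yb[OF e] by simp
          next
            case False
            then have b: "b \<in> E" using that by (simp add: E_def)
            show ?thesis
              using za[OF b] lu(3,4)[OF b, of i] z(2)[OF b] by linarith
          qed
          then show ?thesis using i by (auto simp: T_def mem_box)
        qed
        then show "y \<in> (\<Union>i. T i)" by blast
      qed
      then have "emeasure lborel (cbox 0 (One :: 'a)) \<le> emeasure lborel (\<Union>i. T i)"
        by (intro emeasure_mono) (auto simp: T_def)
      also have "\<dots> \<le> (\<Sum>i. emeasure lborel (T i))"
        by (intro emeasure_subadditive_countably) (auto simp: T_def)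
      also have "\<dots> \<le> (\<Sum>i. ennreal w * hausdorff_weight ?m (C i))"
        by (intro suminf_le summableI eT)
      also have "\<dots> = ennreal w * (\<Sum>i. hausdorff_weight ?m (C i))"
        by (rule ennreal_suminf_cmult)
      finally have "1 \<le> ennreal w * (\<Sum>i. hausdorff_weight ?m (C i))"
        by (simp add: emeasure_lborel_cbox_eq)
      then show "ennreal (1 / w) \<le> (\<Sum>i. hausdorff_weight ?m (C i))"
        using ennreal_mult_inverse_le_iff[of "1 / w" "1 / w"] w by simp
    qed
    then have "ennreal w * ennreal (1 / w) \<le> ennreal w * hausdorff_premeasure ?m 1 ?A"
      by (rule mult_left_mono) simp
    then show ?thesis using w by (simp add: ennreal_mult[symmetric])
  qed
  then have "0 < hausdorff_premeasure ?m 1 ?A"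
    by (auto intro: gr_zeroI)
  then show ?thesis
    using hausdorff_premeasure_le_outer[of 1 ?m ?A] by simp
qed

section \<open>Hyperplanes and Fubini\<close>

text \<open>The uniqueness argument for Haar measure: the double integral of
  \<open>indicator A x * indicator B (x + y)\<close> is evaluated once by translating y and once by
  translating x. Stating the result as an equality of products avoids division by measures that may
  be zero or infinite.\<close>

lemma translation_invariant_proportional_lborel:
  fixes N :: "'a::euclidean_space measure"
  assumes [measurable_cong]: "sets N = sets borel" and "sigma_finite_measure N"
    and inv: "\<And>c. distr N borel ((+) c) = N"
    and [measurable]: "A \<in> sets borel" "B \<in> sets borel"
  shows "emeasure N A * emeasure lborel B = emeasure N B * emeasure lborel A"
proof -
  interpret N: sigma_finite_measure N by fact
  interpret pair_sigma_finite N "lborel :: 'a measure" ..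
  have trN: "(\<integral>\<^sup>+x. f (c + x) \<partial>N) = (\<integral>\<^sup>+x. f x \<partial>N)" if [measurable]: "f \<in> borel_measurable borel" for f :: "'a \<Rightarrow> ennreal" and c
    by (subst inv[of c, symmetric], subst nn_integral_distr) auto
  have trL: "(\<integral>\<^sup>+x. f (c + x) \<partial>lborel) = (\<integral>\<^sup>+x. f x \<partial>lborel)" if [measurable]: "f \<in> borel_measurable borel" for f :: "'a \<Rightarrow> ennreal" and c
    by (subst lborel_distr_plus[of c, symmetric], subst nn_integral_distr) auto
  have refl: "(\<integral>\<^sup>+y. f (x - y) \<partial>lborel) = (\<integral>\<^sup>+y. f y \<partial>lborel)" if [measurable]: "f \<in> borel_measurable borel" for f :: "'a \<Rightarrow> ennreal" and x
    by (subst lborel_affine[of "-1" x]) (auto simp: nn_integral_density nn_integral_distr)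
  have "emeasure N A * emeasure lborel B = (\<integral>\<^sup>+x. indicator A x * emeasure lborel B \<partial>N)"
    by (simp add: nn_integral_multc)
  also have "\<dots> = (\<integral>\<^sup>+x. indicator A x * (\<integral>\<^sup>+y. indicator B (x + y) \<partial>lborel) \<partial>N)"
    by (subst trL) auto
  also have "\<dots> = (\<integral>\<^sup>+x. (\<integral>\<^sup>+y. indicator A x * indicator B (x + y) \<partial>lborel) \<partial>N)"
    by (intro nn_integral_cong nn_integral_cmult[symmetric]) measurable
  also have "\<dots> = (\<integral>\<^sup>+y. (\<integral>\<^sup>+x. indicator A x * indicator B (x + y) \<partial>N) \<partial>lborel)"
    by (rule Fubini'[symmetric]) measurable
  also have "\<dots> = (\<integral>\<^sup>+y. (\<integral>\<^sup>+x. indicator A (x - y) * indicator B x \<partial>N) \<partial>lborel)"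
  proof (rule nn_integral_cong)
    fix y
    show "(\<integral>\<^sup>+x. indicator A x * indicator B (x + y) \<partial>N) = (\<integral>\<^sup>+x. indicator A (x - y) * indicator B x \<partial>N)"
      using trN[of "\<lambda>x. indicator A (x - y) * indicator B x" y] by (simp add: add.commute)
  qed
  also have "\<dots> = (\<integral>\<^sup>+x. (\<integral>\<^sup>+y. indicator A (x - y) * indicator B x \<partial>lborel) \<partial>N)"
    by (rule Fubini') measurable
  also have "\<dots> = (\<integral>\<^sup>+x. (\<integral>\<^sup>+y. indicator A (x - y) \<partial>lborel) * indicator B x \<partial>N)"
    by (intro nn_integral_cong nn_integral_multc) measurable
  also have "\<dots> = (\<integral>\<^sup>+x. emeasure lborel A * indicator B x \<partial>N)"
    by (subst refl) auto
  also have "\<dots> = emeasure N B * emeasure lborel A"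
    by (subst nn_integral_cmult_indicator) (auto simp: mult.commute)
  finally show ?thesis .
qed

text \<open>On the whole space the Hausdorff measure of dimension d - 1 is not sigma-finite, so
  Fubini is out of reach; concentrated on the hyperplane it is. A density, in place of a restricted
  space, keeps all Borel functions of the ambient space measurable.\<close>

definition hyperplane_measure :: "'a::euclidean_space \<Rightarrow> 'a measure" where
  "hyperplane_measure e = density (hausdorff_measure (DIM('a) - 1)) (indicator (half_space_bd e))"

lemma closed_half_space_bd: "closed (half_space_bd e)"
  using closed_hyperplane[of e 0] by (simp add: half_space_bd_def inner_commute)

lemma closed_half_space: "closed (half_space e)"
  using closed_halfspace_ge[of 0 e] by (simp add: half_space_def inner_commute)

lemma convex_half_space: "convex (half_space e)"
  using convex_halfspace_ge[of 0 e] by (simp add: half_space_def inner_commute)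

lemma half_space_sets [measurable, simp]: "half_space_bd e \<in> sets borel" "half_space e \<in> sets borel"
  by (simp_all add: closed_half_space_bd closed_half_space borel_closed)

lemma sets_hyperplane_measure [simp, measurable_cong]: "sets (hyperplane_measure e) = sets borel"
  and space_hyperplane_measure [simp]: "space (hyperplane_measure e) = UNIV"
  by (simp_all add: hyperplane_measure_def)

lemma emeasure_hyperplane_measure:
  fixes e :: "'a::euclidean_space"
  assumes [measurable]: "A \<in> sets borel"
  shows "emeasure (hyperplane_measure e) A = hausdorff_outer (DIM('a) - 1) (half_space_bd e \<inter> A)"
proof -
  have "emeasure (hyperplane_measure e) A = (\<integral>\<^sup>+x. indicator (half_space_bd e) x * indicator A x \<partial>hausdorff_measure (DIM('a) - 1))"
    unfolding hyperplane_measure_def by (subst emeasure_density) auto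
  also have "\<dots> = (\<integral>\<^sup>+x. indicator (half_space_bd e \<inter> A) x \<partial>hausdorff_measure (DIM('a) - 1))"
    by (intro nn_integral_cong) (auto split: split_indicator)
  also have "\<dots> = emeasure (hausdorff_measure (DIM('a) - 1)) (half_space_bd e \<inter> A)"
    by (rule nn_integral_indicator) simp
  also have "\<dots> = hausdorff_outer (DIM('a) - 1) (half_space_bd e \<inter> A)"
    by (rule emeasure_hausdorff_measure) simp
  finally show ?thesis .
qed

lemma AE_hyperplane_measure: "AE x in hyperplane_measure e. x \<in> half_space_bd e"
  unfolding hyperplane_measure_def by (subst AE_density) (auto split: split_indicator)

lemma integral_hyperplane_measure:
  fixes f :: "'a::euclidean_space \<Rightarrow> real"
  assumes "\<And>x. x \<in> half_space_bd e \<Longrightarrow> f x = g x" "f \<in> borel_measurable borel"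
  shows "(LINT x|hyperplane_measure e. f x) = (LINT x:half_space_bd e|hausdorff_measure (DIM('a) - 1). g x)"
proof -
  have "(LINT x|hyperplane_measure e. f x) = (LINT x|hausdorff_measure (DIM('a) - 1). indicator (half_space_bd e) x *\<^sub>R f x)"
    unfolding hyperplane_measure_def ennreal_indicator[symmetric]
    using assms(2) by (intro integral_density) auto
  also have "\<dots> = (LINT x:half_space_bd e|hausdorff_measure (DIM('a) - 1). g x)"
    unfolding set_lebesgue_integral_def using assms(1)
    by (intro Bochner_Integration.integral_cong) (auto split: split_indicator)
  finally show ?thesis .
qed

lemma emeasure_hyperplane_measure_finite:
  fixes e :: "'a::euclidean_space"
  assumes e: "e \<in> Basis" and "bounded A" "A \<in> sets borel"
  shows "emeasure (hyperplane_measure e) A < \<infinity>"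
proof -
  obtain R where R: "\<And>x. x \<in> A \<Longrightarrow> norm x \<le> R"
    using assms(2) by (auto simp: bounded_iff)
  obtain n where n: "R < real n" "0 < n"
    using reals_Archimedean2[of "max 0 R"] by (metis max_less_iff_conj of_nat_0_less_iff)
  have "A \<subseteq> cbox (- real n *\<^sub>R One) (real n *\<^sub>R One)"
  proof
    fix x assume "x \<in> A"
    then have "\<bar>x \<bullet> b\<bar> \<le> real n" if "b \<in> Basis" for b
      using Basis_le_norm[OF that, of x] R n by fastforce
    then show "x \<in> cbox (- real n *\<^sub>R One) (real n *\<^sub>R One)"
      by (auto simp: mem_box abs_le_iff)
        (metis minus_le_iff)
  qed
  then have "hausdorff_outer (DIM('a) - 1) (half_space_bd e \<inter> A) \<le>
      hausdorff_outer (DIM('a) - 1) (half_space_bd e \<inter> cbox (- real n *\<^sub>R One) (real n *\<^sub>R One))"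
    by (intro hausdorff_outer_mono) auto
  also have "\<dots> < \<infinity>"
    by (rule hausdorff_outer_hyperplane_box_finite[OF e n(2)])
  finally show ?thesis
    using assms(3) by (simp add: emeasure_hyperplane_measure)
qed

lemma sigma_finite_measureI_bounded:
  fixes N :: "'a::euclidean_space measure"
  assumes "sets N = sets borel" "\<And>A. bounded A \<Longrightarrow> A \<in> sets borel \<Longrightarrow> emeasure N A < \<infinity>"
  shows "sigma_finite_measure N"
proof
  have sp: "space N = UNIV" using sets_eq_imp_space_eq[OF assms(1)] by simp
  have "(\<Union>n. cball 0 (real n)) = (UNIV :: 'a set)"
    using real_arch_simple by auto
  then show "\<exists>A. countable A \<and> A \<subseteq> sets N \<and> \<Union> A = space N \<and> (\<forall>a\<in>A. emeasure N a \<noteq> \<infinity>)"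
    using assms sp by (intro exI[of _ "range (\<lambda>n. cball 0 (real n))"]) (auto simp: less_top[symmetric])
qed

lemma sigma_finite_hyperplane_measure:
  "e \<in> Basis \<Longrightarrow> sigma_finite_measure (hyperplane_measure e)"
  by (intro sigma_finite_measureI_bounded emeasure_hyperplane_measure_finite) auto

lemma distr_hyperplane_measure_translation:
  fixes e :: "'a::euclidean_space"
  assumes c: "c \<in> half_space_bd e"
  shows "distr (hyperplane_measure e) borel ((+) c) = hyperplane_measure e"
proof (rule measure_eqI)
  fix A assume "A \<in> sets (distr (hyperplane_measure e) borel ((+) c))"
  then have [measurable]: "A \<in> sets borel" by simp
  have m: "(+) c -` A \<in> sets borel"
    using measurable_sets[of "(+) c" borel borel A] by simp
  have "emeasure (distr (hyperplane_measure e) borel ((+) c)) A = hausdorff_outer (DIM('a) - 1) (half_space_bd e \<inter> (+) c -` A)"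
    using m by (subst emeasure_distr) (auto simp: emeasure_hyperplane_measure)
  also have "\<dots> = hausdorff_outer (DIM('a) - 1) ((+) c ` (half_space_bd e \<inter> (+) c -` A))"
    by (rule hausdorff_outer_translation[symmetric])
  also have "(+) c ` (half_space_bd e \<inter> (+) c -` A) = half_space_bd e \<inter> A"
  proof (intro equalityI subsetI)
    fix x assume "x \<in> half_space_bd e \<inter> A"
    then show "x \<in> (+) c ` (half_space_bd e \<inter> (+) c -` A)"
      using c by (intro image_eqI[of _ _ "x - c"]) (auto simp: half_space_bd_def inner_diff_left)
  qed (use c in \<open>auto simp: half_space_bd_def inner_add_left\<close>)
  also have "hausdorff_outer (DIM('a) - 1) (half_space_bd e \<inter> A) = emeasure (hyperplane_measure e) A"
    by (simp add: emeasure_hyperplane_measure)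
  finally show "emeasure (distr (hyperplane_measure e) borel ((+) c)) A = emeasure (hyperplane_measure e) A" .
qed simp

text \<open>The isodiametric inequality would give c = 1; the exact constant is irrelevant below.\<close>

proposition hyperplane_measure_product:
  fixes e :: "'a::euclidean_space"
  assumes e: "e \<in> Basis"
  obtains c :: real where "0 < c"
    "distr (hyperplane_measure e \<Otimes>\<^sub>M lborel) borel (\<lambda>(z, t). z + t *\<^sub>R e) = density lborel (\<lambda>_. ennreal c)"
proof -
  let ?\<mu> = "hyperplane_measure e"
  define N where "N = distr (?\<mu> \<Otimes>\<^sub>M lborel) borel (\<lambda>(z, t). z + t *\<^sub>R e)"
  interpret \<mu>: sigma_finite_measure ?\<mu> by (rule sigma_finite_hyperplane_measure[OF e])
  interpret pair_sigma_finite ?\<mu> "lborel :: real measure" ..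
  have sN [simp, measurable_cong]: "sets N = sets borel" by (simp add: N_def)
  have nnN: "(\<integral>\<^sup>+x. f x \<partial>N) = (\<integral>\<^sup>+z. (\<integral>\<^sup>+t. f (z + t *\<^sub>R e) \<partial>lborel) \<partial>?\<mu>)"
    if [measurable]: "f \<in> borel_measurable borel" for f :: "'a \<Rightarrow> ennreal"
    unfolding N_def by (subst nn_integral_distr) (auto simp: lborel.nn_integral_fst[symmetric])
  have ee: "e \<bullet> e = 1" using e by (simp add: inner_Basis)
  have box: "emeasure N A = (\<integral>\<^sup>+z. (\<integral>\<^sup>+t. indicator A (z + t *\<^sub>R e) \<partial>lborel) \<partial>?\<mu>)" if "A \<in> sets borel" for A
    using nnN[of "indicator A"] that by simp
  have "sigma_finite_measure N"
  \<comment> \<open>If z lies in the hyperplane and z + t e in a set of radius R, then t is a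
    coordinate of that point and at most R in modulus, and z has norm at most 2 R.\<close>
  proof (rule sigma_finite_measureI_bounded[OF sN])
    fix A :: "'a set" assume A: "bounded A" "A \<in> sets borel"
    then obtain R where R: "\<And>x. x \<in> A \<Longrightarrow> norm x \<le> R" "0 < R"
      using bounded_pos by blast
    have "emeasure N A \<le> (\<integral>\<^sup>+z. (\<integral>\<^sup>+t. indicator (cball 0 (2 * R)) z * indicator {-R..R} t \<partial>lborel) \<partial>?\<mu>)"
      unfolding box[OF A(2)]
    proof (rule nn_integral_mono_AE)
      show "AE z in ?\<mu>. (\<integral>\<^sup>+t. indicator A (z + t *\<^sub>R e) \<partial>lborel) \<le>
          (\<integral>\<^sup>+t. indicator (cball 0 (2 * R)) z * indicator {-R..R} t \<partial>lborel)"
        using AE_hyperplane_measure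
      proof eventually_elim
        case (elim z)
        show ?case
        proof (intro nn_integral_mono)
          fix t :: real
          have "\<bar>t\<bar> \<le> R \<and> norm z \<le> 2 * R" if "z + t *\<^sub>R e \<in> A"
          proof -
            have "\<bar>(z + t *\<^sub>R e) \<bullet> e\<bar> \<le> norm (z + t *\<^sub>R e)" by (rule Basis_le_norm[OF e])
            then have t: "\<bar>t\<bar> \<le> R"
              using elim R(1)[OF that] ee by (simp add: half_space_bd_def inner_add_left)
            have "norm z \<le> norm (z + t *\<^sub>R e) + norm (t *\<^sub>R e)"
              using norm_triangle_ineq4[of "z + t *\<^sub>R e" "t *\<^sub>R e"] by simp
            then show ?thesis using t R(1)[OF that] e by simp
          qed
          then show "indicator A (z + t *\<^sub>R e) \<le> (indicator (cball 0 (2 * R)) z * indicator {-R..R} t :: ennreal)"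
            by (auto split: split_indicator)
        qed
      qed
    qed
    also have "\<dots> = (\<integral>\<^sup>+z. ennreal (2 * R) * indicator (cball 0 (2 * R)) z \<partial>?\<mu>)"
    proof (rule nn_integral_cong)
      fix z :: 'a
      have "(\<integral>\<^sup>+t. indicator (cball 0 (2 * R)) z * indicator {-R..R} t \<partial>lborel) =
          indicator (cball 0 (2 * R)) z * emeasure lborel {-R..R}"
        by (rule nn_integral_cmult_indicator) simp
      then show "(\<integral>\<^sup>+t. indicator (cball 0 (2 * R)) z * indicator {-R..R} t \<partial>lborel) =
          ennreal (2 * R) * indicator (cball 0 (2 * R)) z"
        using R(2) by (simp add: mult.commute)
    qed
    also have "\<dots> = ennreal (2 * R) * emeasure ?\<mu> (cball 0 (2 * R))"
      by (rule nn_integral_cmult_indicator) simp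
    also have "\<dots> < \<infinity>"
      using emeasure_hyperplane_measure_finite[OF e, of "cball 0 (2 * R)"]
      by (simp add: ennreal_mult_less_top)
    finally show "emeasure N A < \<infinity>" .
  qed
  moreover have "distr N borel ((+) c) = N" for c
  proof (rule measure_eqI)
    fix A assume "A \<in> sets (distr N borel ((+) c))"
    then have [measurable]: "A \<in> sets borel" by simp
    \<comment> \<open>A translation splits into a component within the hyperplane, under which the
      Hausdorff measure is invariant, and one along \<open>e\<close>, under which Lebesgue measure
      on the line is.\<close>
    define c0 where "c0 = c - (c \<bullet> e) *\<^sub>R e"
    have c0: "c0 \<in> half_space_bd e" by (simp add: c0_def half_space_bd_def inner_diff_left ee)
    define g where "g z = (\<integral>\<^sup>+t. indicator A (z + t *\<^sub>R e) \<partial>lborel)" for z :: 'a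
    have [measurable]: "g \<in> borel_measurable borel" unfolding g_def by measurable
    have "emeasure (distr N borel ((+) c)) A = (\<integral>\<^sup>+x. indicator A (c + x) \<partial>N)"
      using nn_integral_distr[of "(+) c" N borel "indicator A"] by simp
    also have "\<dots> = (\<integral>\<^sup>+z. (\<integral>\<^sup>+t. indicator A (c + (z + t *\<^sub>R e)) \<partial>lborel) \<partial>?\<mu>)"
      by (rule nnN) measurable
    also have "\<dots> = (\<integral>\<^sup>+z. g (c0 + z) \<partial>?\<mu>)"
    proof (intro nn_integral_cong)
      fix z
      have "g (c0 + z) = (\<integral>\<^sup>+t. indicator A (c0 + z + t *\<^sub>R e) \<partial>distr lborel borel ((+) (c \<bullet> e)))"
        by (simp add: g_def lborel_distr_plus)
      also have "\<dots> = (\<integral>\<^sup>+t. indicator A (c0 + z + (c \<bullet> e + t) *\<^sub>R e) \<partial>lborel)"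
        by (rule nn_integral_distr) measurable
      also have "\<dots> = (\<integral>\<^sup>+t. indicator A (c + (z + t *\<^sub>R e)) \<partial>lborel)"
        by (simp add: c0_def algebra_simps)
      finally show "(\<integral>\<^sup>+t. indicator A (c + (z + t *\<^sub>R e)) \<partial>lborel) = g (c0 + z)" by simp
    qed
    also have "\<dots> = (\<integral>\<^sup>+z. g z \<partial>distr ?\<mu> borel ((+) c0))"
      by (rule nn_integral_distr[symmetric]) measurable
    also have "\<dots> = emeasure N A"
      unfolding distr_hyperplane_measure_translation[OF c0] by (simp add: box g_def)
    finally show "emeasure (distr N borel ((+) c)) A = emeasure N A" .
  qed simp
  ultimately have proportional: "emeasure N A * emeasure lborel B = emeasure N B * emeasure lborel A"
    if "A \<in> sets borel" "B \<in> sets borel" for A B :: "'a set"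
    using that by (intro translation_invariant_proportional_lborel) auto
  let ?Q = "cbox 0 (One :: 'a)"
  have NQ: "emeasure N ?Q = emeasure ?\<mu> ?Q"
  proof -
    have "emeasure N ?Q = (\<integral>\<^sup>+z. (\<integral>\<^sup>+t. indicator ?Q z * indicator {0..1::real} t \<partial>lborel) \<partial>?\<mu>)"
      unfolding box[OF borel_closed[OF closed_cbox]]
    proof (rule nn_integral_cong_AE)
      show "AE z in ?\<mu>. (\<integral>\<^sup>+t. indicator ?Q (z + t *\<^sub>R e) \<partial>lborel) = (\<integral>\<^sup>+t. indicator ?Q z * indicator {0..1::real} t \<partial>lborel)"
        using AE_hyperplane_measure
      proof eventually_elim
        case (elim z)
        then have z: "z \<bullet> e = 0" by (simp add: half_space_bd_def)
        have mem: "z + t *\<^sub>R e \<in> ?Q \<longleftrightarrow> z \<in> ?Q \<and> t \<in> {0..1}" for t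
        proof -
          have b: "(z + t *\<^sub>R e) \<bullet> b = (if b = e then t else z \<bullet> b)" if "b \<in> Basis" for b
            using that e z by (auto simp: inner_add_left inner_Basis)
          show ?thesis
          proof
            assume *: "z + t *\<^sub>R e \<in> ?Q"
            have "0 \<le> z \<bullet> b \<and> z \<bullet> b \<le> 1" if "b \<in> Basis" for b
              using * that b[OF that] z by (cases "b = e") (auto simp: mem_box)
            moreover have "0 \<le> (z + t *\<^sub>R e) \<bullet> e \<and> (z + t *\<^sub>R e) \<bullet> e \<le> 1"
              using * e by (auto simp: mem_box)
            then have "t \<in> {0..1}"
              unfolding b[OF e] by simp
            ultimately show "z \<in> ?Q \<and> t \<in> {0..1}"
              by (auto simp: mem_box)
          next
            assume *: "z \<in> ?Q \<and> t \<in> {0..1}"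
            have "0 \<le> (z + t *\<^sub>R e) \<bullet> b \<and> (z + t *\<^sub>R e) \<bullet> b \<le> 1" if "b \<in> Basis" for b
              using * that unfolding b[OF that] by (auto simp: mem_box)
            then show "z + t *\<^sub>R e \<in> ?Q"
              by (auto simp: mem_box)
          qed
        qed
        show ?case by (simp only: indicator_def mem) (auto intro!: nn_integral_cong)
      qed
    qed
    also have "\<dots> = (\<integral>\<^sup>+z. indicator ?Q z \<partial>?\<mu>)"
      by (intro nn_integral_cong) (simp add: nn_integral_cmult)
    finally show ?thesis by simp
  qed
  have fin: "emeasure ?\<mu> ?Q < \<infinity>"
    using emeasure_hyperplane_measure_finite[OF e, of ?Q] by simp
  have pos: "0 < emeasure ?\<mu> ?Q"
    using hausdorff_outer_hyperplane_cube_pos[OF e] by (simp add: emeasure_hyperplane_measure)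
  \<comment> \<open>The unit cube is its face times [0, 1] and has Lebesgue measure 1, so the
    surface measure of the face is the factor of proportionality. The covering estimates make it
    finite and positive.\<close>
  define c where "c = enn2real (emeasure ?\<mu> ?Q)"
  have c: "ennreal c = emeasure ?\<mu> ?Q" using fin by (simp add: c_def)
  have "0 < c" using pos fin by (simp add: c_def enn2real_positive_iff)
  moreover have "N = density lborel (\<lambda>_. ennreal c)"
  proof (rule measure_eqI)
    fix A assume "A \<in> sets N"
    then have A: "A \<in> sets borel" by simp
    show "emeasure N A = emeasure (density lborel (\<lambda>_. ennreal c)) A"
      using proportional[OF A, of ?Q] A NQ
      by (simp add: emeasure_density nn_integral_cmult emeasure_lborel_cbox_eq c)
  qed simp
  ultimately show ?thesis
    using that unfolding N_def by blast
qed

section \<open>Dilations and normal derivatives on the half space\<close>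

lemma has_vector_derivative_along_line:
  fixes F :: "'a::euclidean_space \<Rightarrow> real"
  assumes "(F has_derivative (\<lambda>w. g \<bullet> w)) (at (z + t *\<^sub>R v) within H)" "(\<lambda>s. z + s *\<^sub>R v) ` S \<subseteq> H"
  shows "((\<lambda>s. F (z + s *\<^sub>R v)) has_vector_derivative (g \<bullet> v)) (at t within S)"
proof -
  have "((\<lambda>s. z + s *\<^sub>R v) has_derivative (\<lambda>s. s *\<^sub>R v)) (at t within S)"
    by (auto intro!: derivative_eq_intros)
  from has_derivative_in_compose[OF this has_derivative_subset[OF assms]]
  show ?thesis
    by (simp add: has_vector_derivative_def)
qed

lemma lborel_integral_scaleR:
  fixes f :: "'a::euclidean_space \<Rightarrow> real"
  assumes [measurable]: "f \<in> borel_measurable borel" and s: "0 < s"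
  shows "(LINT x|lborel. f (s *\<^sub>R x)) = (LINT x|lborel. f x) / s ^ DIM('a)"
proof -
  have "(LINT x|lborel. f x) = (LINT x|density (distr lborel borel (\<lambda>x. 0 + s *\<^sub>R x)) (\<lambda>_. ennreal (\<bar>s\<bar> ^ DIM('a))). f x)"
    using lborel_affine[of s "0 :: 'a"] s by simp
  also have "\<dots> = (LINT x|distr lborel borel (\<lambda>x. 0 + s *\<^sub>R x). \<bar>s\<bar> ^ DIM('a) *\<^sub>R f x)"
    by (rule integral_density) auto
  also have "\<dots> = (LINT x|lborel. \<bar>s\<bar> ^ DIM('a) *\<^sub>R f (0 + s *\<^sub>R x))"
    by (rule integral_distr) auto
  also have "\<dots> = s ^ DIM('a) * (LINT x|lborel. f (s *\<^sub>R x))"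
    using s by simp
  finally show ?thesis using s by simp
qed

lemma set_integrable_compact_support:
  fixes f :: "'a::euclidean_space \<Rightarrow> 'b::euclidean_space"
  assumes "closed H" "continuous_on H f" "\<And>x. x \<in> H \<Longrightarrow> R \<le> norm x \<Longrightarrow> f x = 0"
  shows "set_integrable lborel H f"
proof -
  have "set_integrable lborel (H \<inter> cball 0 R) f"
    using assms(1,2) by (intro set_integrable_continuous_compact closed_Int_compact)
      (auto intro: continuous_on_subset)
  moreover have "(\<lambda>x. indicator H x *\<^sub>R f x) = (\<lambda>x. indicator (H \<inter> cball 0 R) x *\<^sub>R f x)"
    using assms(3) by (auto simp: fun_eq_iff split: split_indicator)
  ultimately show ?thesis by (simp add: set_integrable_def)
qed

text \<open>The divergence theorem for a field parallel to \<open>e\<close>: on each ray z + t e the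
  fundamental theorem of calculus leaves - F z, and Fubini over the boundary collects these values.
  The factor \<open>c\<close> converts Lebesgue measure into surface measure times length.\<close>

proposition half_space_normal_derivative_integral:
  fixes F :: "'a::euclidean_space \<Rightarrow> real" and G :: "'a \<Rightarrow> 'a"
  assumes e: "e \<in> Basis" and c: "0 < c"
    "distr (hyperplane_measure e \<Otimes>\<^sub>M lborel) borel (\<lambda>(z, t). z + t *\<^sub>R e) = density lborel (\<lambda>_. ennreal c)"
    and F: "\<And>x. x \<in> half_space e \<Longrightarrow> (F has_derivative (\<lambda>v. G x \<bullet> v)) (at x within half_space e)"
    and G: "continuous_on (half_space e) G"
    and F0: "\<And>x. x \<in> half_space e \<Longrightarrow> R \<le> norm x \<Longrightarrow> F x = 0"
    and G0: "\<And>x. x \<in> half_space e \<Longrightarrow> R \<le> norm x \<Longrightarrow> G x = 0"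
  shows "c * (LINT x:half_space e|lborel. G x \<bullet> e) = - (LINT z:half_space_bd e|hausdorff_measure (DIM('a) - 1). F z)"
proof -
  let ?H = "half_space e" and ?\<mu> = "hyperplane_measure e"
  interpret \<mu>: sigma_finite_measure ?\<mu> by (rule sigma_finite_hyperplane_measure[OF e])
  interpret pair_sigma_finite ?\<mu> "lborel :: real measure" ..
  have ee: "e \<bullet> e = 1" using e by (simp add: inner_Basis)
  define f where "f x = indicator ?H x *\<^sub>R (G x \<bullet> e)" for x
  have cF: "continuous_on ?H F"
    using F by (intro has_derivative_continuous_on)
  have fm [measurable]: "f \<in> borel_measurable borel"
    unfolding f_def by (intro borel_measurable_continuous_on_indicator half_space_sets continuous_intros G)
  have Fm [measurable]: "(\<lambda>x. indicator ?H x *\<^sub>R F x) \<in> borel_measurable borel"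
    by (intro borel_measurable_continuous_on_indicator half_space_sets cF)
  have "set_integrable lborel ?H (\<lambda>x. G x \<bullet> e)"
    using G0 by (intro set_integrable_compact_support[where R = R] closed_half_space continuous_intros G) auto
  then have fi: "integrable lborel f"
    by (simp add: f_def[abs_def] set_integrable_def)
  have "integrable (density lborel (\<lambda>_. ennreal c)) f"
    using fi c(1) by (subst integrable_density) auto
  then have fp: "integrable (?\<mu> \<Otimes>\<^sub>M lborel) (\<lambda>(z, t). f (z + t *\<^sub>R e))"
    unfolding c(2)[symmetric] by (subst (asm) integrable_distr_eq) (auto simp: case_prod_unfold)
  have "c * (LINT x|lborel. f x) = (LINT x|density lborel (\<lambda>_. ennreal c). f x)"
    using c(1) by (subst integral_density) auto
  also have "\<dots> = (LINT (z, t)|(?\<mu> \<Otimes>\<^sub>M lborel). f (z + t *\<^sub>R e))"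
    unfolding c(2)[symmetric] by (subst integral_distr) (auto simp: case_prod_unfold)
  also have "\<dots> = (LINT z|?\<mu>. (LINT t|lborel. f (z + t *\<^sub>R e)))"
    using integral_fst'[OF fp] by simp
  \<comment> \<open>\<open>F\<close> is controlled only on the half space; the indicator makes the
    integrand Borel everywhere and equals 1 on the hyperplane, which carries the measure.\<close>
  also have "\<dots> = (LINT z|?\<mu>. - (indicator ?H z *\<^sub>R F z))"
  proof (rule integral_cong_AE)
    show "AE z in ?\<mu>. (LINT t|lborel. f (z + t *\<^sub>R e)) = - (indicator ?H z *\<^sub>R F z)"
      using AE_hyperplane_measure
    proof eventually_elim
      case (elim z)
      then have z: "z \<bullet> e = 0" by (simp add: half_space_bd_def)
      have H: "z + t *\<^sub>R e \<in> ?H \<longleftrightarrow> 0 \<le> t" for t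
        by (simp add: half_space_def inner_add_left z ee)
      \<comment> \<open>On the ray the norm of z + t e is at least its coordinate t, so
        \<open>F\<close> and \<open>G\<close> vanish from \<open>T\<close> onwards.\<close>
      define T where "T = max 0 R"
      have big: "R \<le> norm (z + t *\<^sub>R e)" if "T \<le> t" for t
      proof -
        have "t = (z + t *\<^sub>R e) \<bullet> e" by (simp add: inner_add_left z ee)
        also have "\<dots> \<le> norm (z + t *\<^sub>R e)" using Basis_le_norm[OF e, of "z + t *\<^sub>R e"] by linarith
        finally show ?thesis using that by (simp add: T_def)
      qed
      have "(LINT t|lborel. f (z + t *\<^sub>R e)) = (LINT t|lborel. indicator {0..T} t *\<^sub>R (G (z + t *\<^sub>R e) \<bullet> e))"
      proof (rule Bochner_Integration.integral_cong)
        fix t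
        show "f (z + t *\<^sub>R e) = indicator {0..T} t *\<^sub>R (G (z + t *\<^sub>R e) \<bullet> e)"
          using H[of t] G0[of "z + t *\<^sub>R e"] big[of t] by (auto simp: f_def split: split_indicator)
      qed simp
      also have "\<dots> = F (z + T *\<^sub>R e) - F (z + 0 *\<^sub>R e)"
      proof (rule integral_FTC_Icc)
        show "0 \<le> T" by (simp add: T_def)
        fix t assume t: "0 \<le> t" "t \<le> T"
        show "((\<lambda>t. F (z + t *\<^sub>R e)) has_vector_derivative G (z + t *\<^sub>R e) \<bullet> e) (at t within {0..T})"
        proof (rule has_vector_derivative_along_line[OF F])
          show "z + t *\<^sub>R e \<in> ?H" unfolding H by (rule t)
          show "(\<lambda>s. z + s *\<^sub>R e) ` {0..T} \<subseteq> ?H"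
            by (rule image_subsetI) (simp add: H)
        qed
      next
        show "continuous_on {0..T} (\<lambda>t. G (z + t *\<^sub>R e) \<bullet> e)"
          by (intro continuous_intros continuous_on_compose2[OF G]) (simp add: H image_subset_iff)
      qed
      also have "F (z + T *\<^sub>R e) = 0"
        by (rule F0[OF _ big]) (simp_all add: H T_def)
      finally show ?case using H[of 0] by simp
    qed
    have "(\<lambda>(z, t). f (z + t *\<^sub>R e)) \<in> borel_measurable (?\<mu> \<Otimes>\<^sub>M lborel)"
      by measurable
    then show "(\<lambda>z. LINT t|lborel. f (z + t *\<^sub>R e)) \<in> borel_measurable ?\<mu>"
      by (rule lborel.borel_measurable_lebesgue_integral)
  qed measurable
  also have "\<dots> = - (LINT z|?\<mu>. indicator ?H z *\<^sub>R F z)"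
    by simp
  also have "(LINT z|?\<mu>. indicator ?H z *\<^sub>R F z) = (LINT z:half_space_bd e|hausdorff_measure (DIM('a) - 1). F z)"
    by (rule integral_hyperplane_measure[OF _ Fm]) (auto simp: half_space_def half_space_bd_def)
  finally show ?thesis
    by (simp add: f_def set_lebesgue_integral_def)
qed

text \<open>Differentiate in s at 1 the scaling law by which the integral of F (s x) over
  \<open>H\<close> is \<open>s\<close> to the power \<open>- DIM('a)\<close> times that of F.
  Dilations map the cone \<open>H\<close> to itself, so no boundary term appears and no surface
  measure is involved.\<close>

proposition euler_dilation_identity:
  fixes F :: "'a::euclidean_space \<Rightarrow> real" and G :: "'a \<Rightarrow> 'a"
  assumes H: "closed H" "convex H" "\<And>x s. x \<in> H \<Longrightarrow> 0 < s \<Longrightarrow> s *\<^sub>R x \<in> H"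
    and F: "\<And>x. x \<in> H \<Longrightarrow> (F has_derivative (\<lambda>v. G x \<bullet> v)) (at x within H)"
    and G: "continuous_on H G"
    and F0: "\<And>x. x \<in> H \<Longrightarrow> R \<le> norm x \<Longrightarrow> F x = 0"
    and G0: "\<And>x. x \<in> H \<Longrightarrow> R \<le> norm x \<Longrightarrow> G x = 0"
  shows "(LINT x:H|lborel. G x \<bullet> x) = - real DIM('a) * (LINT x:H|lborel. F x)"
proof -
  have cF: "continuous_on H F"
    using F by (intro has_derivative_continuous_on)
  have Hs: "H \<in> sets borel" using H(1) by (rule borel_closed)
  define f where "f x = indicator H x *\<^sub>R F x" for x
  define g where "g x = indicator H x *\<^sub>R (G x \<bullet> x)" for x
  have [measurable]: "f \<in> borel_measurable borel" "g \<in> borel_measurable borel"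
    unfolding f_def g_def by (intro borel_measurable_continuous_on_indicator Hs cF continuous_intros G)+
  have fi: "integrable lborel f"
    using set_integrable_compact_support[OF H(1) cF F0] by (simp add: f_def[abs_def] set_integrable_def)
  have "\<exists>C. \<forall>x\<in>H. norm (G x) \<le> C"
  proof -
    have "compact (G ` (H \<inter> cball 0 R))"
      using H(1) G by (intro compact_continuous_image closed_Int_compact) (auto intro: continuous_on_subset)
    then have "bounded (G ` (H \<inter> cball 0 R))" by (rule compact_imp_bounded)
    then obtain C where C: "\<And>x. x \<in> H \<inter> cball 0 R \<Longrightarrow> norm (G x) \<le> C"
      unfolding bounded_iff by blast
    have "norm (G x) \<le> max 0 C" if "x \<in> H" for x
      using C[of x] G0[of x] that by (cases "R \<le> norm x") (auto simp: le_max_iff_disj)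
    then show ?thesis by blast
  qed
  then obtain C where C: "\<And>x. x \<in> H \<Longrightarrow> norm (G x) \<le> C" by blast
  have HC: "0 \<le> C" if "x \<in> H" for x using C[OF that] norm_ge_zero order_trans by blast
  \<comment> \<open>Positive increments only: for a dilation factor above 1 the difference quotients
    vanish outside \<open>cball 0 R\<close> for all n, which yields the dominating function. Inside
    the ball convexity of \<open>H\<close> and the gradient bound \<open>C\<close> give
    \<open>C * R\<close>.\<close>
  define h where "h n = 1 / real (Suc n)" for n
  have h: "0 < h n" for n by (simp add: h_def)
  have h0: "h \<longlonglongrightarrow> 0" unfolding h_def by (rule LIMSEQ_inverse_real_of_nat[unfolded inverse_eq_divide])
  define q where "q n x = (f ((1 + h n) *\<^sub>R x) - f x) / h n" for n x
  have HH: "(1 + h n) *\<^sub>R x \<in> H \<longleftrightarrow> x \<in> H" for n x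
    using H(3)[of x "1 + h n"] H(3)[of "(1 + h n) *\<^sub>R x" "1 / (1 + h n)"] h[of n] by auto
  have qint: "(LINT x|lborel. q n x) = (inverse ((1 + h n) ^ DIM('a)) - inverse (1 ^ DIM('a))) / h n * (LINT x|lborel. f x)" for n
  proof -
    have fi': "integrable lborel (\<lambda>x. f ((1 + h n) *\<^sub>R x))"
    proof -
      have "integrable (density (distr lborel borel (\<lambda>x. 0 + (1 + h n) *\<^sub>R x)) (\<lambda>_. ennreal (\<bar>1 + h n\<bar> ^ DIM('a)))) f"
        using fi lborel_affine[of "1 + h n" "0 :: 'a"] h[of n] by simp
      then have "integrable lborel (\<lambda>x. \<bar>1 + h n\<bar> ^ DIM('a) *\<^sub>R f ((1 + h n) *\<^sub>R x))"
        by (subst (asm) integrable_density, simp, simp, simp, subst (asm) integrable_distr_eq) auto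
      then show ?thesis using h[of n] by simp
    qed
    have "(LINT x|lborel. q n x) = ((LINT x|lborel. f ((1 + h n) *\<^sub>R x)) - (LINT x|lborel. f x)) / h n"
      unfolding q_def using fi fi' by simp
    also have "(LINT x|lborel. f ((1 + h n) *\<^sub>R x)) = (LINT x|lborel. f x) / (1 + h n) ^ DIM('a)"
      using h[of n] by (intro lborel_integral_scaleR) auto
    finally show ?thesis
      by (simp add: field_simps)
  qed
  have "(\<lambda>n. LINT x|lborel. q n x) \<longlonglongrightarrow> (LINT x|lborel. g x)"
  proof (rule integral_dominated_convergence[where w = "\<lambda>x. indicator (H \<inter> cball 0 R) x *\<^sub>R (C * R)"])
    show "integrable lborel (\<lambda>x. indicator (H \<inter> cball 0 R) x *\<^sub>R (C * R))"
      using set_integrable_continuous_compact[OF closed_Int_compact[OF H(1) compact_cball], of _ _ "\<lambda>_. C * R"]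
      by (simp add: set_integrable_def)
    show "AE x in lborel. (\<lambda>n. q n x) \<longlonglongrightarrow> g x"
    proof (rule AE_I2)
      fix x
      show "(\<lambda>n. q n x) \<longlonglongrightarrow> g x"
      proof (cases "x \<in> H")
        case True
        have "((\<lambda>s. F (0 + s *\<^sub>R x)) has_vector_derivative (G x \<bullet> x)) (at 1 within {0<..})"
          by (rule has_vector_derivative_along_line[where H = H]) (use F[OF True] H(3)[OF True] in auto)
        then have "((\<lambda>s. F (s *\<^sub>R x)) has_real_derivative (G x \<bullet> x)) (at 1)"
          by (simp add: has_real_derivative_iff_has_vector_derivative at_within_open[of 1 "{0<..}"])
        then have "((\<lambda>k. (F ((1 + k) *\<^sub>R x) - F (1 *\<^sub>R x)) / k) \<longlongrightarrow> G x \<bullet> x) (at 0)"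
          by (simp add: DERIV_def)
        moreover have "filterlim h (at 0) sequentially"
          using h0 h by (auto simp: filterlim_at intro!: always_eventually less_imp_neq[symmetric])
        ultimately have "(\<lambda>n. (F ((1 + h n) *\<^sub>R x) - F (1 *\<^sub>R x)) / h n) \<longlonglongrightarrow> G x \<bullet> x"
          by (rule filterlim_compose)
        then show ?thesis using True HH by (simp add: q_def g_def f_def)
      qed (simp add: q_def g_def f_def HH)
    qed
    fix n
    show "AE x in lborel. norm (q n x) \<le> indicator (H \<inter> cball 0 R) x *\<^sub>R (C * R)"
    proof (rule AE_I2)
      fix x
      show "norm (q n x) \<le> indicator (H \<inter> cball 0 R) x *\<^sub>R (C * R)"
      proof (cases "x \<in> H")
        case True
        show ?thesis
        proof (cases "norm x \<le> R")
          case le: True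
          have "norm (F ((1 + h n) *\<^sub>R x) - F x) \<le> C * norm ((1 + h n) *\<^sub>R x - x)"
          proof (rule differentiable_bound[OF H(2) F])
            fix y assume y: "y \<in> H"
            show "onorm (\<lambda>v. G y \<bullet> v) \<le> C"
            proof (rule onorm_le)
              fix v
              have "norm (G y \<bullet> v) \<le> norm (G y) * norm v" by (simp add: Cauchy_Schwarz_ineq2)
              also have "\<dots> \<le> C * norm v" by (intro mult_right_mono C y) simp
              finally show "norm (G y \<bullet> v) \<le> C * norm v" .
            qed
          qed (use True HH in auto)
          also have "(1 + h n) *\<^sub>R x - x = h n *\<^sub>R x" by (simp add: algebra_simps)
          also have "C * norm (h n *\<^sub>R x) \<le> C * R * h n"
          proof -
            have "C * (h n * norm x) \<le> C * (h n * R)"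
              using le h[of n] HC[OF True] by (intro mult_left_mono) auto
            then show ?thesis using h[of n] by (simp add: ac_simps)
          qed
          finally have "norm (q n x) \<le> C * R"
            using True HH h[of n] by (simp add: q_def f_def abs_divide divide_le_eq)
          then show ?thesis using True le by simp
        next
          case False
          have "norm x \<le> (1 + h n) * norm x" using h[of n] by (simp add: mult_le_cancel_right1)
          then have "R \<le> norm ((1 + h n) *\<^sub>R x)" using False h[of n] by simp
          then have "F ((1 + h n) *\<^sub>R x) = 0" "F x = 0"
            using F0 True HH False by (auto simp: not_le less_imp_le)
          then show ?thesis using False by (simp add: q_def f_def)
        qed
      qed (simp add: q_def f_def HH)
    qed
  qed (unfold q_def, measurable)
  moreover have "(\<lambda>n. LINT x|lborel. q n x) \<longlonglongrightarrow> - real DIM('a) * (LINT x|lborel. f x)"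
  proof -
    have "((\<lambda>s::real. inverse (s ^ DIM('a))) has_real_derivative - real DIM('a)) (at 1)"
      by (auto intro!: derivative_eq_intros)
    then have "((\<lambda>k. (inverse ((1 + k) ^ DIM('a)) - inverse (1 ^ DIM('a))) / k) \<longlongrightarrow> - real DIM('a)) (at (0::real))"
      by (simp only: DERIV_def)
    moreover have "filterlim h (at 0) sequentially"
      using h0 h by (auto simp: filterlim_at intro!: always_eventually less_imp_neq[symmetric])
    ultimately have "(\<lambda>n. (inverse ((1 + h n) ^ DIM('a)) - inverse (1 ^ DIM('a))) / h n) \<longlonglongrightarrow> - real DIM('a)"
      by (rule filterlim_compose)
    then show ?thesis unfolding qint by (intro tendsto_mult tendsto_const)
  qed
  ultimately have "(LINT x|lborel. g x) = - real DIM('a) * (LINT x|lborel. f x)"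
    by (rule LIMSEQ_unique)
  then show ?thesis by (simp add: f_def g_def set_lebesgue_integral_def)
qed

section \<open>The two-parameter trace inequality\<close>

text \<open>At 0 the difference quotient is \<open>max 0 y powr q\<close>, which tends to 0 because
  q > 0. Hence the power \<open>q + 1\<close> of a nonnegative function is differentiable also where
  that function reaches zero.\<close>

lemma max_powr_has_real_derivative:
  fixes q t :: real
  assumes q: "0 < q"
  shows "((\<lambda>t. max 0 t powr (q + 1)) has_real_derivative (q + 1) * max 0 t powr q) (at t within S)"
proof -
  consider "t < 0" | "t = 0" | "0 < t" by linarith
  then have "((\<lambda>t. max 0 t powr (q + 1)) has_real_derivative (q + 1) * max 0 t powr q) (at t)"
  proof cases
    case 1
    have "((\<lambda>t. 0) has_real_derivative (q + 1) * max 0 t powr q) (at t)"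
      using 1 by simp
    then show ?thesis
      by (rule has_field_derivative_transform_within_open[where S = "{..<0}"]) (use 1 in auto)
  next
    case 2
    have "((\<lambda>y. max 0 y powr q) \<longlongrightarrow> max 0 0 powr q) (at (0::real))"
      using q by (intro tendsto_powr' tendsto_max tendsto_intros) auto
    then have lim: "((\<lambda>y. max 0 y powr q) \<longlongrightarrow> 0) (at (0::real))" by simp
    have "max 0 y powr q = max 0 y powr (q + 1) / y" if "y \<noteq> 0" for y :: real
      using that by (cases "0 < y") (auto simp: powr_add)
    then have "((\<lambda>y. max 0 y powr (q + 1) / y) \<longlongrightarrow> 0) (at (0::real))"
      by (intro Lim_transform_eventually[OF lim]) (auto simp: eventually_at_filter)
    then show ?thesis using 2 by (simp add: has_field_derivative_iff)
  next
    case 3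
    have "((\<lambda>t. t powr (q + 1)) has_real_derivative (q + 1) * max 0 t powr q) (at t)"
      using 3 by (auto intro!: derivative_eq_intros)
    then show ?thesis
      by (rule has_field_derivative_transform_within_open[where S = "{0<..}"]) (use 3 in auto)
  qed
  then show ?thesis by (rule has_field_derivative_at_within)
qed

lemma powr_gradient:
  fixes u :: "'a::euclidean_space \<Rightarrow> real"
  assumes "0 < q" "(u has_derivative (\<lambda>v. g \<bullet> v)) (at x within H)" "x \<in> H" "\<And>x. x \<in> H \<Longrightarrow> 0 \<le> u x"
  shows "((\<lambda>x. u x powr (q + 1)) has_derivative (\<lambda>v. ((q + 1) * u x powr q) *\<^sub>R g \<bullet> v)) (at x within H)"
proof -
  have "((\<lambda>t. max 0 t powr (q + 1)) has_derivative (*) ((q + 1) * max 0 (u x) powr q)) (at (u x) within u ` H)"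
    using max_powr_has_real_derivative[OF assms(1)] by (simp add: has_field_derivative_def)
  from has_derivative_in_compose[OF assms(2) this]
  have "((\<lambda>x. max 0 (u x) powr (q + 1)) has_derivative (\<lambda>v. ((q + 1) * u x powr q) *\<^sub>R g \<bullet> v)) (at x within H)"
    using assms(4)[OF assms(3)] by simp
  then show ?thesis
    by (rule has_derivative_transform[rotated 2]) (use assms in auto)
qed

text \<open>One formula for three functions: the power \<open>q + 1\<close> of the profile, the
  extremal itself (whose exponent 1 / (1 - p) is one more than p / (1 - p)), and the cutoff, where q
  = 1.\<close>

lemma max_quadratic_gradient:
  fixes c :: "'a::euclidean_space"
  assumes q: "0 < q"
  shows "((\<lambda>x. max 0 (\<tau> - \<kappa> * (norm (x - c))\<^sup>2) powr (q + 1)) has_derivative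
    (\<lambda>v. (- 2 * \<kappa> * (q + 1) * max 0 (\<tau> - \<kappa> * (norm (x - c))\<^sup>2) powr q) *\<^sub>R (x - c) \<bullet> v)) (at x within H)"
proof -
  let ?f = "\<lambda>x. \<tau> - \<kappa> * (norm (x - c))\<^sup>2"
  have "((\<lambda>x. \<tau> - \<kappa> * ((x - c) \<bullet> (x - c))) has_derivative (\<lambda>v. - 2 * \<kappa> * ((x - c) \<bullet> v))) (at x within H)"
    by (auto intro!: derivative_eq_intros simp: inner_commute)
  then have d: "(?f has_derivative (\<lambda>v. - 2 * \<kappa> * ((x - c) \<bullet> v))) (at x within H)"
    by (simp add: power2_norm_eq_inner)
  have "((\<lambda>t. max 0 t powr (q + 1)) has_derivative (*) ((q + 1) * max 0 (?f x) powr q)) (at (?f x) within ?f ` H)"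
    using max_powr_has_real_derivative[OF q] by (simp add: has_field_derivative_def)
  from has_derivative_in_compose[OF d this]
  show ?thesis
    by (simp add: algebra_simps)
qed

text \<open>The parameters \<open>k\<close> and \<open>s\<close> come from comparing \<open>u\<close> with \<open>k * V (s x)\<close>, whose centre is \<open>- (h / s) e\<close>;
  this is how dilations of the boundary integral are avoided.\<close>

proposition compact_support_trace_inequality:
  fixes u :: "'a::euclidean_space \<Rightarrow> real" and g :: "'a \<Rightarrow> 'a" and \<beta> h c k s q :: real
  assumes e: "e \<in> Basis" and c: "0 < c"
    "distr (hyperplane_measure e \<Otimes>\<^sub>M lborel) borel (\<lambda>(z, t). z + t *\<^sub>R e) = density lborel (\<lambda>_. ennreal c)"
    and u: "\<And>x. x \<in> half_space e \<Longrightarrow> (u has_derivative (\<lambda>v. g x \<bullet> v)) (at x within half_space e)"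
    and g: "continuous_on (half_space e) g"
    and u0: "\<And>x. x \<in> half_space e \<Longrightarrow> 0 \<le> u x"
    and uR: "\<And>x. x \<in> half_space e \<Longrightarrow> R \<le> norm x \<Longrightarrow> u x = 0"
    and gR: "\<And>x. x \<in> half_space e \<Longrightarrow> R \<le> norm x \<Longrightarrow> g x = 0"
    and q: "0 < q" and ks: "0 < k" "0 < s"
  defines "V \<equiv> \<lambda>x. max 0 (\<beta> - (norm (x + h *\<^sub>R e))\<^sup>2)"
  defines "M \<equiv> LINT x:half_space e|lborel. u x powr q"
    and "M1 \<equiv> LINT x:half_space e|lborel. V x powr q"
    and "X1 \<equiv> LINT x:half_space e|lborel. V x powr (q + 1)"
  assumes M: "0 < M" "k powr q * M1 / s ^ DIM('a) = M"
  shows "(q + real DIM('a)) * (LINT x:half_space e|lborel. u x powr (q + 1)) \<le>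
    (q + 1) * (k * \<beta> * M + (LINT x:half_space e|lborel. u x powr q * (norm (g x))\<^sup>2) / (4 * k * s\<^sup>2))
    - h / (s * c) * (LINT x:half_space_bd e|hausdorff_measure (DIM('a) - 1). u x powr (q + 1))
    - k * (M * X1 / M1)"
proof -
  let ?H = "half_space e" and ?d = "real DIM('a)"
  \<comment> \<open>\<open>s *\<^sub>R y + h *\<^sub>R e\<close> equals
    \<open>s *\<^sub>R (y - c0)\<close>, so the rescaled profile is again a truncated paraboloid, of
    height \<open>k * \<beta>\<close>, curvature \<open>k * s\<^sup>2\<close> and centre
    \<open>c0\<close>.\<close>
  define c0 where "c0 = - (h / s) *\<^sub>R e"
  define v where "v y = max 0 (k * \<beta> - (k * s\<^sup>2) * (norm (y - c0))\<^sup>2)" for y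
  have vV: "v y = k * V (s *\<^sub>R y)" for y
  proof -
    have "s *\<^sub>R y + h *\<^sub>R e = s *\<^sub>R (y - c0)"
      using ks by (simp add: c0_def algebra_simps)
    then have "(norm (s *\<^sub>R y + h *\<^sub>R e))\<^sup>2 = s\<^sup>2 * (norm (y - c0))\<^sup>2"
      using ks by (simp add: power_mult_distrib)
    then have "k * \<beta> - (k * s\<^sup>2) * (norm (y - c0))\<^sup>2 = k * (\<beta> - (norm (s *\<^sub>R y + h *\<^sub>R e))\<^sup>2)"
      by (simp add: algebra_simps)
    then show ?thesis using ks by (simp add: v_def V_def max_mult_distrib_left)
  qed
  have sH: "s *\<^sub>R y \<in> ?H \<longleftrightarrow> y \<in> ?H" for y
    using ks by (simp add: half_space_def zero_le_mult_iff)
  have Vm: "(\<lambda>x. indicator ?H x * V x powr r) \<in> borel_measurable borel" for r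
    unfolding V_def by measurable
  have vint: "(LINT y:?H|lborel. v y powr r) = k powr r * (LINT x:?H|lborel. V x powr r) / s ^ DIM('a)" for r
  proof -
    have "(LINT y:?H|lborel. v y powr r) = (LINT y|lborel. k powr r * (indicator ?H (s *\<^sub>R y) * V (s *\<^sub>R y) powr r))"
      unfolding set_lebesgue_integral_def using ks
      by (intro Bochner_Integration.integral_cong) (auto simp: vV powr_mult sH V_def split: split_indicator)
    also have "\<dots> = k powr r * ((LINT x|lborel. indicator ?H x * V x powr r) / s ^ DIM('a))"
      using lborel_integral_scaleR[OF Vm[of r] ks(2)] by simp
    finally show ?thesis by (simp add: set_lebesgue_integral_def)
  qed
  have M1: "M1 \<noteq> 0" using M by auto
  have vM: "(LINT y:?H|lborel. v y powr q) = M"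
    unfolding vint using M(2) by (simp add: M1_def)
  have vX: "(LINT y:?H|lborel. v y powr (q + 1)) = k * (M * X1 / M1)"
    unfolding vint M(2)[symmetric] X1_def[symmetric] using ks M1 by (simp add: powr_add)
  have cu: "continuous_on ?H u"
    using u by (intro has_derivative_continuous_on)
  have cuq: "continuous_on ?H (\<lambda>x. u x powr q)"
    using u0 q by (intro continuous_on_powr' cu continuous_on_const) auto
  note supp = set_integrable_compact_support[where R = R, OF closed_half_space]
  define F where "F x = u x powr (q + 1)" for x
  define G where "G x = ((q + 1) * u x powr q) *\<^sub>R g x" for x
  define D where "D = (LINT x:?H|lborel. u x powr q * (norm (g x))\<^sup>2)"
  define X where "X = (LINT x:?H|lborel. F x)"
  have F: "(F has_derivative (\<lambda>v. G x \<bullet> v)) (at x within ?H)" if "x \<in> ?H" for x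
    unfolding F_def G_def by (rule powr_gradient[OF q u[OF that] that u0])
  have cG: "continuous_on ?H G"
    unfolding G_def by (intro continuous_intros cuq g)
  have F0: "F x = 0" "G x = 0" if "x \<in> ?H" "R \<le> norm x" for x
    using uR[OF that] q by (auto simp: F_def G_def)
  have euler: "(LINT x:?H|lborel. G x \<bullet> x) = - ?d * X"
    unfolding X_def
    by (rule euler_dilation_identity[where R = R, OF closed_half_space convex_half_space _ F cG])
       (use F0 in \<open>auto simp: half_space_def\<close>)
  have normal: "c * (LINT x:?H|lborel. G x \<bullet> e) = - (LINT z:half_space_bd e|hausdorff_measure (DIM('a) - 1). F z)"
    by (rule half_space_normal_derivative_integral[where R = R, OF e c F cG]) (use F0 in auto)
  have "k * (M * X1 / M1) - X \<le>
    (q + 1) * (LINT x:?H|lborel. u x powr q * (k * \<beta> + (norm (g x))\<^sup>2 / (4 * (k * s\<^sup>2)) + g x \<bullet> (x - c0) - u x))"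
    unfolding X_def F_def vX[symmetric] v_def
    by (rule borell_brascamp_lieb_gradient[where R = R, OF closed_half_space convex_half_space u g u0])
       (use uR q ks M(1) vM in \<open>auto simp: M_def v_def\<close>)
  also have "\<dots> = (LINT x:?H|lborel. (q + 1) * (k * \<beta>) * u x powr q + (q + 1) / (4 * k * s\<^sup>2) * (u x powr q * (norm (g x))\<^sup>2)
      + G x \<bullet> x + h / s * (G x \<bullet> e) - (q + 1) * F x)"
  \<comment> \<open>Here \<open>x - c0\<close> is \<open>x + (h / s) *\<^sub>R e\<close>, and
    \<open>G\<close> is the gradient of \<open>u powr (q + 1)\<close>. The first summand falls under
    the dilation identity, the second yields the trace term.\<close>
  proof -
    have "(q + 1) * (u x powr q * (k * \<beta> + (norm (g x))\<^sup>2 / (4 * (k * s\<^sup>2)) + g x \<bullet> (x - c0) - u x)) =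
      (q + 1) * (k * \<beta>) * u x powr q + (q + 1) / (4 * k * s\<^sup>2) * (u x powr q * (norm (g x))\<^sup>2)
      + G x \<bullet> x + h / s * (G x \<bullet> e) - (q + 1) * F x" if "x \<in> ?H" for x
      using u0[OF that] ks q
      by (simp add: G_def F_def c0_def powr_add inner_diff_right inner_add_right algebra_simps add_divide_distrib)
    then show ?thesis
      by (subst set_integral_mult_right[symmetric], intro set_lebesgue_integral_cong) auto
  qed
  also have "\<dots> = (q + 1) * (k * \<beta>) * M + (q + 1) / (4 * k * s\<^sup>2) * D + (LINT x:?H|lborel. G x \<bullet> x)
      + h / s * (LINT x:?H|lborel. G x \<bullet> e) - (q + 1) * X"
  proof -
    have i: "set_integrable lborel ?H (\<lambda>x. u x powr q)" "set_integrable lborel ?H (\<lambda>x. u x powr q * (norm (g x))\<^sup>2)"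
        "set_integrable lborel ?H (\<lambda>x. G x \<bullet> x)" "set_integrable lborel ?H (\<lambda>x. G x \<bullet> e)" "set_integrable lborel ?H F"
      using F0 uR q
      by (auto intro!: supp cuq continuous_intros g cG has_derivative_continuous_on[OF F])
    show ?thesis
      unfolding M_def D_def X_def using i
      by (simp add: set_integral_add set_integral_diff)
  qed
  also have "(LINT x:?H|lborel. G x \<bullet> e) = - (LINT z:half_space_bd e|hausdorff_measure (DIM('a) - 1). F z) / c"
    using normal c(1) by (simp add: field_simps)
  finally show ?thesis
    unfolding euler unfolding X_def F_def D_def by (simp add: algebra_simps add_divide_distrib)
qed

lemma sum_square_le_weighted:
  fixes a b r :: real
  assumes "0 < r"
  shows "(a + b)\<^sup>2 \<le> (1 + r) * a\<^sup>2 + (1 + 1 / r) * b\<^sup>2"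
proof -
  have "0 \<le> (r * a - b)\<^sup>2 / r" using assms by simp
  also have "\<dots> = r * a\<^sup>2 + b\<^sup>2 / r - 2 * a * b"
    using assms by (simp add: power2_eq_square field_simps)
  finally show ?thesis by (simp add: power2_eq_square algebra_simps)
qed

text \<open>The truncation \<open>N * w / (N + w)\<close> makes \<open>w\<close> square integrable, so that the gradient of the cutoff
  contributes nothing in the limit.\<close>

proposition trace_inequality_two_parameters:
  fixes w :: "'a::euclidean_space \<Rightarrow> real" and g :: "'a \<Rightarrow> 'a" and \<beta> h c k s p q :: real
  assumes e: "e \<in> Basis" and c: "0 < c"
    "distr (hyperplane_measure e \<Otimes>\<^sub>M lborel) borel (\<lambda>(z, t). z + t *\<^sub>R e) = density lborel (\<lambda>_. ennreal c)"
    and w: "\<And>x. x \<in> half_space e \<Longrightarrow> (w has_derivative (\<lambda>v. g x \<bullet> v)) (at x within half_space e)"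
    and g: "continuous_on (half_space e) g"
    and wpos: "\<And>x. x \<in> half_space e \<Longrightarrow> 0 < w x"
    and p: "0 < p" "p < 1" and q: "q = 2 * p / (1 - p)" and ks: "0 < k" "0 < s"
    and iX: "set_integrable lborel (half_space e) (\<lambda>x. w x powr (1 + p))"
    and iM: "set_integrable lborel (half_space e) (\<lambda>x. w x powr (2 * p))"
    and iD: "set_integrable lborel (half_space e) (\<lambda>x. (norm (g x))\<^sup>2)"
    and iY: "set_integrable (hausdorff_measure (DIM('a) - 1)) (half_space_bd e) (\<lambda>x. w x powr (1 + p))"
  defines "V \<equiv> \<lambda>x. max 0 (\<beta> - (norm (x + h *\<^sub>R e))\<^sup>2)"
  defines "M \<equiv> LINT x:half_space e|lborel. w x powr (2 * p)"
    and "M1 \<equiv> LINT x:half_space e|lborel. V x powr q"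
    and "X1 \<equiv> LINT x:half_space e|lborel. V x powr (q + 1)"
  assumes M: "0 < M" "k powr q * M1 / s ^ DIM('a) = M"
  shows "(q + real DIM('a)) * (LINT x:half_space e|lborel. w x powr (1 + p)) \<le>
    (q + 1) * (k * \<beta> * M + (1 - p)\<^sup>2 * (LINT x:half_space e|lborel. (norm (g x))\<^sup>2) / (4 * k * s\<^sup>2))
    - h / (s * c) * (LINT x:half_space_bd e|hausdorff_measure (DIM('a) - 1). w x powr (1 + p))
    - k * (M * X1 / M1)"
proof -
  let ?H = "half_space e" and ?hm = "hausdorff_measure (DIM('a) - 1) :: 'a measure"
  \<comment> \<open>A smooth truncation below both \<open>t\<close> and \<open>N\<close>, whose
    derivative \<open>(N / (N + t))\<^sup>2\<close> is at most 1; \<open>\<theta>'\<close> is the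
    derivative of its power 1 - p.\<close>
  define \<phi> where "\<phi> N t = N * t / (N + t)" for N t :: real
  define \<theta>' where "\<theta>' N t = (1 - p) * \<phi> N t powr (- p) * (N / (N + t))\<^sup>2" for N t :: real
  \<comment> \<open>The squared paraboloid (1 - |x|^2 / N^2)_+^2, differentiable across the sphere
    of radius N and with gradient at most 4 / N. The unsimplified form matches the general gradient
    formula with q = 1 and centre 0.\<close>
  define \<eta> where "\<eta> N x = max 0 (1 - 1 / N\<^sup>2 * (norm (x - 0))\<^sup>2) powr (1 + 1)" for N and x :: 'a
  define \<eta>' where "\<eta>' N x = (- 2 * (1 / N\<^sup>2) * (1 + 1) * max 0 (1 - 1 / N\<^sup>2 * (norm (x - 0))\<^sup>2) powr 1) *\<^sub>R (x - 0)" for N and x :: 'a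
  define u where "u N x = \<phi> N (w x) powr (1 - p) * \<eta> N x" for N x
  define g' where "g' N x = (\<theta>' N (w x) * \<eta> N x) *\<^sub>R g x + (\<phi> N (w x) powr (1 - p)) *\<^sub>R \<eta>' N x" for N x
  have q0: "0 < q" using p by (simp add: q)
  have pq: "(1 - p) * q = 2 * p" "(1 - p) * (q + 1) = 1 + p"
    using p by (simp_all add: q distrib_left)
  have cw: "continuous_on ?H w"
    using w by (intro has_derivative_continuous_on)
  have \<phi>: "0 < \<phi> N t" "\<phi> N t \<le> t" "\<phi> N t \<le> N" if "0 < N" "0 < t" for N t
    using that by (auto simp: \<phi>_def divide_le_eq algebra_simps)
  have \<eta>01: "0 \<le> \<eta> N x" "\<eta> N x \<le> 1" for N x
  proof -
    show "0 \<le> \<eta> N x" by (simp add: \<eta>_def)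
    have "\<eta> N x \<le> 1 powr (1 + 1)" unfolding \<eta>_def by (intro powr_mono2) auto
    then show "\<eta> N x \<le> 1" by simp
  qed
  have \<eta>0: "\<eta> N x = 0" "\<eta>' N x = 0" if "0 < N" "N \<le> norm x" for N x
  proof -
    have "N\<^sup>2 \<le> (norm x)\<^sup>2" using that by (intro power_mono) auto
    then have "max 0 (1 - 1 / N\<^sup>2 * (norm (x - 0))\<^sup>2) = 0" using that by (simp add: max_def field_simps)
    then show "\<eta> N x = 0" "\<eta>' N x = 0" by (simp_all add: \<eta>_def \<eta>'_def)
  qed
  have \<eta>'_le: "norm (\<eta>' N x) \<le> 4 / N" if "0 < N" for N x
  proof (cases "norm x \<le> N")
    case True
    have "max 0 (1 - 1 / N\<^sup>2 * (norm (x - 0))\<^sup>2) \<le> 1" by auto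
    then have "norm (\<eta>' N x) \<le> (4 / N\<^sup>2) * 1 * norm x"
      unfolding \<eta>'_def by (simp add: divide_right_mono mult_right_mono)
    also have "\<dots> \<le> (4 / N\<^sup>2) * 1 * N" using True by (intro mult_left_mono) auto
    also have "\<dots> = 4 / N" using that by (simp add: power2_eq_square)
    finally show ?thesis .
  next
    case False
    then show ?thesis using \<eta>0[of N x] that by simp
  qed
  have u: "(u N has_derivative (\<lambda>v. g' N x \<bullet> v)) (at x within ?H)" if N: "0 < N" and x: "x \<in> ?H" for N x
  proof -
    have "((\<lambda>t. (N * t / (N + t)) powr (1 - p)) has_real_derivative \<theta>' N (w x)) (at (w x))"
    proof -
      have "((\<lambda>t. N * t / (N + t)) has_real_derivative (N / (N + w x))\<^sup>2) (at (w x))"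
        using wpos[OF x] N by (auto intro!: derivative_eq_intros simp: power2_eq_square field_simps)
      moreover have "0 < N * w x / (N + w x)" using \<phi>(1)[OF N wpos[OF x]] by (simp add: \<phi>_def)
      ultimately show ?thesis
        using DERIV_fun_powr[of "\<lambda>t. N * t / (N + t)" "(N / (N + w x))\<^sup>2" "w x" "1 - p"]
        by (simp add: \<theta>'_def \<phi>_def)
    qed
    then have "((\<lambda>t. \<phi> N t powr (1 - p)) has_derivative (*) (\<theta>' N (w x))) (at (w x) within w ` ?H)"
      unfolding \<phi>_def has_field_derivative_def by (rule has_derivative_at_withinI)
    from has_derivative_in_compose[OF w[OF x] this]
    have d1: "((\<lambda>x. \<phi> N (w x) powr (1 - p)) has_derivative (\<lambda>v. \<theta>' N (w x) * (g x \<bullet> v))) (at x within ?H)" .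
    have d2: "(\<eta> N has_derivative (\<lambda>v. \<eta>' N x \<bullet> v)) (at x within ?H)"
    proof -
      have "\<eta> N = (\<lambda>x. max 0 (1 - 1 / N\<^sup>2 * (norm (x - 0))\<^sup>2) powr (1 + 1))"
        by (rule ext) (rule \<eta>_def)
      moreover have "\<eta>' N x = (- 2 * (1 / N\<^sup>2) * (1 + 1) * max 0 (1 - 1 / N\<^sup>2 * (norm (x - 0))\<^sup>2) powr 1) *\<^sub>R (x - 0)"
        by (rule \<eta>'_def)
      ultimately show ?thesis
        using max_quadratic_gradient[OF zero_less_one, of 1 "1 / N\<^sup>2" 0 x ?H] by metis
    qed
    have "u N = (\<lambda>x. \<phi> N (w x) powr (1 - p) * \<eta> N x)"
      by (rule ext) (rule u_def)
    moreover have "(\<lambda>v. \<phi> N (w x) powr (1 - p) * (\<eta>' N x \<bullet> v) + \<theta>' N (w x) * (g x \<bullet> v) * \<eta> N x) = (\<lambda>v. g' N x \<bullet> v)"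
      by (rule ext) (simp add: g'_def inner_add_left)
    ultimately show ?thesis
      using has_derivative_mult[OF d1 d2] by metis
  qed
  have Nw: "N + w x \<noteq> 0" if "0 < N" "x \<in> ?H" for N x
    using that(1) wpos[OF that(2)] by linarith
  have cont_\<phi>: "continuous_on ?H (\<lambda>x. \<phi> N (w x))" if "0 < N" for N
    unfolding \<phi>_def by (intro continuous_intros cw ballI Nw that)
  have cg': "continuous_on ?H (g' N)" if N: "0 < N" for N
  proof -
    have 1: "continuous_on ?H (\<lambda>x. \<phi> N (w x) powr r)" for r
      by (intro continuous_on_powr cont_\<phi>[OF N] continuous_on_const ballI less_imp_neq[symmetric] \<phi>(1)[OF N wpos])
    have 2: "continuous_on ?H (\<lambda>x. N / (N + w x))"
      by (intro continuous_intros cw ballI Nw N)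
    have 3: "continuous_on ?H (\<lambda>x. max 0 (1 - 1 / N\<^sup>2 * (norm (x - 0))\<^sup>2) powr r)" if "0 < r" for r
      using that by (intro continuous_on_powr' continuous_intros) auto
    show ?thesis
      unfolding g'_def[abs_def] \<theta>'_def \<eta>_def \<eta>'_def
      by (intro continuous_on_add continuous_on_scaleR continuous_on_mult continuous_on_power continuous_on_const
          continuous_on_id continuous_on_diff 1 2 3 g) simp_all
  qed
  have u0: "0 \<le> u N x" for N x by (simp add: u_def \<eta>01)
  \<comment> \<open>The set \<open>S\<close> and the measure \<open>\<mu>\<close> are left open so
    that one dominated convergence argument serves the half space and its boundary. The dominating
    function is a power of \<open>w\<close> itself, as the truncation lies below \<open>w\<close>
    and the cutoff below 1.\<close>
  have conv: "(\<lambda>n. LINT x:S|\<mu>. u (real (Suc n)) x powr r) \<longlonglongrightarrow> (LINT x:S|\<mu>. w x powr ((1 - p) * r))"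
    if S: "S \<subseteq> ?H" "S \<in> sets borel" and r: "0 < r" and \<mu> [measurable_cong]: "sets \<mu> = sets borel"
      and int: "set_integrable \<mu> S (\<lambda>x. w x powr ((1 - p) * r))" for S :: "'a set" and \<mu> r
    unfolding set_lebesgue_integral_def
  proof (rule integral_dominated_convergence[where w = "\<lambda>x. indicator S x *\<^sub>R w x powr ((1 - p) * r)"])
    have m: "(\<lambda>x. indicator S x *\<^sub>R f x) \<in> borel_measurable \<mu>" if "continuous_on ?H f" for f :: "'a \<Rightarrow> real"
      using borel_measurable_continuous_on_indicator[OF S(2) continuous_on_subset[OF that S(1)]]
      by (simp cong: measurable_cong_sets[OF \<mu> refl])
    have "continuous_on ?H (\<lambda>x. w x powr ((1 - p) * r))"
      by (intro continuous_on_powr cw continuous_on_const ballI less_imp_neq[symmetric] wpos)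
    then show "(\<lambda>x. indicator S x *\<^sub>R w x powr ((1 - p) * r)) \<in> borel_measurable \<mu>"
      by (rule m)
    show "(\<lambda>x. indicator S x *\<^sub>R u (real (Suc n)) x powr r) \<in> borel_measurable \<mu>" for n
    proof (rule m)
      have "continuous_on ?H (u (real (Suc n)))"
        using u[of "real (Suc n)"] by (intro has_derivative_continuous_on) auto
      then show "continuous_on ?H (\<lambda>x. u (real (Suc n)) x powr r)"
        using u0 r by (intro continuous_on_powr' continuous_on_const) auto
    qed
    show "integrable \<mu> (\<lambda>x. indicator S x *\<^sub>R w x powr ((1 - p) * r))"
      using int by (simp add: set_integrable_def)
    show "AE x in \<mu>. (\<lambda>n. indicator S x *\<^sub>R u (real (Suc n)) x powr r) \<longlonglongrightarrow> indicator S x *\<^sub>R w x powr ((1 - p) * r)"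
    proof (rule AE_I2)
      fix x
      show "(\<lambda>n. indicator S x *\<^sub>R u (real (Suc n)) x powr r) \<longlonglongrightarrow> indicator S x *\<^sub>R w x powr ((1 - p) * r)"
      proof (cases "x \<in> S")
        case True
        then have wx: "0 < w x" using S wpos by auto
        have inv0: "(\<lambda>n. 1 / real (Suc n)) \<longlonglongrightarrow> 0"
          by (rule LIMSEQ_inverse_real_of_nat[unfolded inverse_eq_divide])
        have "(\<lambda>n. w x / (1 + w x * (1 / real (Suc n)))) \<longlonglongrightarrow> w x / (1 + w x * 0)"
          by (intro tendsto_intros inv0) auto
        moreover have "w x / (1 + w x * (1 / real (Suc n))) = \<phi> (real (Suc n)) (w x)" for n
        proof -
          have "1 + w x * (1 / real (Suc n)) = (real (Suc n) + w x) / real (Suc n)"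
            by (simp add: field_simps)
          then show ?thesis by (simp only: \<phi>_def divide_divide_eq_right mult.commute)
        qed
        ultimately have l1: "(\<lambda>n. \<phi> (real (Suc n)) (w x)) \<longlonglongrightarrow> w x" by simp
        have "(\<lambda>n. max 0 (1 - (1 / real (Suc n))\<^sup>2 * (norm (x - 0))\<^sup>2) powr (1 + 1)) \<longlonglongrightarrow> max 0 (1 - 0\<^sup>2 * (norm (x - 0))\<^sup>2) powr (1 + 1)"
          by (intro tendsto_intros inv0) auto
        then have l2: "(\<lambda>n. \<eta> (real (Suc n)) x) \<longlonglongrightarrow> 1"
          by (simp add: \<eta>_def power_one_over)
        have "(\<lambda>n. u (real (Suc n)) x powr r) \<longlonglongrightarrow> (w x powr (1 - p) * 1) powr r"
          unfolding u_def using wx by (intro tendsto_intros l1 l2) auto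
        then show ?thesis using True by (simp add: powr_powr)
      qed simp
    qed
    fix n
    show "AE x in \<mu>. norm (indicator S x *\<^sub>R u (real (Suc n)) x powr r) \<le> indicator S x *\<^sub>R w x powr ((1 - p) * r)"
    proof (rule AE_I2)
      fix x
      have "u (real (Suc n)) x powr r \<le> w x powr ((1 - p) * r)" if "x \<in> S"
      proof -
        have wx: "0 < w x" using S wpos that by auto
        have "u (real (Suc n)) x \<le> w x powr (1 - p) * 1"
          unfolding u_def using \<phi>(1,2)[of "real (Suc n)" "w x"] wx \<eta>01 p
          by (intro mult_mono powr_mono2) auto
        then have "u (real (Suc n)) x powr r \<le> (w x powr (1 - p)) powr r"
          using r u0 by (intro powr_mono2) auto
        then show ?thesis by (simp add: powr_powr)
      qed
      then show "norm (indicator S x *\<^sub>R u (real (Suc n)) x powr r) \<le> indicator S x *\<^sub>R w x powr ((1 - p) * r)"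
        by (auto split: split_indicator)
    qed
  qed
  define Mn where "Mn n = (LINT x:?H|lborel. u (real (Suc n)) x powr q)" for n
  define Xn where "Xn n = (LINT x:?H|lborel. u (real (Suc n)) x powr (q + 1))" for n
  define Yn where "Yn n = (LINT x:half_space_bd e|?hm. u (real (Suc n)) x powr (q + 1))" for n
  define Dn where "Dn n = (LINT x:?H|lborel. u (real (Suc n)) x powr q * (norm (g' (real (Suc n)) x))\<^sup>2)" for n
  define X where "X = (LINT x:?H|lborel. w x powr (1 + p))"
  define Y where "Y = (LINT x:half_space_bd e|?hm. w x powr (1 + p))"
  define D where "D = (LINT x:?H|lborel. (norm (g x))\<^sup>2)"
  have bdH: "half_space_bd e \<subseteq> ?H" by (auto simp: half_space_def half_space_bd_def)
  have lM: "Mn \<longlonglongrightarrow> M" and lX: "Xn \<longlonglongrightarrow> X" and lY: "Yn \<longlonglongrightarrow> Y"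
    unfolding Mn_def M_def Xn_def X_def Yn_def Y_def
    using conv[of ?H q lborel] conv[of ?H "q + 1" lborel] conv[of "half_space_bd e" "q + 1" ?hm] bdH q0 iM iX iY
    unfolding pq by auto
  define U where "U N = (1 + N powr (- p)) * ((1 - p)\<^sup>2 * D) + (16 * N powr (- 2 * p) + 16 * N powr (- p)) * M" for N
  have DU: "Dn n \<le> U (real (Suc n))" for n
  proof -
    define N where "N = real (Suc n)"
    have N: "0 < N" by (simp add: N_def)
    \<comment> \<open>The weight in the splitting of the square: \<open>r\<close> tends to 0, while
      the cutoff error, of order \<open>N powr (- 2 * p)\<close>, is multiplied by only
      \<open>1 + N powr p\<close> and still tends to 0.\<close>
    define r where "r = N powr (- p)"
    have r: "0 < r" "1 / r = N powr p" using N by (simp_all add: r_def powr_minus_divide)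
    have pw: "u N x powr q * (norm (g' N x))\<^sup>2 \<le>
        (1 + r) * (1 - p)\<^sup>2 * (norm (g x))\<^sup>2 + (16 * N powr (- 2 * p) + 16 * N powr (- p)) * w x powr (2 * p)" if x: "x \<in> ?H" for x
    proof -
      define f where "f = \<phi> N (w x)"
      have f: "0 < f" "f \<le> w x" "f \<le> N" using \<phi>[OF N wpos[OF x]] by (auto simp: f_def)
      have "u N x powr q = f powr (2 * p) * \<eta> N x powr q"
        unfolding u_def f_def[symmetric] using \<eta>01 by (simp add: powr_mult powr_powr pq)
      also have "\<dots> \<le> f powr (2 * p) * 1"
        using \<eta>01[of N x] q0 powr_mono2[of q "\<eta> N x" 1] by (intro mult_left_mono) auto
      also have "\<dots> = (f powr p)\<^sup>2"
        by (simp add: power2_eq_square powr_add[symmetric])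
      finally have 1: "u N x powr q \<le> (f powr p)\<^sup>2" .
      have NN: "0 \<le> (N / (N + w x))\<^sup>2" "(N / (N + w x))\<^sup>2 \<le> 1"
        using N wpos[OF x] by (auto intro!: power_le_one simp: divide_le_eq)
      have "norm (g' N x) \<le> norm ((\<theta>' N (w x) * \<eta> N x) *\<^sub>R g x) + norm ((f powr (1 - p)) *\<^sub>R \<eta>' N x)"
        unfolding g'_def f_def by (rule norm_triangle_ineq)
      also have "\<dots> = (1 - p) * f powr (- p) * ((N / (N + w x))\<^sup>2 * \<eta> N x) * norm (g x) + f powr (1 - p) * norm (\<eta>' N x)"
        using p \<eta>01[of N x] by (simp add: \<theta>'_def f_def[symmetric] abs_mult)
      also have "\<dots> \<le> (1 - p) * f powr (- p) * (1 * 1) * norm (g x) + f powr (1 - p) * (4 / N)"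
        using p \<eta>01[of N x] NN \<eta>'_le[OF N, of x]
        by (intro add_mono mult_mono mult_nonneg_nonneg) auto
      finally have "f powr p * norm (g' N x) \<le> f powr p * ((1 - p) * f powr (- p) * (1 * 1) * norm (g x) + f powr (1 - p) * (4 / N))"
        by (intro mult_left_mono) auto
      also have "\<dots> = (f powr p * f powr (- p)) * ((1 - p) * norm (g x)) + (f powr p * f powr (1 - p)) * (4 / N)"
        by (simp add: algebra_simps)
      also have "\<dots> = (1 - p) * norm (g x) + f * (4 / N)"
        using f by (simp add: powr_add[symmetric])
      finally have 2: "f powr p * norm (g' N x) \<le> (1 - p) * norm (g x) + f * (4 / N)" .
      \<comment> \<open>Here the truncation pays off: of the square of f the power 2 - 2 p is
        bounded through \<open>f \<le> N\<close>, and only the integrable power 2 p of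
        \<open>w\<close> remains.\<close>
      have "(f * (4 / N))\<^sup>2 = 16 * (f powr (2 - 2 * p) * f powr (2 * p)) / N\<^sup>2"
        using f by (simp add: powr_add[symmetric] power_mult_distrib power_divide)
      also have "\<dots> \<le> 16 * (N powr (2 - 2 * p) * w x powr (2 * p)) / N\<^sup>2"
        using f p N by (intro divide_right_mono mult_left_mono mult_mono powr_mono2) auto
      also have "\<dots> = 16 * N powr (- 2 * p) * w x powr (2 * p)"
        using N by (simp add: powr_diff powr_minus_divide)
      finally have 3: "(f * (4 / N))\<^sup>2 \<le> 16 * N powr (- 2 * p) * w x powr (2 * p)" .
      have "u N x powr q * (norm (g' N x))\<^sup>2 \<le> (f powr p)\<^sup>2 * (norm (g' N x))\<^sup>2"
        by (intro mult_right_mono 1) auto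
      also have "\<dots> \<le> ((1 - p) * norm (g x) + f * (4 / N))\<^sup>2"
        unfolding power_mult_distrib[symmetric] by (intro power_mono 2) auto
      also have "\<dots> \<le> (1 + r) * ((1 - p) * norm (g x))\<^sup>2 + (1 + 1 / r) * (f * (4 / N))\<^sup>2"
        by (rule sum_square_le_weighted[OF r(1)])
      also have "\<dots> \<le> (1 + r) * ((1 - p) * norm (g x))\<^sup>2 + (1 + 1 / r) * (16 * N powr (- 2 * p) * w x powr (2 * p))"
        using r(1) by (intro add_left_mono mult_left_mono 3) auto
      also have "(1 + 1 / r) * (16 * N powr (- 2 * p) * w x powr (2 * p)) =
          (16 * N powr (- 2 * p) + 16 * (N powr p * N powr (- 2 * p))) * w x powr (2 * p)"
        unfolding r(2) by (simp add: algebra_simps)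
      also have "N powr p * N powr (- 2 * p) = N powr (- p)"
        by (simp add: powr_add[symmetric])
      also have "(1 + r) * ((1 - p) * norm (g x))\<^sup>2 = (1 + r) * (1 - p)\<^sup>2 * (norm (g x))\<^sup>2"
        by (simp add: power_mult_distrib)
      finally show ?thesis .
    qed
    have i1: "set_integrable lborel ?H (\<lambda>x. u N x powr q * (norm (g' N x))\<^sup>2)"
    proof (rule set_integrable_compact_support[where R = N, OF closed_half_space])
      have "continuous_on ?H (u N)"
        using u[OF N] by (intro has_derivative_continuous_on)
      then show "continuous_on ?H (\<lambda>x. u N x powr q * (norm (g' N x))\<^sup>2)"
        using u0 q0 by (intro continuous_on_mult continuous_on_powr' continuous_on_const continuous_intros cg'[OF N]) auto
      show "u N x powr q * (norm (g' N x))\<^sup>2 = 0" if "N \<le> norm x" for x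
        using \<eta>0[OF N that] q0 by (simp add: u_def)
    qed
    have "Dn n \<le> (LINT x:?H|lborel. (1 + r) * (1 - p)\<^sup>2 * (norm (g x))\<^sup>2 + (16 * N powr (- 2 * p) + 16 * N powr (- p)) * w x powr (2 * p))"
      unfolding Dn_def N_def[symmetric]
      by (rule set_integral_mono[OF i1 _ pw]) (auto intro!: set_integral_add iD iM)
    also have "\<dots> = U N"
      using iD iM by (simp add: set_integral_add(2) U_def D_def M_def r_def)
    finally show ?thesis by (simp add: N_def)
  qed
  have powr0: "(\<lambda>n. real (Suc n) powr r) \<longlonglongrightarrow> 0" if "r < 0" for r
    using that by (intro tendsto_neg_powr filterlim_compose[OF filterlim_real_sequentially filterlim_Suc])
  have lU: "(\<lambda>n. U (real (Suc n))) \<longlonglongrightarrow> (1 + 0) * ((1 - p)\<^sup>2 * D) + (16 * 0 + 16 * 0) * M"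
    unfolding U_def using p by (intro tendsto_intros powr0) auto
  have M1: "0 < M1"
    using M ks by (metis divide_pos_pos mult_pos_pos powr_gt_zero not_less zero_less_divide_iff zero_less_mult_iff zero_less_power less_asym)
  \<comment> \<open>Truncation changes the mass; with \<open>s\<close> fixed, this value of the
    amplitude restores the mass relation, and it converges to \<open>k\<close>.\<close>
  define kn where "kn n = (Mn n * s ^ DIM('a) / M1) powr (1 / q)" for n
  have "M * s ^ DIM('a) / M1 = k powr q"
    using M(2)[symmetric] M1 ks by simp
  then have kpos: "0 < M * s ^ DIM('a) / M1" and keq: "(M * s ^ DIM('a) / M1) powr (1 / q) = k"
    using ks q0 by (auto simp: powr_powr)
  have lk: "kn \<longlonglongrightarrow> k"
    unfolding kn_def keq[symmetric] using M1 kpos ks by (intro tendsto_intros lM) auto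
  let ?rhs = "\<lambda>n. (q + 1) * (kn n * \<beta> * Mn n + U (real (Suc n)) / (4 * kn n * s\<^sup>2)) - h / (s * c) * Yn n - kn n * (Mn n * X1 / M1)"
  let ?lim = "(q + 1) * (k * \<beta> * M + ((1 + 0) * ((1 - p)\<^sup>2 * D) + (16 * 0 + 16 * 0) * M) / (4 * k * s\<^sup>2)) - h / (s * c) * Y - k * (M * X1 / M1)"
  have step: "(q + real DIM('a)) * Xn n \<le>
    ?rhs n"
    if Mn: "0 < Mn n" for n
  proof -
    have kn: "0 < kn n" using Mn M1 ks by (simp add: kn_def)
    have knM: "kn n powr q * M1 / s ^ DIM('a) = Mn n"
      using Mn M1 ks q0 by (simp add: kn_def powr_powr)
    have "(q + real DIM('a)) * Xn n \<le>
      (q + 1) * (kn n * \<beta> * Mn n + Dn n / (4 * kn n * s\<^sup>2)) - h / (s * c) * Yn n - kn n * (Mn n * X1 / M1)"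
      unfolding Xn_def Yn_def Mn_def Dn_def X1_def M1_def V_def
      by (rule compact_support_trace_inequality[OF e c u cg' u0 _ _ q0 _ ks(2), where R = "real (Suc n)"])
         (use \<eta>0[of "real (Suc n)"] kn knM Mn in \<open>auto simp: u_def g'_def Mn_def M1_def V_def\<close>)
    moreover have "Dn n / (4 * kn n * s\<^sup>2) \<le> U (real (Suc n)) / (4 * kn n * s\<^sup>2)"
      using kn by (intro divide_right_mono DU) auto
    then have "(q + 1) * (kn n * \<beta> * Mn n + Dn n / (4 * kn n * s\<^sup>2)) \<le> (q + 1) * (kn n * \<beta> * Mn n + U (real (Suc n)) / (4 * kn n * s\<^sup>2))"
      using q0 by (intro mult_left_mono) auto
    ultimately show ?thesis by linarith
  qed
  have "(q + real DIM('a)) * X \<le>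
    ?lim"
  proof (rule tendsto_le[OF sequentially_bot])
    show "?rhs
      \<longlonglongrightarrow> ?lim"
      using ks M1 by (intro tendsto_intros lk lM lU lY) auto
    show "(\<lambda>n. (q + real DIM('a)) * Xn n) \<longlonglongrightarrow> (q + real DIM('a)) * X"
      by (intro tendsto_intros lX)
    have "\<forall>\<^sub>F n in sequentially. 0 < Mn n"
      using order_tendstoD(1)[OF lM M(1)] .
    then show "\<forall>\<^sub>F n in sequentially. (q + real DIM('a)) * Xn n \<le>
      ?rhs n"
      by eventually_elim (rule step)
  qed
  then show ?thesis by (simp add: X_def Y_def D_def)
qed

section \<open>The sharp constants\<close>

lemma ball_subset_half_space:
  assumes e: "e \<in> Basis"
  shows "ball ((1 / 2) *\<^sub>R e) (1 / 2) \<subseteq> half_space e \<inter> cball 0 1"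
proof
  fix x assume "x \<in> ball ((1 / 2) *\<^sub>R e) (1 / 2)"
  then have d: "norm (x - (1 / 2) *\<^sub>R e) < 1 / 2" by (simp add: dist_norm norm_minus_commute)
  have "\<bar>(x - (1 / 2) *\<^sub>R e) \<bullet> e\<bar> \<le> norm (x - (1 / 2) *\<^sub>R e)"
    by (rule Basis_le_norm[OF e])
  then have "0 \<le> x \<bullet> e"
    using d e by (simp add: inner_diff_left inner_Basis)
  moreover have "norm x \<le> norm (x - (1 / 2) *\<^sub>R e) + norm ((1 / 2) *\<^sub>R e)"
    using norm_triangle_ineq[of "x - (1 / 2) *\<^sub>R e" "(1 / 2) *\<^sub>R e"] by simp
  ultimately show "x \<in> half_space e \<inter> cball 0 1"
    using d e by (simp add: half_space_def)
qed

lemma half_space_integral_pos: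
  fixes f :: "'a::euclidean_space \<Rightarrow> real"
  assumes e: "e \<in> Basis" and f: "set_integrable lborel (half_space e) f" "\<And>x. x \<in> half_space e \<Longrightarrow> 0 < f x"
  shows "0 < (LINT x:half_space e|lborel. f x)"
proof -
  have nn: "0 \<le> indicator (half_space e) x *\<^sub>R f x" for x
    using f(2) by (auto split: split_indicator simp: less_imp_le)
  have "(LINT x:half_space e|lborel. f x) \<noteq> 0"
  proof
    assume "(LINT x:half_space e|lborel. f x) = 0"
    then have "AE x in lborel. indicator (half_space e) x *\<^sub>R f x = 0"
      using f(1) nn unfolding set_lebesgue_integral_def set_integrable_def
      by (subst (asm) integral_nonneg_eq_0_iff_AE) auto
    then have "AE x in lborel. x \<notin> ball ((1 / 2) *\<^sub>R e) (1 / 2)"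
    proof eventually_elim
      case (elim x)
      then show ?case using ball_subset_half_space[OF e] f(2)[of x] by (auto split: split_indicator_asm)
    qed
    then have "emeasure lborel (ball ((1 / 2) *\<^sub>R e) (1 / 2)) = 0"
      by (subst (asm) AE_iff_measurable[of "ball ((1 / 2) *\<^sub>R e) (1 / 2)"]) auto
    then show False
      using content_ball_pos[of "1 / 2" "(1 / 2) *\<^sub>R e"] by (simp add: measure_def)
  qed
  moreover have "0 \<le> (LINT x:half_space e|lborel. f x)"
    unfolding set_lebesgue_integral_def using nn by (intro Bochner_Integration.integral_nonneg) auto
  ultimately show ?thesis by linarith
qed

lemma half_space_cone: "x \<in> half_space e \<Longrightarrow> 0 < s \<Longrightarrow> s *\<^sub>R x \<in> half_space e"
  by (simp add: half_space_def)

lemma grad_on_has_derivative: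
  fixes f :: "'a::euclidean_space \<Rightarrow> real"
  assumes "f differentiable (at x within S)"
  shows "(f has_derivative (\<lambda>v. grad_on S f x \<bullet> v)) (at x within S)"
proof -
  have d: "(f has_derivative frechet_derivative f (at x within S)) (at x within S)"
    using assms by (simp add: frechet_derivative_works)
  interpret linear "frechet_derivative f (at x within S)"
    using d by (rule has_derivative_linear)
  have "frechet_derivative f (at x within S) v = grad_on S f x \<bullet> v" for v
  proof -
    have "frechet_derivative f (at x within S) v = frechet_derivative f (at x within S) (\<Sum>i\<in>Basis. (v \<bullet> i) *\<^sub>R i)"
      by (simp add: euclidean_representation)
    also have "\<dots> = (\<Sum>i\<in>Basis. (v \<bullet> i) * frechet_derivative f (at x within S) i)"
      by (simp add: sum scale)
    also have "\<dots> = grad_on S f x \<bullet> v"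
      unfolding grad_on_def inner_sum_left
      by (intro sum.cong refl) (simp add: inner_commute mult.commute)
    finally show ?thesis .
  qed
  then have "frechet_derivative f (at x within S) = (\<lambda>v. grad_on S f x \<bullet> v)"
    by (rule ext)
  then show ?thesis using d by simp
qed

lemma smooth_on_gradient:
  fixes w :: "'a::euclidean_space \<Rightarrow> real"
  assumes "smooth_on S w"
  shows "x \<in> S \<Longrightarrow> (w has_derivative (\<lambda>v. grad_on S w x \<bullet> v)) (at x within S)"
    and "continuous_on S (grad_on S w)"
proof -
  have C: "Ck_on (Suc 0) S w" using assms by (simp add: smooth_on_def)
  show "x \<in> S \<Longrightarrow> (w has_derivative (\<lambda>v. grad_on S w x \<bullet> v)) (at x within S)"
    using C by (intro grad_on_has_derivative) (auto simp: differentiable_on_def)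
  show "continuous_on S (grad_on S w)"
    unfolding grad_on_def[abs_def] using C by (intro continuous_intros) auto
qed

text \<open>The derivative relative to the half space is unique up to the boundary: each basis
  direction admits arbitrarily small nonzero steps inside, and a positive step along
  \<open>e\<close> never leaves.\<close>

lemma grad_on_half_space:
  fixes f :: "'a::euclidean_space \<Rightarrow> real"
  assumes e: "e \<in> Basis" and x: "x \<in> half_space e"
    and f: "(f has_derivative (\<lambda>v. g \<bullet> v)) (at x within half_space e)"
  shows "grad_on (half_space e) f x = g"
proof -
  have f': "(f has_derivative frechet_derivative f (at x within half_space e)) (at x within half_space e)"
    using f by (auto simp: frechet_derivative_works[symmetric] differentiable_def)
  have "\<exists>d. 0 < \<bar>d\<bar> \<and> \<bar>d\<bar> < r \<and> x + d *\<^sub>R i \<in> half_space e" if "i \<in> Basis" "0 < r" for i :: 'a and r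
    using x e that by (intro exI[of _ "r / 2"]) (auto simp: half_space_def inner_add_left inner_Basis)
  then have "frechet_derivative f (at x within half_space e) = (\<lambda>v. g \<bullet> v)"
    by (rule frechet_derivative_unique_within[OF f' f])
  then show ?thesis
    by (simp add: grad_on_def euclidean_representation)
qed

lemma Lq_norm_powr:
  assumes "q \<noteq> 0"
  shows "Lq_norm M S q f powr q = (LINT x:S|M. norm (f x) powr q)"
proof -
  have "0 \<le> (LINT x:S|M. norm (f x) powr q)"
    unfolding set_lebesgue_integral_def by (intro Bochner_Integration.integral_nonneg) auto
  then show ?thesis
    using assms by (simp add: Lq_norm_def powr_powr)
qed

lemma set_integrable_cong_on:
  "(\<And>x. x \<in> S \<Longrightarrow> f x = g x) \<Longrightarrow> set_integrable M S f \<longleftrightarrow> set_integrable M S g"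
  unfolding set_integrable_def
  by (intro Bochner_Integration.integrable_cong refl) (auto split: split_indicator)

lemma set_lebesgue_integral_cong_on:
  fixes f g :: "'a \<Rightarrow> real"
  shows "(\<And>x. x \<in> S \<Longrightarrow> f x = g x) \<Longrightarrow> (LINT x:S|M. f x) = (LINT x:S|M. g x)"
  unfolding set_lebesgue_integral_def
  by (intro Bochner_Integration.integral_cong) (auto split: split_indicator)

section \<open>The extremal profile, its normalisation and its integral identities\<close>

lemma barenblatt_vanishes:
  fixes e :: "'a::euclidean_space"
  assumes "e \<in> Basis" "\<bar>h\<bar> + sqrt \<bar>\<beta>\<bar> \<le> norm x"
  shows "max 0 (\<beta> - (norm (x + h *\<^sub>R e))\<^sup>2) = 0"
proof -
  have "norm x \<le> norm (x + h *\<^sub>R e) + \<bar>h\<bar>"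
    using norm_triangle_ineq4[of "x + h *\<^sub>R e" "h *\<^sub>R e"] assms(1) by simp
  then have "sqrt \<bar>\<beta>\<bar> \<le> norm (x + h *\<^sub>R e)" using assms(2) by linarith
  then have "(sqrt \<bar>\<beta>\<bar>)\<^sup>2 \<le> (norm (x + h *\<^sub>R e))\<^sup>2" by (intro power_mono) auto
  then show ?thesis by auto
qed

lemma barenblatt_integrable:
  fixes e :: "'a::euclidean_space"
  assumes "e \<in> Basis" "0 < r" "continuous_on UNIV f"
  shows "set_integrable lborel (half_space e) (\<lambda>x. max 0 (\<beta> - (norm (x + h *\<^sub>R e))\<^sup>2) powr r * f x)"
proof (rule set_integrable_compact_support[where R = "\<bar>h\<bar> + sqrt \<bar>\<beta>\<bar>", OF closed_half_space])
  have "continuous_on (half_space e) (\<lambda>x. max 0 (\<beta> - (norm (x + h *\<^sub>R e))\<^sup>2) powr r)"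
    using assms(2) by (intro continuous_on_powr' continuous_intros) auto
  then show "continuous_on (half_space e) (\<lambda>x. max 0 (\<beta> - (norm (x + h *\<^sub>R e))\<^sup>2) powr r * f x)"
    by (intro continuous_on_mult continuous_on_subset[OF assms(3)]) auto
qed (use barenblatt_vanishes[OF assms(1)] in auto)

text \<open>Intermediate value theorem in \<open>\<beta>\<close>: the integral vanishes at 0,
  depends continuously on \<open>\<beta>\<close> by dominated convergence, and exceeds 1 for a
  suitable large value.\<close>

lemma extremal_normalized_exists:
  fixes e :: "'a::euclidean_space"
  assumes e: "e \<in> Basis" and p: "0 < p" "p < 1"
  shows "\<exists>\<beta>. extremal_normalized p h e \<beta>"
proof -
  define q where "q = 2 * p / (1 - p)"
  define \<kappa> where "\<kappa> = (1 - p) / (2 * p)"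
  have q: "0 < q" and \<kappa>: "0 < \<kappa>" using p by (auto simp: q_def \<kappa>_def)
  define f where "f \<beta> x = (\<kappa> * max (\<beta> - (norm (x + h *\<^sub>R e))\<^sup>2) 0) powr q" for \<beta> and x :: 'a
  define I where "I \<beta> = (LINT x:half_space e|lborel. f \<beta> x)" for \<beta>
  have Iint: "set_integrable lborel (half_space e) (\<lambda>x. f \<beta> x)" for \<beta>
    using barenblatt_integrable[OF e q, of "\<lambda>_. \<kappa> powr q" \<beta> h]
    by (simp add: f_def powr_mult max.commute mult.commute)
  have bm: "(\<lambda>x. indicator (half_space e) x *\<^sub>R f \<beta> x) \<in> borel_measurable lborel" for \<beta>
    using Iint[of \<beta>] by (auto simp: set_integrable_def)
  have fcont: "(\<lambda>n. f (b n) x) \<longlonglongrightarrow> f \<beta> x" if "b \<longlonglongrightarrow> \<beta>" for b \<beta> x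
    unfolding f_def using q \<kappa> by (intro tendsto_powr' tendsto_intros that) auto
  define S where "S = ball ((1 / 2) *\<^sub>R e) (1 / 2 :: real)"
  define K where "K = (1 + \<bar>h\<bar>)\<^sup>2"
  have S: "S \<subseteq> half_space e" "\<And>x. x \<in> S \<Longrightarrow> (norm (x + h *\<^sub>R e))\<^sup>2 \<le> K"
  proof -
    show "S \<subseteq> half_space e" using ball_subset_half_space[OF e] by (auto simp: S_def)
    fix x assume "x \<in> S"
    then have "norm x \<le> 1" using ball_subset_half_space[OF e] by (auto simp: S_def)
    then have "norm (x + h *\<^sub>R e) \<le> 1 + \<bar>h\<bar>"
      using norm_triangle_ineq[of x "h *\<^sub>R e"] e by simp
    then show "(norm (x + h *\<^sub>R e))\<^sup>2 \<le> K" unfolding K_def by (intro power_mono) auto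
  qed
  define m where "m = measure lborel S"
  have m: "0 < m" unfolding m_def S_def by (rule content_ball_pos) simp
  \<comment> \<open>On the ball \<open>S\<close>, of measure \<open>m\<close>, the squared distance
    is at most \<open>K\<close>, so this value makes the integrand at least \<open>1 / m\<close>
    there.\<close>
  define B where "B = K + (1 / m) powr (1 / q) / \<kappa>"
  have K: "0 \<le> K" by (simp add: K_def)
  have B: "0 \<le> B" using K \<kappa> by (simp add: B_def)
  have "1 \<le> I B"
  proof -
    have "1 = (LINT x|lborel. indicator S x *\<^sub>R (1 / m))"
      using m by (simp add: m_def S_def)
    also have "\<dots> \<le> I B"
      unfolding I_def set_lebesgue_integral_def
    proof (rule integral_mono)
      show "integrable lborel (\<lambda>x. indicator S x *\<^sub>R (1 / m))"
        unfolding S_def using emeasure_lborel_ball_finite[of "(1 / 2) *\<^sub>R e" "1 / 2"]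
        by (intro integrable_scaleR_left integrable_real_indicator) auto
      show "integrable lborel (\<lambda>x. indicator (half_space e) x *\<^sub>R f B x)"
        using Iint[of B] by (simp add: set_integrable_def)
      fix x
      have "1 / m \<le> f B x" if "x \<in> S"
      proof -
        have "(1 / m) powr (1 / q) = \<kappa> * (B - K)" using \<kappa> by (simp add: B_def)
        also have "\<dots> \<le> \<kappa> * max (B - (norm (x + h *\<^sub>R e))\<^sup>2) 0"
          using S(2)[OF that] \<kappa> by (intro mult_left_mono) auto
        finally have "((1 / m) powr (1 / q)) powr q \<le> f B x"
          unfolding f_def using q \<kappa> m by (intro powr_mono2) auto
        then show ?thesis using q m by (simp add: powr_powr)
      qed
      then show "indicator S x *\<^sub>R (1 / m) \<le> indicator (half_space e) x *\<^sub>R f B x"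
        using S(1) by (auto split: split_indicator simp: f_def)
    qed
    finally show ?thesis .
  qed
  moreover have "I 0 = 0"
  proof -
    have "max (0 - (norm (x + h *\<^sub>R e))\<^sup>2) 0 = 0" for x :: 'a by (simp add: max_def)
    then show ?thesis by (simp add: I_def f_def set_lebesgue_integral_def)
  qed
  moreover have "continuous_on {0..B} I"
    unfolding continuous_on_sequentially comp_def
  proof (intro allI ballI impI, elim conjE)
    fix b \<beta> assume \<beta>: "\<beta> \<in> {0..B}" and b: "\<forall>n. b n \<in> {0..B}" "b \<longlonglongrightarrow> \<beta>"
    show "(\<lambda>n. I (b n)) \<longlonglongrightarrow> I \<beta>"
      unfolding I_def set_lebesgue_integral_def
    proof (rule integral_dominated_convergence[OF bm bm])
      show "integrable lborel (\<lambda>x. indicator (half_space e) x *\<^sub>R f B x)"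
        using Iint[of B] by (simp add: set_integrable_def)
      show "AE x in lborel. (\<lambda>n. indicator (half_space e) x *\<^sub>R f (b n) x)
          \<longlonglongrightarrow> indicator (half_space e) x *\<^sub>R f \<beta> x"
        by (rule AE_I2) (rule tendsto_scaleR[OF tendsto_const fcont[OF b(2)]])
      fix n
      have "b n \<le> B" using b(1) by auto
      then have "f (b n) x \<le> f B x" for x
        unfolding f_def using q \<kappa> by (intro powr_mono2 mult_left_mono max.mono) auto
      then show "AE x in lborel. norm (indicator (half_space e) x *\<^sub>R f (b n) x)
          \<le> indicator (half_space e) x *\<^sub>R f B x"
        by (intro AE_I2) (auto split: split_indicator simp: f_def)
    qed
  qed
  ultimately obtain \<beta> where "I \<beta> = 1"
    using IVT'[of I 0 1 B] B by auto
  then show ?thesis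
    by (auto simp: extremal_normalized_def I_def f_def q_def \<kappa>_def)
qed

lemma extremal_normalized_mass:
  fixes e :: "'a::euclidean_space"
  assumes p: "0 < p" "p < 1" and n: "extremal_normalized p h e \<beta>"
  shows "0 < (LINT x:half_space e|lborel. max 0 (\<beta> - (norm (x + h *\<^sub>R e))\<^sup>2) powr (2 * p / (1 - p)))"
proof -
  have "(LINT x:half_space e|lborel. ((1 - p) / (2 * p) * max (\<beta> - (norm (x + h *\<^sub>R e))\<^sup>2) 0) powr (2 * p / (1 - p))) =
      (LINT x:half_space e|lborel. ((1 - p) / (2 * p)) powr (2 * p / (1 - p)) * max 0 (\<beta> - (norm (x + h *\<^sub>R e))\<^sup>2) powr (2 * p / (1 - p)))"
    using p by (intro set_lebesgue_integral_cong_on) (subst powr_mult, auto simp: max.commute)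
  then have "1 = ((1 - p) / (2 * p)) powr (2 * p / (1 - p)) *
      (LINT x:half_space e|lborel. max 0 (\<beta> - (norm (x + h *\<^sub>R e))\<^sup>2) powr (2 * p / (1 - p)))"
    using n by (simp add: extremal_normalized_def)
  then show ?thesis
    by (metis not_less zero_less_one mult_nonneg_nonpos powr_ge_zero)
qed

text \<open>The integrand is monotone in \<open>\<beta>\<close>, and strictly so wherever it is
  positive; equal integrals would force the smaller one to vanish almost everywhere, against its
  integral 1. Uniqueness lets constants built from one normalised \<open>\<beta>\<close> serve for
  every such \<open>\<beta>\<close> in the theorem.\<close>

lemma extremal_normalized_unique:
  fixes e :: "'a::euclidean_space"
  assumes e: "e \<in> Basis" and p: "0 < p" "p < 1" and n: "extremal_normalized p h e \<beta>" "extremal_normalized p h e \<beta>'"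
  shows "\<beta> = \<beta>'"
proof -
  define q where "q = 2 * p / (1 - p)"
  define \<kappa> where "\<kappa> = (1 - p) / (2 * p)"
  have q: "0 < q" and \<kappa>: "0 < \<kappa>" using p by (auto simp: q_def \<kappa>_def)
  define f where "f \<beta> x = indicator (half_space e) x *\<^sub>R (\<kappa> * max (\<beta> - (norm (x + h *\<^sub>R e))\<^sup>2) 0) powr q" for \<beta> and x
  have int: "integrable lborel (f \<beta>)" for \<beta>
    using barenblatt_integrable[OF e q, of "\<lambda>_. \<kappa> powr q" \<beta> h] \<kappa>
    by (simp add: powr_mult max.commute mult.commute f_def[abs_def] set_integrable_def)
  have *: False if lt: "\<beta> < \<beta>'" and 1: "(LINT x|lborel. f \<beta> x) = 1" "(LINT x|lborel. f \<beta>' x) = 1" for \<beta> \<beta>'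
  proof -
    have "f \<beta> x \<le> f \<beta>' x" for x
      unfolding f_def using lt \<kappa> q by (intro scaleR_left_mono powr_mono2 mult_left_mono max.mono) auto
    moreover have "(LINT x|lborel. f \<beta>' x - f \<beta> x) = 0"
      using int 1 by simp
    ultimately have "AE x in lborel. f \<beta>' x - f \<beta> x = 0"
      using int by (subst (asm) integral_nonneg_eq_0_iff_AE) auto
    then have "AE x in lborel. f \<beta> x = 0"
    proof eventually_elim
      case (elim x)
      show ?case
      proof (rule ccontr)
        assume nz: "f \<beta> x \<noteq> 0"
        then have x: "x \<in> half_space e" "0 < \<beta> - (norm (x + h *\<^sub>R e))\<^sup>2"
          using q by (auto simp: f_def max_def split: split_indicator_asm if_splits)
        then have "(\<kappa> * max (\<beta> - (norm (x + h *\<^sub>R e))\<^sup>2) 0) powr q < (\<kappa> * max (\<beta>' - (norm (x + h *\<^sub>R e))\<^sup>2) 0) powr q"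
          using lt \<kappa> q by (intro powr_less_mono2 mult_strict_left_mono) auto
        then show False using elim x by (simp add: f_def)
      qed
    qed
    then have "(LINT x|lborel. f \<beta> x) = 0"
      by (rule integral_eq_zero_AE)
    with 1 show False by simp
  qed
  have "(LINT x|lborel. f \<beta> x) = 1" "(LINT x|lborel. f \<beta>' x) = 1"
    using n by (auto simp: extremal_normalized_def f_def set_lebesgue_integral_def q_def \<kappa>_def)
  then show ?thesis
    using *[of \<beta> \<beta>'] *[of \<beta>' \<beta>] by (cases \<beta> \<beta>' rule: linorder_cases) auto
qed

text \<open>These identities verify the equality case. The first splits \<open>\<beta>\<close> as V
  plus the squared distance on the support of V; the second integrates the gradient of
  \<open>V powr (q + 1)\<close> against x + h e by parts, through the dilation and the normal
  derivative identities.\<close>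

lemma barenblatt_identities:
  fixes e :: "'a::euclidean_space" and \<beta> h q c :: real
  assumes e: "e \<in> Basis" and c: "0 < c"
    "distr (hyperplane_measure e \<Otimes>\<^sub>M lborel) borel (\<lambda>(z, t). z + t *\<^sub>R e) = density lborel (\<lambda>_. ennreal c)"
    and q: "0 < q"
  defines "V \<equiv> \<lambda>x. max 0 (\<beta> - (norm (x + h *\<^sub>R e))\<^sup>2)"
  defines "M \<equiv> LINT x:half_space e|lborel. V x powr q"
    and "X \<equiv> LINT x:half_space e|lborel. V x powr (q + 1)"
    and "J \<equiv> LINT x:half_space e|lborel. V x powr q * (norm (x + h *\<^sub>R e))\<^sup>2"
    and "Y \<equiv> LINT x:half_space_bd e|hausdorff_measure (DIM('a) - 1). V x powr (q + 1)"
  shows "\<beta> * M = X + J" and "h / c * Y = 2 * (q + 1) * J - real DIM('a) * X"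
    and "0 < M \<Longrightarrow> 0 < J" and "0 \<le> X"
proof -
  let ?H = "half_space e" and ?R = "\<bar>h\<bar> + sqrt \<bar>\<beta>\<bar>"
  have iM: "set_integrable lborel ?H (\<lambda>x. V x powr q)"
    using barenblatt_integrable[OF e q, of "\<lambda>_. 1" \<beta> h] by (simp add: V_def)
  have iX: "set_integrable lborel ?H (\<lambda>x. V x powr (q + 1))"
    using barenblatt_integrable[OF e, of "q + 1" "\<lambda>_. 1" \<beta> h] q by (simp add: V_def)
  have iJ: "set_integrable lborel ?H (\<lambda>x. V x powr q * (norm (x + h *\<^sub>R e))\<^sup>2)"
    unfolding V_def by (intro barenblatt_integrable[OF e q] continuous_intros)
  have "\<beta> * M = (LINT x:?H|lborel. V x powr (q + 1) + V x powr q * (norm (x + h *\<^sub>R e))\<^sup>2)"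
    unfolding M_def set_integral_mult_right[symmetric]
    using q by (intro set_lebesgue_integral_cong_on) (auto simp: V_def max_def powr_add algebra_simps)
  then show "\<beta> * M = X + J"
    using iX iJ by (simp add: X_def J_def set_integral_add(2))
  show "0 \<le> X"
    unfolding X_def set_lebesgue_integral_def by (intro Bochner_Integration.integral_nonneg) auto
  have nnJ: "0 \<le> indicator ?H x *\<^sub>R (V x powr q * (norm (x + h *\<^sub>R e))\<^sup>2)" for x by simp
  show "0 < J" if "0 < M"
  proof (rule ccontr)
    assume "\<not> 0 < J"
    moreover have "0 \<le> J"
      unfolding J_def set_lebesgue_integral_def by (intro Bochner_Integration.integral_nonneg nnJ)
    ultimately have "J = 0" by simp
    then have "AE x in lborel. indicator ?H x *\<^sub>R (V x powr q * (norm (x + h *\<^sub>R e))\<^sup>2) = 0"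
      unfolding J_def set_lebesgue_integral_def using iJ
      by (subst (asm) integral_nonneg_eq_0_iff_AE) (auto simp: set_integrable_def)
    \<comment> \<open>The squared distance can vanish only at the centre - h e, which lies in this
      null hyperplane; so a vanishing \<open>J\<close> would give a vanishing mass.\<close>
    moreover have "AE x in lborel. x \<bullet> e \<noteq> - h"
      by (rule AE_lborel_inner_neq[OF e])
    ultimately have "AE x in lborel. indicator ?H x *\<^sub>R V x powr q = 0"
    proof eventually_elim
      case (elim x)
      have "(x + h *\<^sub>R e) \<bullet> e \<noteq> 0"
        using elim(2) e by (simp add: inner_add_left inner_Basis)
      then have "x + h *\<^sub>R e \<noteq> 0" by auto
      then show ?case using elim(1) by auto
    qed
    then have "M = 0"
      unfolding M_def set_lebesgue_integral_def by (rule integral_eq_zero_AE)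
    with that show False by simp
  qed
  define F where "F x = V x powr (q + 1)" for x
  define G where "G x = (- 2 * (q + 1) * V x powr q) *\<^sub>R (x + h *\<^sub>R e)" for x
  have V0: "V x = 0" if "?R \<le> norm x" for x
    unfolding V_def using barenblatt_vanishes[OF e that] by simp
  have F: "(F has_derivative (\<lambda>v. G x \<bullet> v)) (at x within ?H)" for x
    using max_quadratic_gradient[OF q, of \<beta> 1 "- h *\<^sub>R e" x ?H] by (simp add: F_def[abs_def] G_def V_def)
  have cG: "continuous_on ?H G"
  proof -
    have "continuous_on ?H (\<lambda>x. V x powr q)"
      unfolding V_def using q by (intro continuous_on_powr' continuous_intros) auto
    then show ?thesis
      unfolding G_def
      by (intro continuous_on_scaleR continuous_on_mult continuous_on_const continuous_on_add continuous_on_id)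
  qed
  have FG0: "F x = 0" "G x = 0" if "?R \<le> norm x" for x
    using V0[OF that] by (simp_all add: F_def G_def)
  have 1: "(LINT x:?H|lborel. G x \<bullet> x) = - real DIM('a) * X"
    unfolding X_def F_def[symmetric]
    by (rule euler_dilation_identity[OF closed_half_space convex_half_space half_space_cone F cG FG0])
  have 2: "c * (LINT x:?H|lborel. G x \<bullet> e) = - Y"
    unfolding Y_def F_def[symmetric]
    by (rule half_space_normal_derivative_integral[OF e c F cG FG0])
  have iG: "set_integrable lborel ?H (\<lambda>x. G x \<bullet> x)" "set_integrable lborel ?H (\<lambda>x. G x \<bullet> e)"
    using FG0 by (auto intro!: set_integrable_compact_support[where R = ?R, OF closed_half_space] continuous_intros cG)
  have "- 2 * (q + 1) * J = (LINT x:?H|lborel. G x \<bullet> x + h * (G x \<bullet> e))"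
    unfolding J_def set_integral_mult_right[symmetric]
    by (intro set_lebesgue_integral_cong_on)
      (simp add: G_def power2_norm_eq_inner inner_add_right algebra_simps)
  also have "\<dots> = - real DIM('a) * X + h * (- Y / c)"
  proof -
    have "(LINT x:?H|lborel. G x \<bullet> e) = - Y / c"
      using 2 c(1) by (simp add: field_simps)
    then show ?thesis
      using iG 1 by (simp add: set_integral_add(2))
  qed
  finally show "h / c * Y = 2 * (q + 1) * J - real DIM('a) * X"
    by (simp add: algebra_simps)
qed

text \<open>Comparison of logarithms, where the exponents fit together because 1 / \<delta> = q / (q
  + d) and q / (2 p) = 1 + q / 2. This is how the ratio of norms with its power 1 / \<delta> emerges
  from the scale \<open>s\<close> fixed by the mass relation.\<close>

lemma scaling_exponent:
  fixes p q d \<delta> M D A s :: real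
  assumes p: "0 < p" "p < 1" and q: "q = 2 * p / (1 - p)" and \<delta>: "\<delta> = 1 + d * (1 - p) / (2 * p)" and d: "0 \<le> d"
    and pos: "0 < M" "0 < D" "0 < A"
    and s: "s = ((D / sqrt M) powr q * A / M) powr (1 / (q + d))"
  shows "1 / s = A powr (- 1 / (q + d)) * (M powr (1 / (2 * p)) / D) powr (1 / \<delta>)"
proof -
  have q0: "0 < q" using p by (simp add: q)
  have "\<delta> = (q + d) / q"
    using p by (simp add: \<delta> q field_simps)
  then have \<delta>': "1 / \<delta> = q * (1 / (q + d))" by simp
  have qp: "q * (1 / (2 * p)) = 1 + q / 2"
    using p by (simp add: q field_simps)
  have sp: "0 < s" using pos by (simp add: s)
  define E where "E = 1 / (q + d)"
  have "ln (1 / s) = - (E * (q * (ln D - ln M / 2) + ln A - ln M))"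
    using pos sp by (simp add: s ln_div ln_mult ln_powr ln_sqrt E_def)
  also have "\<dots> = - E * ln A + E * (1 + q / 2) * ln M - E * q * ln D"
    by (simp add: algebra_simps)
  also have "E * (1 + q / 2) * ln M = E * q * (1 / (2 * p)) * ln M"
    by (simp add: qp[symmetric])
  also have "- E * ln A + E * q * (1 / (2 * p)) * ln M - E * q * ln D =
      ln (A powr (- 1 / (q + d)) * (M powr (1 / (2 * p)) / D) powr (1 / \<delta>))"
    unfolding \<delta>' using pos by (simp add: ln_div ln_mult ln_powr E_def[symmetric]) (simp add: E_def algebra_simps)
  finally show ?thesis
    using sp pos by (subst (asm) ln_inj_iff) auto
qed

theorem theorem2p11:
  fixes p \<delta> :: real and e :: "'a::euclidean_space"
  assumes "0 < p" and "p < 1"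
    and "\<delta> = 1 + real DIM('a) * (1 - p) / (2 * p)"
    and "e \<in> Basis"
  shows "\<forall>h::real. \<exists>a>0. \<exists>b>0.
    (\<forall>w. smooth_on (half_space e) w \<and> (\<forall>x\<in>half_space e. w x > 0) \<and> trace_norms_finite p e w \<longrightarrow>
       trace_GN_lhs p e w \<le> trace_GN_rhs p \<delta> h a b e w) \<and>
    (\<exists>\<beta>. extremal_normalized p h e \<beta>) \<and>
    (\<forall>\<beta>. extremal_normalized p h e \<beta> \<longrightarrow>
       trace_GN_lhs p e (extremal p h e \<beta>) = trace_GN_rhs p \<delta> h a b e (extremal p h e \<beta>))"
proof
  fix h :: real
  note p = assms(1,2) and \<delta> = assms(3) and e = assms(4)
  let ?H = "half_space e" and ?hm = "hausdorff_measure (DIM('a) - 1) :: 'a measure" and ?d = "real DIM('a)"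
  define q where "q = 2 * p / (1 - p)"
  have q: "0 < q" using p by (simp add: q_def)
  have q1: "(1 + p) / (1 - p) = q + 1" using p by (simp add: q_def field_simps)
  obtain c where c: "0 < c"
    "distr (hyperplane_measure e \<Otimes>\<^sub>M lborel) borel (\<lambda>(z, t). z + t *\<^sub>R e) = density lborel (\<lambda>_. ennreal c)"
    using hyperplane_measure_product[OF e] by blast
  obtain \<beta> where \<beta>: "extremal_normalized p h e \<beta>"
    using extremal_normalized_exists[OF e p] by blast
  define V where "V x = max 0 (\<beta> - (norm (x + h *\<^sub>R e))\<^sup>2)" for x
  define M1 where "M1 = (LINT x:?H|lborel. V x powr q)"
  define X1 where "X1 = (LINT x:?H|lborel. V x powr (q + 1))"
  define J where "J = (LINT x:?H|lborel. V x powr q * (norm (x + h *\<^sub>R e))\<^sup>2)"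
  define Y1 where "Y1 = (LINT x:half_space_bd e|?hm. V x powr (q + 1))"
  have M1: "0 < M1"
    using extremal_normalized_mass[OF p \<beta>] by (simp add: M1_def V_def q_def)
  have ids: "\<beta> * M1 = X1 + J" "h / c * Y1 = 2 * (q + 1) * J - ?d * X1" "0 < J" "0 \<le> X1"
    using barenblatt_identities[OF e c q, where \<beta> = \<beta> and h = h] M1
    by (simp_all add: M1_def X1_def J_def Y1_def V_def)
  \<comment> \<open>The gradient norm of the extremal: differentiating the power 1 / (1 - p) of V
    produces 2 / (1 - p) times \<open>V powr (p / (1 - p))\<close> times the distance to the
    centre.\<close>
  define D1 where "D1 = 2 / (1 - p) * sqrt J"
  have D1: "0 < D1" "(1 - p)\<^sup>2 / 4 * D1\<^sup>2 = J"
    using p ids(3) by (auto simp: D1_def power_mult_distrib power_divide)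
  \<comment> \<open>Chosen so that D / sqrt M * \<rho> compares the ratio of gradient norm to root
    of mass for \<open>w\<close> with the same ratio for the extremal, where it equals 1.\<close>
  define \<rho> where "\<rho> = sqrt M1 / D1"
  have \<rho>: "0 < \<rho>" using M1 D1 by (simp add: \<rho>_def)
  \<comment> \<open>With the scaling chosen below, the mass term and the gradient term are both
    multiples of D * sqrt M; \<open>a0\<close> is the sum of their coefficients.\<close>
  define a0 where "a0 = \<rho> * ((q + 1) * \<beta> - X1 / M1) + (q + 1) * ((1 - p)\<^sup>2 / 4) / \<rho>"
  have a0: "\<rho> * z * ((q + 1) * \<beta> - X1 / M1) + (q + 1) * ((1 - p)\<^sup>2 / 4) * (z / \<rho>) = a0 * z" for z
  proof -
    have "\<rho> * z * u + v * (z / \<rho>) = (\<rho> * u + v / \<rho>) * z" for u v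
      by (simp add: algebra_simps)
    then show ?thesis unfolding a0_def .
  qed
  define A where "A = \<rho> powr q * M1"
  have A: "0 < A" using \<rho> M1 by (simp add: A_def)
  \<comment> \<open>Collects the factor q + d from the left side and the power of \<open>A\<close>
    from the scale; the same \<open>C\<close> multiplies the gradient term and the trace
    term.\<close>
  define C where "C = A powr (- 1 / (q + ?d)) / (q + ?d)"
  have C: "0 < C" using A q by (simp add: C_def)
  have qd: "0 < q + ?d" using q by simp
  have "0 < a0"
  proof -
    have "X1 / M1 = \<beta> - J / M1" using ids(1) M1 by (simp add: field_simps)
    then have "(q + 1) * \<beta> - X1 / M1 = q * \<beta> + J / M1" by (simp add: algebra_simps)
    \<comment> \<open>Needed for \<open>a0 > 0\<close>; it follows from
      \<open>\<beta> * M1 = X1 + J\<close> with a positive right side.\<close>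
    moreover have "0 < \<beta>" using ids M1 by (metis add_nonneg_pos zero_less_mult_pos2)
    ultimately have "0 < (q + 1) * \<beta> - X1 / M1" using q ids(3) M1 by (simp add: add_pos_pos)
    then show ?thesis unfolding a0_def using \<rho> q p by (intro add_pos_pos mult_pos_pos divide_pos_pos) auto
  qed
  then have ab: "0 < a0 * C" "0 < C / c" using C c(1) by auto
  have two_p_powr: "(M powr (1 / (2 * p))) powr p = sqrt M" if "0 \<le> M" for M :: real
    using p that by (simp add: powr_powr powr_half_sqrt)
  have ineq: "trace_GN_lhs p e w \<le> trace_GN_rhs p \<delta> h (a0 * C) (C / c) e w"
    if sm: "smooth_on ?H w" and wp: "\<forall>x\<in>?H. w x > 0" and fin: "trace_norms_finite p e w" for w :: "'a \<Rightarrow> real"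
  proof -
    define g where "g = grad_on ?H w"
    have w: "(w has_derivative (\<lambda>v. g x \<bullet> v)) (at x within ?H)" if "x \<in> ?H" for x
      unfolding g_def by (rule smooth_on_gradient(1)[OF sm that])
    have cg: "continuous_on ?H g" unfolding g_def by (rule smooth_on_gradient(2)[OF sm])
    have wpos: "0 < w x" if "x \<in> ?H" for x using wp that by blast
    have bdH: "x \<in> ?H" if "x \<in> half_space_bd e" for x
      using that by (simp add: half_space_def half_space_bd_def)
    have nw: "norm (w x) powr r = w x powr r" if "x \<in> ?H" for x r
      using wpos[OF that] by simp
    have intw: "set_integrable lborel ?H (\<lambda>x. norm (w x) powr r) = set_integrable lborel ?H (\<lambda>x. w x powr r)"
      "set_integrable ?hm (half_space_bd e) (\<lambda>x. norm (w x) powr r) = set_integrable ?hm (half_space_bd e) (\<lambda>x. w x powr r)"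
      "(LINT x:?H|lborel. norm (w x) powr r) = (LINT x:?H|lborel. w x powr r)"
      "(LINT x:half_space_bd e|?hm. norm (w x) powr r) = (LINT x:half_space_bd e|?hm. w x powr r)" for r
      by (rule set_integrable_cong_on[OF nw] set_integrable_cong_on[OF nw[OF bdH]]
          set_lebesgue_integral_cong_on[OF nw] set_lebesgue_integral_cong_on[OF nw[OF bdH]]; assumption)+
    have iX: "set_integrable lborel ?H (\<lambda>x. w x powr (1 + p))"
      and iM: "set_integrable lborel ?H (\<lambda>x. w x powr (2 * p))"
      and iD: "set_integrable lborel ?H (\<lambda>x. (norm (g x))\<^sup>2)"
      and iY: "set_integrable ?hm (half_space_bd e) (\<lambda>x. w x powr (1 + p))"
      using fin unfolding trace_norms_finite_def Lq_finite_def intw g_def by simp_all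
    define M where "M = (LINT x:?H|lborel. w x powr (2 * p))"
    define X where "X = (LINT x:?H|lborel. w x powr (1 + p))"
    define Y where "Y = (LINT x:half_space_bd e|?hm. w x powr (1 + p))"
    define D2 where "D2 = (LINT x:?H|lborel. (norm (g x))\<^sup>2)"
    have M: "0 < M" and X: "0 < X"
      unfolding M_def X_def
      by (rule half_space_integral_pos[OF e iM] half_space_integral_pos[OF e iX]; simp add: wpos less_imp_neq[OF wpos, symmetric])+
    note two = trace_inequality_two_parameters[OF e c w cg wpos p q_def _ _ iX iM iD iY, folded M_def X_def Y_def D2_def]
    \<comment> \<open>The scaling divides by the gradient norm, so it must not vanish. If it did,
      the inequality with h = 0 would lose its gradient and trace terms, and its right side would be
      at most a multiple of the free amplitude \<open>k\<close>, hence too small.\<close>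
    have D2: "0 < D2"
    proof (rule ccontr)
      assume "\<not> 0 < D2"
      moreover have "0 \<le> D2"
        unfolding D2_def set_lebesgue_integral_def by (intro Bochner_Integration.integral_nonneg) auto
      ultimately have D20: "D2 = 0" by simp
      obtain \<beta>' where \<beta>': "extremal_normalized p 0 e \<beta>'"
        using extremal_normalized_exists[OF e p] by blast
      define M0 where "M0 = (LINT x:?H|lborel. max 0 (\<beta>' - (norm (x + 0 *\<^sub>R e))\<^sup>2) powr q)"
      define X0 where "X0 = (LINT x:?H|lborel. max 0 (\<beta>' - (norm (x + 0 *\<^sub>R e))\<^sup>2) powr (q + 1))"
      have M0: "0 < M0" using extremal_normalized_mass[OF p \<beta>'] by (simp add: M0_def q_def)
      have X0: "0 \<le> X0"
        unfolding X0_def set_lebesgue_integral_def by (intro Bochner_Integration.integral_nonneg) auto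
      \<comment> \<open>Makes the upper bound on the right exactly half of the left side;
        \<open>\<bar>\<beta>'\<bar> + 1\<close> replaces \<open>\<beta>'\<close> to have a positive
        divisor. The scale \<open>s\<close> is then dictated by the mass relation.\<close>
      define k where "k = (q + ?d) * X / (2 * (q + 1) * (\<bar>\<beta>'\<bar> + 1) * M)"
      have k: "0 < k" unfolding k_def using q X M qd by (intro divide_pos_pos mult_pos_pos) auto
      define s where "s = (k powr q * M0 / M) powr (1 / ?d)"
      have s: "0 < s" using k M M0 by (simp add: s_def)
      have "s ^ DIM('a) = k powr q * M0 / M"
        using s k M M0 by (simp add: powr_realpow[symmetric] s_def powr_powr)
      then have "k powr q * M0 / s ^ DIM('a) = M" using k M M0 by simp
      then have "(q + ?d) * X \<le> (q + 1) * (k * \<beta>' * M + (1 - p)\<^sup>2 * D2 / (4 * k * s\<^sup>2)) - 0 / (s * c) * Y - k * (M * X0 / M0)"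
        unfolding M0_def X0_def by (intro two k s M)
      also have "\<dots> \<le> (q + 1) * (k * \<beta>' * M)"
        using D20 k M X0 M0 by simp
      also have "\<dots> \<le> (q + 1) * (k * (\<bar>\<beta>'\<bar> + 1) * M)"
        using q k M by (intro mult_left_mono mult_right_mono) auto
      also have "\<dots> = (q + ?d) * X / 2"
      proof -
        have cancel: "a * (z / (2 * a * b * m) * b * m) = z / 2" if "a \<noteq> 0" "b \<noteq> 0" "m \<noteq> 0" for a b m z :: real
          using that by simp
        show ?thesis unfolding k_def by (rule cancel) (use q M in linarith)+
      qed
      finally show False using X qd by (simp add: mult_pos_pos not_le)
    qed
    define D where "D = sqrt D2"
    have D: "0 < D" "D\<^sup>2 = D2" using D2 by (auto simp: D_def)
    \<comment> \<open>The product k s for which the rescaled extremal, once its mass equals that of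
      \<open>w\<close>, has the same gradient norm as \<open>w\<close>.\<close>
    define r where "r = D / sqrt M * \<rho>"
    have r: "0 < r" using D M \<rho> by (simp add: r_def)
    \<comment> \<open>Solution of the mass relation after substituting k = r / s, which reads s^(q +
      d) = r^q * M1 / M.\<close>
    define s where "s = ((D / sqrt M) powr q * A / M) powr (1 / (q + ?d))"
    have s: "0 < s" using D M A by (simp add: s_def)
    define k where "k = r / s"
    have k: "0 < k" using r s by (simp add: k_def)
    have rA: "r powr q * M1 = (D / sqrt M) powr q * A"
      by (simp only: r_def A_def powr_mult mult.assoc)
    have "s powr q * s ^ DIM('a) = s powr (q + ?d)"
      using s by (simp add: powr_add powr_realpow)
    also have "\<dots> = (D / sqrt M) powr q * A / M"
      using D M A q by (simp add: s_def powr_powr)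
    finally have sq: "s powr q * s ^ DIM('a) = r powr q * M1 / M" by (simp add: rA)
    have "k powr q * M1 / s ^ DIM('a) = r powr q * M1 / (s powr q * s ^ DIM('a))"
      using r s by (simp add: k_def powr_divide)
    also have "\<dots> = M" unfolding sq using r M1 M by simp
    finally have kM: "k powr q * M1 / s ^ DIM('a) = M" .
    have "(q + ?d) * X \<le> (q + 1) * (k * \<beta> * M + (1 - p)\<^sup>2 * D2 / (4 * k * s\<^sup>2)) - h / (s * c) * Y - k * (M * X1 / M1)"
      using kM unfolding M1_def X1_def V_def by (intro two k s M)
    \<comment> \<open>The point of the substitution k = r / s: \<open>k\<close>,
      \<open>1 / (k * s\<^sup>2)\<close> and \<open>h / s\<close> all contain exactly one factor
      \<open>1 / s\<close>.\<close>
    also have "\<dots> = 1 / s * (r * M * ((q + 1) * \<beta> - X1 / M1) + (q + 1) * ((1 - p)\<^sup>2 / 4) * (D2 / r) - h / c * Y)"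
      using r s c(1) by (simp add: k_def field_simps power2_eq_square)
    also have "r * M = \<rho> * (D * sqrt M)"
      using M by (simp add: r_def real_div_sqrt field_simps)
    also have "D2 / r = D * sqrt M / \<rho>"
      using D \<rho> M by (simp add: r_def D(2)[symmetric] power2_eq_square)
    also have "\<rho> * (D * sqrt M) * ((q + 1) * \<beta> - X1 / M1) + (q + 1) * ((1 - p)\<^sup>2 / 4) * (D * sqrt M / \<rho>) = a0 * (D * sqrt M)"
      by (rule a0)
    finally have "X \<le> 1 / s * (a0 * (D * sqrt M) - h / c * Y) / (q + ?d)"
      unfolding pos_le_divide_eq[OF qd] mult.commute[of X] .
    also have "1 / s = A powr (- 1 / (q + ?d)) * (M powr (1 / (2 * p)) / D) powr (1 / \<delta>)"
      by (rule scaling_exponent[OF p q_def \<delta> _ M D(1) A s_def]) simp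
    finally have main: "X \<le> (a0 * C * D * sqrt M - h * (C / c) * Y) * (M powr (1 / (2 * p)) / D) powr (1 / \<delta>)"
      by (simp add: C_def algebra_simps diff_divide_distrib)
    have nX: "Lq_norm lborel ?H (1 + p) w powr (1 + p) = X"
      unfolding X_def intw(3)[symmetric] using p by (intro Lq_norm_powr) simp
    have nY: "Lq_norm ?hm (half_space_bd e) (1 + p) w powr (1 + p) = Y"
      unfolding Y_def intw(4)[symmetric] using p by (intro Lq_norm_powr) simp
    have nM: "Lq_norm lborel ?H (2 * p) w = M powr (1 / (2 * p))"
      unfolding Lq_norm_def M_def intw ..
    have nD: "Lq_norm lborel ?H 2 (grad_on ?H w) = D"
      unfolding Lq_norm_def g_def[symmetric] D_def D2_def by (simp add: powr_half_sqrt D2[unfolded D2_def] less_imp_le)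
    show ?thesis
      unfolding trace_GN_lhs_def trace_GN_rhs_def nX nY nM nD
      using main M by (simp add: two_p_powr)
  qed
  have eq: "trace_GN_lhs p e (extremal p h e \<beta>) = trace_GN_rhs p \<delta> h (a0 * C) (C / c) e (extremal p h e \<beta>)"
  proof -
    let ?w = "extremal p h e \<beta>"
    have w: "?w x = V x powr (1 / (1 - p))" for x
      by (simp add: extremal_def V_def max.commute)
    have wr: "norm (?w x) powr r = V x powr (r / (1 - p))" for x r
      by (simp add: w powr_powr)
    have nX: "Lq_norm lborel ?H (1 + p) ?w powr (1 + p) = X1"
      unfolding X1_def q1[symmetric] wr[symmetric] using p by (intro Lq_norm_powr) simp
    have nY: "Lq_norm ?hm (half_space_bd e) (1 + p) ?w powr (1 + p) = Y1"
      unfolding Y1_def q1[symmetric] wr[symmetric] using p by (intro Lq_norm_powr) simp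
    have nM: "Lq_norm lborel ?H (2 * p) ?w = M1 powr (1 / (2 * p))"
      unfolding Lq_norm_def M1_def wr q_def ..
    have nD: "Lq_norm lborel ?H 2 (grad_on ?H ?w) = D1"
    proof -
      \<comment> \<open>The extremal is the power q' + 1 of V, so the gradient formula applies with
        \<open>q'\<close>; squaring it gives the power q, since 2 q' = q.\<close>
      define q' where "q' = p / (1 - p)"
      have q': "0 < q'" "q' + 1 = 1 / (1 - p)" "2 * q' = q" using p by (auto simp: q'_def q_def field_simps)
      define G where "G x = (- 2 * (q' + 1) * V x powr q') *\<^sub>R (x + h *\<^sub>R e)" for x
      have d: "(?w has_derivative (\<lambda>v. G x \<bullet> v)) (at x)" for x
        using max_quadratic_gradient[OF q'(1), of \<beta> 1 "- h *\<^sub>R e" x UNIV]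
        by (simp add: G_def V_def extremal_def[abs_def] q'(2) max.commute)
      have "(LINT x:?H|lborel. norm (grad_on ?H ?w x) powr 2) = (LINT x:?H|lborel. 4 / (1 - p)\<^sup>2 * (V x powr q * (norm (x + h *\<^sub>R e))\<^sup>2))"
      proof (rule set_lebesgue_integral_cong_on)
        fix x assume x: "x \<in> ?H"
        have "norm (grad_on ?H ?w x) powr 2 = (norm (grad_on ?H ?w x))\<^sup>2"
          by simp
        moreover have "grad_on ?H ?w x = G x"
          by (rule grad_on_half_space[OF e x has_derivative_at_withinI[OF d]])
        moreover have "norm (G x) = 2 * (1 / (1 - p)) * V x powr q' * norm (x + h *\<^sub>R e)"
          using p by (simp add: G_def q'(2) abs_mult)
        moreover have "(V x powr q')\<^sup>2 = V x powr q"
          by (simp add: power2_eq_square powr_add[symmetric] q'(3)[symmetric])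
        ultimately show "norm (grad_on ?H ?w x) powr 2 = 4 / (1 - p)\<^sup>2 * (V x powr q * (norm (x + h *\<^sub>R e))\<^sup>2)"
          by (simp only:) (simp add: power_mult_distrib power_divide)
      qed
      also have "\<dots> = D1\<^sup>2"
        using p ids(3) by (simp add: J_def[symmetric] D1_def power_mult_distrib power_divide)
      finally show ?thesis
        using D1 by (simp add: Lq_norm_def powr_half_sqrt)
    qed
    \<comment> \<open>The same scale evaluated at the extremal; it equals 1, which identifies the
      ratio factor with \<open>1 / (C * (q + d))\<close>.\<close>
    define s where "s = ((D1 / sqrt M1) powr q * A / M1) powr (1 / (q + ?d))"
    have "(D1 / sqrt M1) powr q * A = (D1 / sqrt M1 * \<rho>) powr q * M1"
      by (simp only: A_def powr_mult mult.assoc)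
    also have "D1 / sqrt M1 * \<rho> = 1"
      using D1 M1 by (simp add: \<rho>_def)
    finally have s1: "s = 1" using M1 by (simp add: s_def)
    have "1 / s = A powr (- 1 / (q + ?d)) * (M1 powr (1 / (2 * p)) / D1) powr (1 / \<delta>)"
      by (rule scaling_exponent[OF p q_def \<delta> _ M1 D1(1) A s_def]) simp
    then have CC: "C * (M1 powr (1 / (2 * p)) / D1) powr (1 / \<delta>) = 1 / (q + ?d)"
      using s1 by (simp add: C_def)
    have "a0 * (D1 * sqrt M1) = M1 * ((q + 1) * \<beta> - X1 / M1) + (q + 1) * J"
    proof -
      have "\<rho> * (D1 * sqrt M1) = M1" "D1 * sqrt M1 / \<rho> = D1\<^sup>2"
        using M1 D1 by (auto simp: \<rho>_def power2_eq_square)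
      then show ?thesis
        using a0[of "D1 * sqrt M1"] by (simp only: mult.assoc D1(2))
    qed
    \<comment> \<open>Inserting \<open>\<beta> * M1 = X1 + J\<close> gives q X1 + 2 (q + 1) J, and
      the boundary identity removes the J terms and adds d X1.\<close>
    also have "\<dots> = (q + 1) * (\<beta> * M1) - X1 + (q + 1) * J"
      using M1 by (simp add: algebra_simps)
    finally have "a0 * (D1 * sqrt M1) - h / c * Y1 = (q + ?d) * X1"
      unfolding ids(1,2) by (simp add: algebra_simps)
    then have "X1 = (a0 * (D1 * sqrt M1) - h / c * Y1) * (1 / (q + ?d))"
      using qd by simp
    then have "X1 = (a0 * C * D1 * sqrt M1 - h * (C / c) * Y1) * (M1 powr (1 / (2 * p)) / D1) powr (1 / \<delta>)"
      unfolding CC[symmetric] by (simp add: algebra_simps)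
    then show ?thesis
      unfolding trace_GN_lhs_def trace_GN_rhs_def nX nY nM nD
      using M1 by (simp add: two_p_powr)
  qed
  show "\<exists>a>0. \<exists>b>0.
    (\<forall>w. smooth_on ?H w \<and> (\<forall>x\<in>?H. w x > 0) \<and> trace_norms_finite p e w \<longrightarrow>
       trace_GN_lhs p e w \<le> trace_GN_rhs p \<delta> h a b e w) \<and>
    (\<exists>\<beta>. extremal_normalized p h e \<beta>) \<and>
    (\<forall>\<beta>. extremal_normalized p h e \<beta> \<longrightarrow>
       trace_GN_lhs p e (extremal p h e \<beta>) = trace_GN_rhs p \<delta> h a b e (extremal p h e \<beta>))"
    \<comment> \<open>The constants were built from one normalised \<open>\<beta>\<close>;
      uniqueness extends the equality to all of them.\<close>
    using ab ineq eq \<beta> extremal_normalized_unique[OF e p \<beta>] by blast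
qed

end
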